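(* Let $N_b<N_h$ be fixed integers, $N_l=N_h-N_b$, and $p\in[0,1]$. Under $\mathbb{P}^{n,N_b,N_h,p}$, as $n\to\infty$ the vector $(\Delta_iH^1/n)_{0\le i<N_l}$ converges in distribution to a random vector $D=(D_0,\dots,D_{N_l-1})$ taking values in $\mathrm{Simplex}(N_l)=\{x=(x_i)_{0\le i<N_l}:\sum_ix_i=1,\ x_i\ge0\}$, where $D_{N_l-1}=1-\sum_{i=0}^{N_l-2}D_i$ and $(D_0,\dots,D_{N_l-2})$ has density with respect to Lebesgue measure on $\mathbb{R}^{N_l-1}$ $$f(x_0,\dots,x_{N_l-2})=x_0\,N_b!\,N_h!\sum_{(b_i):\sum_ib_i=N_b}\ \prod_{k\in\mathbb{Z}/N_l\mathbb{Z}}\frac{x_k^{2b_k}}{b_k!\,(b_k+1)!}\ \mathbf{1}_{\{(x_0,\dots,x_{N_l-1})\in\mathrm{Simplex}(N_l)\}},$$ with $x_{N_l-1}=1-\sum_{i<N_l-1}x_i$ and the sum over tuples $(b_i)_{i\in\mathbb{Z}/N_l\mathbb{Z}}$ of nonnegative integers.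
   Context: Golf process on the cycle $\mathbb{Z}/n\mathbb{Z}$ under $\mathbb{P}^{n,N_b,N_h,p}$: initial configuration uniform among assignments with exactly $N_b$ balls, $N_h$ holes, the rest neutral; clocks i.i.d. uniform on $[0,1]$; at its clock time each ball performs an independent random walk (step $+1$ w.p. $p$, $-1$ w.p. $1-p$) stopped at the first not-yet-filled hole, which it fills. $H^1$ is the set of holes never filled. With $\pi:\mathbb{Z}/n\mathbb{Z}\to\{1,\dots,n\}$ the canonical bijection, a set $X$ of size $k$ is listed as $(x_i)_{i\in\mathbb{Z}/k\mathbb{Z}}$ with $\pi(x_1)<\dots<\pi(x_k)=\pi(x_0)$, and $\Delta_iX=\pi(x_{i+1})-\pi(x_i)-1\bmod n$. *)

theory Defs
  imports "HOL-Probability.Probability"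
begin

text \<open>Sites of the cycle Z/nZ are represented by {0..<n}; the canonical bijection
  pi onto {1..n} is taken to be pi(x) = x + 1.\<close>

text \<open>Initial configuration: a pair (B, H) of disjoint subsets of the sites with
  |B| = Nb balls and |H| = Nh holes, chosen uniformly.\<close>
definition golf_configs :: "nat \<Rightarrow> nat \<Rightarrow> nat \<Rightarrow> (nat set \<times> nat set) set" where
  "golf_configs n Nb Nh = {(B, H). B \<subseteq> {..<n} \<and> H \<subseteq> {..<n} \<and> B \<inter> H = {}
      \<and> card B = Nb \<and> card H = Nh}"

definition golf_config :: "nat \<Rightarrow> nat \<Rightarrow> nat \<Rightarrow> (nat set \<times> nat set) pmf" where
  "golf_config n Nb Nh = pmf_of_set (golf_configs n Nb Nh)"

text \<open>Every site carries an independent clock (uniform on [0,1]) and an independent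
  random walk step sequence (True = step +1 with probability p, False = step -1).
  Only the randomness at ball sites is used.\<close>
definition golf_space :: "nat \<Rightarrow> nat \<Rightarrow> nat \<Rightarrow> real \<Rightarrow>
    ((nat set \<times> nat set) \<times> (nat \<Rightarrow> real \<times> bool stream)) measure" where
  "golf_space n Nb Nh p =
     measure_pmf (golf_config n Nb Nh) \<Otimes>\<^sub>M
     (\<Pi>\<^sub>M x\<in>{..<n}. uniform_measure lborel {0..1::real} \<Otimes>\<^sub>M
                       stream_space (measure_pmf (bernoulli_pmf p)))"

definition walk_pos :: "nat \<Rightarrow> nat \<Rightarrow> bool stream \<Rightarrow> nat \<Rightarrow> nat" where
  "walk_pos n b w k = nat ((int b + (\<Sum>j<k. if w !! j then 1 else -1)) mod int n)"

definition golf_hit :: "nat \<Rightarrow> nat set \<Rightarrow> nat set \<Rightarrow> nat \<Rightarrow> bool stream \<Rightarrow> nat set" where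
  "golf_hit n H F b w =
     (if \<exists>k. walk_pos n b w k \<in> H - F
      then {walk_pos n b w (LEAST k. walk_pos n b w k \<in> H - F)} else {})"

definition golf_filled :: "nat \<Rightarrow> nat set \<Rightarrow> nat set \<Rightarrow> (nat \<Rightarrow> real \<times> bool stream) \<Rightarrow> nat set" where
  "golf_filled n B H W =
     foldl (\<lambda>F b. F \<union> golf_hit n H F b (snd (W b))) {}
           (sort_key (\<lambda>b. fst (W b)) (sorted_list_of_set B))"

definition golf_H1 :: "nat \<Rightarrow> (nat set \<times> nat set) \<times> (nat \<Rightarrow> real \<times> bool stream) \<Rightarrow> nat set" where
  "golf_H1 n \<omega> = (case \<omega> of ((B, H), W) \<Rightarrow> H - golf_filled n B H W)"

text \<open>X listed as x_1 < ... < x_k = x_0 (via pi), gap Delta_i X.\<close>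
definition list_elt :: "nat set \<Rightarrow> nat \<Rightarrow> nat" where
  "list_elt X j = sorted_list_of_set X ! ((j + card X - 1) mod card X)"

definition gap :: "nat \<Rightarrow> nat set \<Rightarrow> nat \<Rightarrow> nat" where
  "gap n X i = nat ((int (list_elt X ((i + 1) mod card X)) - int (list_elt X (i mod card X)) - 1)
                    mod int n)"

definition gap_vector :: "nat \<Rightarrow> nat \<Rightarrow> nat \<Rightarrow> (nat set \<times> nat set) \<times> (nat \<Rightarrow> real \<times> bool stream)
    \<Rightarrow> nat \<Rightarrow> real" where
  "gap_vector n Nb Nh \<omega> i =
     (if i < Nh - Nb then real (gap n (golf_H1 n \<omega>) i) / real n else 0)"

definition simplex_point :: "nat \<Rightarrow> (nat \<Rightarrow> real) \<Rightarrow> nat \<Rightarrow> real" where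
  "simplex_point L x i =
     (if i < L - 1 then x i else if i = L - 1 then 1 - (\<Sum>j<L - 1. x j) else 0)"

definition in_simplex :: "nat \<Rightarrow> (nat \<Rightarrow> real) \<Rightarrow> bool" where
  "in_simplex L y \<longleftrightarrow> (\<forall>i<L. y i \<ge> 0) \<and> (\<Sum>i<L. y i) = 1"

definition golf_density :: "nat \<Rightarrow> nat \<Rightarrow> (nat \<Rightarrow> real) \<Rightarrow> real" where
  "golf_density Nb Nh x =
     (let L = Nh - Nb; y = simplex_point L x in
       y 0 * fact Nb * fact Nh *
       (\<Sum>b\<in>{b. b \<in> {..<L} \<rightarrow>\<^sub>E {..Nb} \<and> sum b {..<L} = Nb}.
          \<Prod>k<L. y k ^ (2 * b k) / (fact (b k) * fact (b k + 1)))
       * (if in_simplex L y then 1 else 0))"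

end

theory Submission
  imports Defs "HOL-Number_Theory.Cong" "HOL-Computational_Algebra.Formal_Power_Series"
    "HOL-Combinatorics.Multiset_Permutations"
begin

text \<open>Up to an error \<open>O(1/n)\<close> the balls may be taken independent and uniform on the whole cycle, and
  then the hole set is a Markov chain: a hole set \<open>X\<close> arises from \<open>X \<union> {h}\<close> when a uniform ball ends in
  \<open>h\<close>. If \<open>h\<close> cuts an arc of length \<open>l\<close> into \<open>u + v\<close>, this has probability \<open>a(u, v) / n\<close> with
  \<open>a(u, v) + a(v, u) = l\<close> for every bias of the walk. Since the weight of a hole set is a symmetric
  function of its arc lengths, only the average \<open>l / 2\<close> matters, and the weight after \<open>k\<close> balls is
  \<open>k!\<close> times the \<open>k\<close>-th coefficient of a product over the arcs of power series determined by
  \<open>G_l' = (l / 2) * (\<Sum>u + v = l. G_u * G_v)\<close>. The case of one surviving hole, which is uniform by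
  rotation, evaluates the coefficients: \<open>n * b! * G_n[b] = n^b * binomial n (b + 1)\<close>, of order
  \<open>n^(2 * b) / (b! * (b + 1)!)\<close>. Each gap vector with first gap \<open>d\<close> comes from \<open>d + 1\<close> hole sets, which
  gives the factor \<open>x_0\<close>, and the law of the gaps is a Riemann sum of the density.\<close>

section \<open>Exit probabilities of the walk\<close>

text \<open>The obstacle is that in the true process the balls sit on distinct sites off the holes,
  so their positions depend on each other and on the hole set. Independent uniform balls may share a
  site or start on a hole and fill it at once; then each launch sees only the current hole set. The
  pairs of launch order and hole set of the true process embed into the unrestricted pairs, so a
  bounded test function feels at most its bound times the missing proportion. The clocks matter only
  through their order, a uniform permutation of the ball sites. Of the exit law of the walk only one
  fact is used: leaving an arc upwards and leaving it downwards have total probability one. In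
  \<open>a(u, v) + a(v, u)\<close> every exit probability meets its complement, so no gambler's ruin
  formula appears. Weights are counted and not normalised: the chain starts from weight 1 on every
  hole set, and a step sums over the \<open>n\<close> starting sites. The total mass is divided out
  at the end; its asymptotics supply \<open>N_h!\<close>, while \<open>N_b!\<close> comes from
  \<open>k!\<close>.\<close>

abbreviation coin_space :: "real \<Rightarrow> bool stream measure" where
  "coin_space p \<equiv> stream_space (measure_pmf (bernoulli_pmf p))"

text \<open>The displacement is kept in the integers and reduced modulo \<open>n\<close> only in
  \<open>walk_pos\<close>, so exit events do not depend on the starting site.\<close>

definition step_sum :: "bool stream \<Rightarrow> nat \<Rightarrow> int" where
  "step_sum w k = (\<Sum>j<k. if w !! j then 1 else -1)"

lemma step_sum_0 [simp]: "step_sum w 0 = 0"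
  by (simp add: step_sum_def)

lemma step_sum_Suc: "step_sum w (Suc k) = step_sum w k + (if w !! k then 1 else -1)"
  by (simp add: step_sum_def)

lemma step_sum_Stream_Suc: "step_sum (x ## w) (Suc k) = (if x then 1 else -1) + step_sum w k"
  unfolding step_sum_def by (subst sum.lessThan_Suc_shift) simp

lemma walk_pos_step_sum: "walk_pos n b w k = nat ((int b + step_sum w k) mod int n)"
  by (simp add: walk_pos_def step_sum_def)

lemma prob_space_coin_space: "prob_space (coin_space p)"
  by (rule prob_space.prob_space_stream_space) (rule measure_pmf.prob_space_axioms)

lemma space_coin_space [simp]: "space (coin_space p) = UNIV"
  by (simp add: space_stream_space)

lemma measurable_const_pred: "Measurable.pred M (\<lambda>_. c)"
  by simp

lemma measurable_step_sum:
  "(\<lambda>w. step_sum w k) \<in> coin_space p \<rightarrow>\<^sub>M count_space UNIV"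
proof (induction k)
  case (Suc k)
  note Suc [measurable]
  have [measurable]: "(\<lambda>w. w !! k) \<in> coin_space p \<rightarrow>\<^sub>M count_space UNIV"
    using measurable_snth[of k "measure_pmf (bernoulli_pmf p)"] by simp
  show ?case unfolding step_sum_Suc by measurable
qed simp

lemma measurable_walk_pos:
  "(\<lambda>w. walk_pos n b w k) \<in> coin_space p \<rightarrow>\<^sub>M count_space UNIV"
  unfolding walk_pos_step_sum by (rule measurable_compose[OF measurable_step_sum]) simp

lemma pred_step_sum: "Measurable.pred (coin_space p) (\<lambda>w. P (step_sum w k))"
  by (rule measurable_compose[OF measurable_step_sum]) simp

lemma pred_walk_pos: "Measurable.pred (coin_space p) (\<lambda>w. P (walk_pos n b w k))"
  by (rule measurable_compose[OF measurable_walk_pos]) simp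

lemma coin_space_setI:
  "Measurable.pred (coin_space p) P \<Longrightarrow> {w. P w} \<in> sets (coin_space p)"
  by (simp add: pred_def)

lemma prob_coin_space_first_step:
  fixes P :: "bool stream \<Rightarrow> bool"
  assumes p: "0 \<le> p" "p \<le> 1" and [measurable]: "Measurable.pred (coin_space p) P"
  shows "measure (coin_space p) {w. P w} =
    p * measure (coin_space p) {w. P (True ## w)} + (1 - p) * measure (coin_space p) {w. P (False ## w)}"
proof -
  interpret prob_space "coin_space p" by (rule prob_space_coin_space)
  have "{w \<in> space (coin_space p). P w} \<in> sets (coin_space p)" by measurable
  from prob_space.prob_stream_space[OF measure_pmf.prob_space_axioms this]
  have "ennreal (measure (coin_space p) {w. P w}) =
     (\<integral>\<^sup>+x. ennreal (measure (coin_space p) {w. P (x ## w)}) \<partial>measure_pmf (bernoulli_pmf p))"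
    by (simp add: emeasure_eq_measure)
  also have "\<dots> = ennreal (measure (coin_space p) {w. P (True ## w)}) * ennreal p
      + ennreal (measure (coin_space p) {w. P (False ## w)}) * ennreal (1 - p)"
    using p by (simp add: nn_integral_bernoulli_pmf)
  also have "\<dots> = ennreal (p * measure (coin_space p) {w. P (True ## w)}
      + (1 - p) * measure (coin_space p) {w. P (False ## w)})"
    using p by (simp add: ennreal_mult[symmetric] ennreal_plus[symmetric] mult.commute del: ennreal_plus)
  finally show ?thesis using p by (subst (asm) ennreal_inj) auto
qed

definition survive :: "int \<Rightarrow> int \<Rightarrow> bool stream set" where
  "survive c a = {w. \<forall>k. 0 < a + step_sum w k \<and> a + step_sum w k < c}"

lemma measurable_survive [measurable]: "survive c a \<in> sets (coin_space p)"
  unfolding survive_def by (intro coin_space_setI pred_intros_countable pred_step_sum)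

lemma survive_Stream:
  assumes "0 < a" "a < c"
  shows "x ## w \<in> survive c a \<longleftrightarrow> w \<in> survive c (a + (if x then 1 else -1))"
proof -
  have "(\<forall>k. Q k) \<longleftrightarrow> Q 0 \<and> (\<forall>k. Q (Suc k))" for Q :: "nat \<Rightarrow> bool"
    by (metis not0_implies_Suc)
  from this[of "\<lambda>k. 0 < a + step_sum (x ## w) k \<and> a + step_sum (x ## w) k < c"] assms show ?thesis
    by (simp add: survive_def step_sum_Stream_Suc add.assoc)
qed

text \<open>Maximum principle: as a function of the starting point this probability is harmonic for
  the walk inside the interval and zero outside, so a positive maximum would have to spread to the
  boundary.\<close>

lemma prob_survive:
  assumes p: "0 \<le> p" "p \<le> 1"
  shows "measure (coin_space p) (survive c a) = 0"
proof (rule ccontr)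
  define v where "v a = measure (coin_space p) (survive c a)" for a
  have harm: "v a = p * v (a + 1) + (1 - p) * v (a - 1)" if "0 < a" "a < c" for a
  proof -
    have "Measurable.pred (coin_space p) (\<lambda>w. w \<in> survive c a)" by measurable
    from prob_coin_space_first_step[OF p this] show ?thesis
      using survive_Stream[OF that] by (simp add: v_def)
  qed
  have zero: "v a = 0" if "\<not> (0 < a \<and> a < c)" for a
  proof -
    have "survive c a = {}" using that by (auto simp: survive_def intro!: exI[of _ 0])
    then show ?thesis by (simp add: v_def)
  qed
  have nonneg: "v a \<ge> 0" for a by (simp add: v_def)
  assume "measure (coin_space p) (survive c a) \<noteq> 0"
  then have a: "v a > 0" by (simp add: v_def zero_less_measure_iff)
  with zero[of a] have ac: "0 < a" "a < c" by force+
  define M where "M = Max (v ` {0..c})"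
  define Z where "Z = {x \<in> {0..c}. v x = M}"
  have fin: "finite (v ` {0..c})" "v ` {0..c} \<noteq> {}" using ac by auto
  have le: "v x \<le> M" for x
  proof (cases "x \<in> {0..c}")
    case True then show ?thesis using fin by (auto simp: M_def)
  next
    case False then have "v x = 0" by (intro zero) auto
    moreover have "v a \<le> M" using ac fin by (auto simp: M_def)
    ultimately show ?thesis using a by simp
  qed
  have Mpos: "M > 0" using le[of a] a by simp
  have Z: "finite Z" "Z \<noteq> {}"
  proof -
    show "Z \<noteq> {}" using Max_in[OF fin] by (force simp: Z_def M_def)
    show "finite Z" by (rule finite_subset[of _ "{0..c}"]) (auto simp: Z_def)
  qed
  have int: "0 < z \<and> z < c" if "z \<in> Z" for z
    using zero[of z] that Mpos by (force simp: Z_def)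
  \<comment> \<open>When \<open>p > 0\<close>, the right neighbour of the last maximiser is strictly
    smaller and carries positive weight. When \<open>p = 0\<close> the walk moves only to the left,
    and the first maximiser takes this role.\<close>
  show False
  proof (cases "p > 0")
    case True
    define z where "z = Max Z"
    have z: "z \<in> Z" using Z by (simp add: z_def)
    have "z + 1 \<notin> Z" using Z Max_ge[of Z "z + 1"] by (auto simp: z_def)
    then have "v (z + 1) < M" using int[OF z] le[of "z + 1"] by (force simp: Z_def)
    then have "p * v (z + 1) < p * M" using True by simp
    moreover have "(1 - p) * v (z - 1) \<le> (1 - p) * M" using p le by (intro mult_left_mono) auto
    ultimately show False using harm[of z] int[OF z] z by (simp add: Z_def algebra_simps)
  next
    case False
    define z where "z = Min Z"
    have z: "z \<in> Z" using Z by (simp add: z_def)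
    have "z - 1 \<notin> Z" using Z Min_le[of Z "z - 1"] by (auto simp: z_def)
    then have "v (z - 1) < M" using int[OF z] le[of "z - 1"] by (force simp: Z_def)
    then show False using harm[of z] int[OF z] z False p by (simp add: Z_def)
  qed
qed

text \<open>\<open>i\<close> and \<open>j\<close> are the distances to the lower and the upper end.
  Demanding that all earlier times are interior expresses the first exit by countable quantifiers,
  hence measurably.\<close>

definition exit_up :: "nat \<Rightarrow> nat \<Rightarrow> bool stream set" where
  "exit_up i j = {w. \<exists>k. step_sum w k = int j \<and> (\<forall>l<k. - int i < step_sum w l \<and> step_sum w l < int j)}"

definition exit_down :: "nat \<Rightarrow> nat \<Rightarrow> bool stream set" where
  "exit_down i j = {w. \<exists>k. step_sum w k = - int i \<and> (\<forall>l<k. - int i < step_sum w l \<and> step_sum w l < int j)}"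

lemma measurable_exit [measurable]:
  "exit_up i j \<in> sets (coin_space p)" "exit_down i j \<in> sets (coin_space p)"
  unfolding exit_up_def exit_down_def
  by (intro coin_space_setI pred_intros_countable pred_intros_logic measurable_const_pred pred_step_sum)+

lemma exit_cases:
  assumes "0 < i" "0 < j"
  shows "w \<in> exit_up i j \<or> w \<in> exit_down i j \<or> w \<in> survive (int (i + j)) (int i)"
proof (cases "\<forall>k. - int i < step_sum w k \<and> step_sum w k < int j")
  case True
  have "0 < int i + step_sum w k \<and> int i + step_sum w k < int (i + j)" for k
    using True[rule_format, of k] by auto
  then show ?thesis by (auto simp: survive_def)
next
  case False
  then have "\<exists>k. \<not> (- int i < step_sum w k \<and> step_sum w k < int j)" by simp
  then obtain k where k: "\<not> (- int i < step_sum w k \<and> step_sum w k < int j)"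
    and l: "\<forall>l<k. - int i < step_sum w l \<and> step_sum w l < int j"
    by (subst (asm) exists_least_iff) blast
  obtain k' where k': "k = Suc k'" using k assms by (cases k) auto
  have "- int i < step_sum w k' \<and> step_sum w k' < int j" using l k' by simp
  \<comment> \<open>At the first time outside, a step of size one from an interior point lands
    exactly on an end.\<close>
  then have "step_sum w k = int j \<or> step_sum w k = - int i"
    using k unfolding k' step_sum_Suc by (cases "w !! k'") auto
  then show ?thesis using l unfolding exit_up_def exit_down_def by blast
qed

lemma exit_disjoint: assumes "0 < i" "0 < j" shows "exit_up i j \<inter> exit_down i j = {}"
proof -
  have False if "step_sum w k = int j" "\<forall>l<k. - int i < step_sum w l \<and> step_sum w l < int j"
    "step_sum w k' = - int i" "\<forall>l<k'. - int i < step_sum w l \<and> step_sum w l < int j" for w k k'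
    using that assms by (cases k k' rule: linorder_cases) force+
  then show ?thesis by (auto simp: exit_up_def exit_down_def)
qed

text \<open>Surviving forever is a null event, so the two exits exhaust the space. This
  complementarity is what later cancels the bias.\<close>

lemma prob_exit_up_down:
  assumes p: "0 \<le> p" "p \<le> 1" and "0 < i" "0 < j"
  shows "measure (coin_space p) (exit_up i j) + measure (coin_space p) (exit_down i j) = 1"
proof -
  interpret prob_space "coin_space p" by (rule prob_space_coin_space)
  let ?S = "survive (int (i + j)) (int i)"
  have "UNIV = exit_up i j \<union> exit_down i j \<union> ?S" using exit_cases[OF assms(3,4)] by auto
  then have "1 = prob (exit_up i j \<union> exit_down i j \<union> ?S)" using prob_space by simp
  also have "\<dots> \<le> prob (exit_up i j \<union> exit_down i j) + prob ?S"
    by (intro measure_Un_le) auto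
  also have "\<dots> = prob (exit_up i j \<union> exit_down i j)" using prob_survive[OF p] by simp
  also have "\<dots> = prob (exit_up i j) + prob (exit_down i j)"
    using exit_disjoint[OF assms(3,4)] by (intro finite_measure_Union) auto
  finally have "1 \<le> prob (exit_up i j) + prob (exit_down i j)" .
  moreover have "prob (exit_up i j) + prob (exit_down i j) = prob (exit_up i j \<union> exit_down i j)"
    using exit_disjoint[OF assms(3,4)] by (intro finite_measure_Union[symmetric]) auto
  ultimately show ?thesis using prob_le_1[of "exit_up i j \<union> exit_down i j"] by linarith
qed

section \<open>Landing sites of a single ball\<close>

lemma golf_hit_first:
  assumes "walk_pos n b w k \<in> A" "\<forall>l<k. walk_pos n b w l \<notin> A"
  shows "golf_hit n A {} b w = {walk_pos n b w k}"
proof -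
  have "(LEAST k. walk_pos n b w k \<in> A) = k"
    using assms by (intro Least_equality) (auto simp: not_less[symmetric])
  then show ?thesis using assms by (auto simp: golf_hit_def)
qed

lemma golf_hit_self: "b \<in> A \<Longrightarrow> b < n \<Longrightarrow> golf_hit n A {} b w = {b}"
  using golf_hit_first[of n b w 0 A] by (simp add: walk_pos_step_sum)

text \<open>The lift sits over an interior point of the stretch that starts at \<open>y\<close>;
  reduction modulo \<open>n\<close> respects this even when the stretch wraps around the end of the
  site range.\<close>

lemma walk_pos_between:
  assumes "y < n" "0 < s" "s < d" "\<forall>r. 0 < r \<and> r < d \<longrightarrow> (y + r) mod n \<notin> A"
    and "- int s < step_sum w l" "step_sum w l < int (d - s)"
  shows "walk_pos n ((y + s) mod n) w l \<notin> A"
proof -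
  define r where "r = nat (int s + step_sum w l)"
  have r: "int r = int s + step_sum w l" "0 < r" "r < d" using assms by (auto simp: r_def)
  have "(int ((y + s) mod n) + step_sum w l) mod int n = (int (y + s) + step_sum w l) mod int n"
    by (simp add: zmod_int mod_simps)
  also have "int (y + s) + step_sum w l = int (y + r)" using r by simp
  finally have "walk_pos n ((y + s) mod n) w l = (y + r) mod n"
    by (simp add: walk_pos_step_sum zmod_int[symmetric] del: of_nat_add)
  then show ?thesis using assms(4) r by simp
qed

lemma golf_hit_exit_up:
  assumes "y < n" "0 < s" "s < d" "\<forall>r. 0 < r \<and> r < d \<longrightarrow> (y + r) mod n \<notin> A"
    and "(y + d) mod n \<in> A" "w \<in> exit_up s (d - s)"
  shows "golf_hit n A {} ((y + s) mod n) w = {(y + d) mod n}"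
proof -
  obtain k where k: "step_sum w k = int (d - s)"
    "\<forall>l<k. - int s < step_sum w l \<and> step_sum w l < int (d - s)"
    using assms(6) by (auto simp: exit_up_def)
  have "(int ((y + s) mod n) + step_sum w k) mod int n = (int (y + s) + int (d - s)) mod int n"
    by (simp add: zmod_int mod_simps k)
  also have "int (y + s) + int (d - s) = int (y + d)" using assms by simp
  finally have "walk_pos n ((y + s) mod n) w k = (y + d) mod n"
    by (simp add: walk_pos_step_sum zmod_int[symmetric] del: of_nat_add)
  then show ?thesis
    using golf_hit_first[of n "(y + s) mod n" w k A] walk_pos_between[OF assms(1-4)] k assms(5) by simp
qed

lemma golf_hit_exit_down:
  assumes "y < n" "0 < s" "s < d" "\<forall>r. 0 < r \<and> r < d \<longrightarrow> (y + r) mod n \<notin> A"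
    and "y \<in> A" "w \<in> exit_down s (d - s)"
  shows "golf_hit n A {} ((y + s) mod n) w = {y}"
proof -
  obtain k where k: "step_sum w k = - int s"
    "\<forall>l<k. - int s < step_sum w l \<and> step_sum w l < int (d - s)"
    using assms(6) by (auto simp: exit_down_def)
  have "(int ((y + s) mod n) + step_sum w k) mod int n = (int (y + s) + - int s) mod int n"
    by (simp add: zmod_int mod_simps k)
  also have "int (y + s) + - int s = int y" by simp
  finally have "walk_pos n ((y + s) mod n) w k = y"
    using assms(1) by (simp add: walk_pos_step_sum)
  then show ?thesis
    using golf_hit_first[of n "(y + s) mod n" w k A] walk_pos_between[OF assms(1-4)] k assms(5) by simp
qed

text \<open>The \<open>LEAST\<close> is traded for a first time described by countable quantifiers;
  a walk that never hits is kept as a separate case.\<close>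

lemma measurable_golf_hit [measurable]: "{w. golf_hit n H F b w = S} \<in> sets (coin_space p)"
proof -
  let ?A = "\<lambda>k w. walk_pos n b w k \<in> H - F"
  have "golf_hit n H F b w = S \<longleftrightarrow>
      (if \<exists>k. ?A k w then \<exists>k. (?A k w \<and> {walk_pos n b w k} = S) \<and> (\<forall>l<k. \<not> ?A l w) else {} = S)" for w
  proof (cases "\<exists>k. ?A k w")
    case True
    then obtain k where k: "?A k w" "\<forall>l<k. \<not> ?A l w"
      by (subst (asm) exists_least_iff) blast
    have L: "(LEAST k. ?A k w) = k"
      using k by (intro Least_equality) (auto simp: not_less[symmetric])
    have hit: "golf_hit n H F b w = {walk_pos n b w k}" unfolding golf_hit_def L using True by simp
    have uniq: "k' = k" if "?A k' w" "\<forall>l<k'. \<not> ?A l w" for k'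
      using that k by (cases k k' rule: linorder_cases) blast+
    show ?thesis
    proof
      assume "golf_hit n H F b w = S"
      then have "(?A k w \<and> {walk_pos n b w k} = S) \<and> (\<forall>l<k. \<not> ?A l w)" using k hit by blast
      then show "if \<exists>k. ?A k w then \<exists>k. (?A k w \<and> {walk_pos n b w k} = S) \<and> (\<forall>l<k. \<not> ?A l w) else {} = S"
        using True by (subst if_P) blast+
    next
      assume "if \<exists>k. ?A k w then \<exists>k. (?A k w \<and> {walk_pos n b w k} = S) \<and> (\<forall>l<k. \<not> ?A l w) else {} = S"
      then obtain k' where k': "?A k' w \<and> {walk_pos n b w k'} = S" "\<forall>l<k'. \<not> ?A l w"
        using True by (subst (asm) if_P) blast+
      then have "k' = k" by (intro uniq) blast+
      then show "golf_hit n H F b w = S" using k' hit by simp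
    qed
  next
    case False
    then show ?thesis unfolding golf_hit_def by (simp only: if_False)
  qed
  moreover have "{w. if \<exists>k. ?A k w then \<exists>k. (?A k w \<and> {walk_pos n b w k} = S) \<and> (\<forall>l<k. \<not> ?A l w) else {} = S}
     \<in> sets (coin_space p)"
    unfolding if_bool_eq_conj
    by (intro coin_space_setI pred_intros_logic(2-6) pred_intros_countable measurable_const_pred pred_walk_pos)
  ultimately show ?thesis by simp
qed

definition hit_prob :: "nat \<Rightarrow> real \<Rightarrow> nat set \<Rightarrow> nat \<Rightarrow> nat \<Rightarrow> real" where
  "hit_prob n p A b h = measure (coin_space p) {w. golf_hit n A {} b w = {h}}"

definition up_prob :: "real \<Rightarrow> nat \<Rightarrow> nat \<Rightarrow> real" where
  "up_prob p i j = measure (coin_space p) (exit_up i j)"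

lemma hit_prob_nonneg: "0 \<le> hit_prob n p A b h"
  by (simp add: hit_prob_def)

lemma hit_prob_self: "b \<in> A \<Longrightarrow> b < n \<Longrightarrow> hit_prob n p A b h = (if h = b then 1 else 0)"
  using prob_space.prob_space[OF prob_space_coin_space, of p]
  by (auto simp: hit_prob_def golf_hit_self)

text \<open>Each exit forces the landing site, which bounds two of the probabilities from below by
  numbers adding up to one. Disjointness of the outcomes turns the bounds into equalities and leaves
  nothing for any other site. The ends must differ, since otherwise both exits would land on the
  same site.\<close>

lemma hit_prob_between:
  assumes p: "0 \<le> p" "p \<le> 1"
    and "y < n" "0 < s" "s < d" "\<forall>r. 0 < r \<and> r < d \<longrightarrow> (y + r) mod n \<notin> A"
    and "y \<in> A" "(y + d) mod n \<in> A" "(y + d) mod n \<noteq> y"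
  shows "hit_prob n p A ((y + s) mod n) h =
    (if h = y then 1 - up_prob p s (d - s) else if h = (y + d) mod n then up_prob p s (d - s) else 0)"
proof -
  interpret prob_space "coin_space p" by (rule prob_space_coin_space)
  let ?b = "(y + s) mod n" and ?z = "(y + d) mod n"
  let ?E = "\<lambda>h. {w. golf_hit n A {} ?b w = {h}}"
  have up: "up_prob p s (d - s) \<le> hit_prob n p A ?b ?z"
    unfolding up_prob_def hit_prob_def using golf_hit_exit_up[OF assms(3-6,8)]
    by (intro finite_measure_mono) auto
  have down: "1 - up_prob p s (d - s) \<le> hit_prob n p A ?b y"
  proof -
    have "1 - up_prob p s (d - s) = prob (exit_down s (d - s))"
      using prob_exit_up_down[OF p, of s "d - s"] assms(4,5) by (simp add: up_prob_def)
    also have "\<dots> \<le> hit_prob n p A ?b y"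
      unfolding hit_prob_def using golf_hit_exit_down[OF assms(3-7)]
      by (intro finite_measure_mono) auto
    finally show ?thesis .
  qed
  have disj: "?E y \<inter> ?E ?z = {}" using assms(9) by auto
  have le1: "hit_prob n p A ?b y + hit_prob n p A ?b ?z \<le> 1"
    unfolding hit_prob_def using disj by (subst finite_measure_Union[symmetric]) auto
  have other: "hit_prob n p A ?b h = 0" if "h \<noteq> y" "h \<noteq> ?z"
  proof -
    have "prob (?E y \<union> ?E ?z \<union> ?E h) = hit_prob n p A ?b y + hit_prob n p A ?b ?z + hit_prob n p A ?b h"
      unfolding hit_prob_def using disj that by (subst finite_measure_Union; auto)+
    then show ?thesis using prob_le_1[of "?E y \<union> ?E ?z \<union> ?E h"] up down hit_prob_nonneg[of n p A ?b h]
      by linarith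
  qed
  show ?thesis using up down le1 other assms(9) by auto
qed

section \<open>Arcs of the cycle\<close>

text \<open>An arc is measured up to and including the next element, so its length is one more than
  the corresponding \<open>gap\<close>; a single element has the whole cycle as its arc, of length
  \<open>n\<close>.\<close>

definition cyc_gap :: "nat \<Rightarrow> nat set \<Rightarrow> nat \<Rightarrow> nat" where
  "cyc_gap n X x = (LEAST d. 0 < d \<and> (x + d) mod n \<in> X)"

lemma cyc_gap_eqI:
  assumes "0 < D" "(x + D) mod n \<in> X" "\<And>s. 0 < s \<Longrightarrow> s < D \<Longrightarrow> (x + s) mod n \<notin> X"
  shows "cyc_gap n X x = D"
  unfolding cyc_gap_def using assms by (intro Least_equality) (auto simp: not_less[symmetric])

context
  fixes n :: nat and X :: "nat set"
  assumes X: "X \<subseteq> {..<n}"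
begin

lemma cyc_gap_props:
  assumes "x \<in> X"
  shows "0 < cyc_gap n X x" "(x + cyc_gap n X x) mod n \<in> X" "cyc_gap n X x \<le> n"
    "\<And>s. 0 < s \<Longrightarrow> s < cyc_gap n X x \<Longrightarrow> (x + s) mod n \<notin> X"
proof -
  have n: "0 < n \<and> (x + n) mod n \<in> X" using assms X by auto
  from LeastI[of "\<lambda>d. 0 < d \<and> (x + d) mod n \<in> X", OF n] Least_le[of "\<lambda>d. 0 < d \<and> (x + d) mod n \<in> X", OF n]
  show "0 < cyc_gap n X x" "(x + cyc_gap n X x) mod n \<in> X" "cyc_gap n X x \<le> n"
    by (auto simp: cyc_gap_def)
  show "(x + s) mod n \<notin> X" if "0 < s" "s < cyc_gap n X x" for s
    using not_less_Least[of s "\<lambda>d. 0 < d \<and> (x + d) mod n \<in> X"] that by (auto simp: cyc_gap_def)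
qed

text \<open>Going back from the common site by the smaller offset reaches an element of
  \<open>X\<close> at an offset below the length of the other arc; that offset must be zero.\<close>

lemma cyc_position_unique:
  assumes "x \<in> X" "y \<in> X" "s < cyc_gap n X x" "r < cyc_gap n X y" "(x + s) mod n = (y + r) mod n"
  shows "x = y \<and> s = r"
proof -
  have *: "x = y \<and> s = r" if "x \<in> X" "y \<in> X" "s \<le> r" "r < cyc_gap n X y" "(x + s) mod n = (y + r) mod n" for x y s r
  proof -
    have "[y + (r - s) + s = x + s] (mod n)" using that by (simp add: cong_def)
    then have "[y + (r - s) = x] (mod n)" by (simp only: cong_add_rcancel_nat)
    then have eq: "(y + (r - s)) mod n = x" using that X by (auto simp: cong_def)
    then have "(y + (r - s)) mod n \<in> X" using that by simp
    moreover have "r - s < cyc_gap n X y" using that by simp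
    ultimately have "r - s = 0" using cyc_gap_props(4)[of y "r - s"] that(2) by blast
    then show ?thesis using eq that X by auto
  qed
  show ?thesis using *[of x y s r] *[of y x r s] assms by (cases "s \<le> r") auto
qed

text \<open>The least offset at which \<open>b\<close> is reached from some element works: if it
  passed the end of the arc, the next element would reach \<open>b\<close> sooner.\<close>

lemma cyc_position_exists:
  assumes "X \<noteq> {}" "b < n"
  shows "\<exists>x\<in>X. \<exists>s<cyc_gap n X x. b = (x + s) mod n"
proof -
  obtain y where y: "y \<in> X" using assms by auto
  have "\<exists>s. \<exists>x\<in>X. (x + s) mod n = b"
    using y X assms by (intro exI[of _ "b + (n - y)"] bexI[of _ y]) auto
  then obtain s where s: "\<exists>x\<in>X. (x + s) mod n = b" "\<forall>r<s. \<not> (\<exists>x\<in>X. (x + r) mod n = b)"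
    by (subst (asm) exists_least_iff) blast
  then obtain x where x: "x \<in> X" "(x + s) mod n = b" by blast
  have "s < cyc_gap n X x"
  proof (rule ccontr)
    assume "\<not> s < cyc_gap n X x"
    then have "(x + cyc_gap n X x + (s - cyc_gap n X x)) mod n = b"
      using x by simp
    then have "((x + cyc_gap n X x) mod n + (s - cyc_gap n X x)) mod n = b"
      by (simp only: mod_add_left_eq)
    then show False
      using s(2) cyc_gap_props(1,2)[OF x(1)] \<open>\<not> s < cyc_gap n X x\<close>
      by (metis diff_less not_less order_less_le_trans)
  qed
  then show ?thesis using x by blast
qed

lemma bij_betw_cyc_position:
  assumes "X \<noteq> {}"
  shows "bij_betw (\<lambda>(x, s). (x + s) mod n) (SIGMA x:X. {..<cyc_gap n X x}) {..<n}"
proof -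
  have "n > 0" using assms X by auto
  then have "(\<lambda>(x, s). (x + s) mod n) ` (SIGMA x:X. {..<cyc_gap n X x}) = {..<n}"
    using cyc_position_exists[OF assms] by (fastforce simp: image_iff)
  then show ?thesis
    using cyc_position_unique by (force simp: bij_betw_def inj_on_def)
qed

lemma sum_cyc_position:
  assumes "X \<noteq> {}"
  shows "(\<Sum>b<n. f b) = (\<Sum>x\<in>X. \<Sum>s<cyc_gap n X x. f ((x + s) mod n))"
proof -
  have fin: "finite X" using X finite_subset by blast
  have "(\<Sum>b<n. f b) = (\<Sum>(x, s)\<in>(SIGMA x:X. {..<cyc_gap n X x}). f ((x + s) mod n))"
    by (subst sum.reindex_bij_betw[OF bij_betw_cyc_position[OF assms], symmetric]) (simp add: case_prod_unfold)
  then show ?thesis using fin by (simp add: sum.Sigma)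
qed

text \<open>Offset 0 is the element of \<open>X\<close> that starts the arc, hence \<open>u\<close>
  begins at 1.\<close>

lemma sum_cyc_position_outside:
  assumes "X \<noteq> {}"
  shows "(\<Sum>h\<in>{..<n} - X. f h) = (\<Sum>x\<in>X. \<Sum>u\<in>{1..<cyc_gap n X x}. f ((x + u) mod n))"
proof -
  have fin: "finite X" using X finite_subset by blast
  have "(\<Sum>h\<in>{..<n} - X. f h) = (\<Sum>h<n. if h \<in> X then 0 else f h)"
    by (rule sum.mono_neutral_cong_left) auto
  also have "\<dots> = (\<Sum>x\<in>X. \<Sum>s<cyc_gap n X x. if (x + s) mod n \<in> X then 0 else f ((x + s) mod n))"
    by (rule sum_cyc_position[OF assms])
  also have "\<dots> = (\<Sum>x\<in>X. \<Sum>u\<in>{1..<cyc_gap n X x}. f ((x + u) mod n))"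
  proof (rule sum.cong[OF refl])
    fix x assume x: "x \<in> X"
    show "(\<Sum>s<cyc_gap n X x. if (x + s) mod n \<in> X then 0 else f ((x + s) mod n)) =
        (\<Sum>u\<in>{1..<cyc_gap n X x}. f ((x + u) mod n))"
    proof (rule sum.mono_neutral_cong_right)
      show "\<forall>s\<in>{..<cyc_gap n X x} - {1..<cyc_gap n X x}. (if (x + s) mod n \<in> X then 0 else f ((x + s) mod n)) = 0"
        using x X by (auto simp: subset_eq not_le)
    qed (use cyc_gap_props(4)[OF x] in auto)
  qed
  finally show ?thesis .
qed

lemma sum_cyc_gap: "X \<noteq> {} \<Longrightarrow> (\<Sum>x\<in>X. cyc_gap n X x) = n"
  using sum_cyc_position[of "\<lambda>_. 1::nat"] by simp

text \<open>An arc returning to its start has length \<open>n\<close>, the total of all arcs, which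
  leaves no room for the positive arc of a second element.\<close>

lemma cyc_next_neq:
  assumes y: "y \<in> X" and z: "z \<in> X" "z \<noteq> y"
  shows "(y + cyc_gap n X y) mod n \<noteq> y"
proof
  assume "(y + cyc_gap n X y) mod n = y"
  then have "[y + cyc_gap n X y = y] (mod n)" by (metis cong_mod_left cong_refl)
  then have "n dvd cyc_gap n X y" by (simp add: cong_add_lcancel_0_nat cong_0_iff)
  then have "cyc_gap n X y = n" using cyc_gap_props(1,3)[OF y] by (simp add: dvd_imp_le le_antisym)
  then have "sum (cyc_gap n X) {y, z} > n" using cyc_gap_props(1)[OF z(1)] z(2) by simp
  moreover have "sum (cyc_gap n X) {y, z} \<le> sum (cyc_gap n X) X"
    using finite_subset[OF X] y z by (intro sum_mono2) auto
  ultimately show False using sum_cyc_gap y by force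
qed

text \<open>A new point disturbs one arc only, so in a product over the arcs one factor is replaced
  by two.\<close>

lemma
  assumes x: "x \<in> X" and u: "0 < u" "u < cyc_gap n X x"
  defines "h \<equiv> (x + u) mod n"
  shows cyc_gap_insert_left: "cyc_gap n (insert h X) x = u"
    and cyc_gap_insert_new: "cyc_gap n (insert h X) h = cyc_gap n X x - u"
    and cyc_gap_insert_other: "\<And>y. y \<in> X - {x} \<Longrightarrow> cyc_gap n (insert h X) y = cyc_gap n X y"
    and cyc_next_insert_new: "(h + cyc_gap n (insert h X) h) mod n \<in> X"
proof -
  have ne: "(y + s) mod n \<noteq> h" if "y \<in> X" "s < cyc_gap n X y" "(y, s) \<noteq> (x, u)" for y s
    using cyc_position_unique[OF that(1) x that(2) u(2)] that(3) by (auto simp: h_def)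
  show "cyc_gap n (insert h X) x = u"
    using u cyc_gap_props(4)[OF x] ne[OF x] by (intro cyc_gap_eqI) (auto simp: h_def)
  have hs: "(h + s) mod n = (x + (u + s)) mod n" for s
    by (simp add: h_def mod_add_left_eq add.assoc)
  show *: "cyc_gap n (insert h X) h = cyc_gap n X x - u"
  proof (rule cyc_gap_eqI)
    show "(h + (cyc_gap n X x - u)) mod n \<in> insert h X"
      unfolding hs using u cyc_gap_props(2)[OF x] by simp
    show "(h + s) mod n \<notin> insert h X" if "0 < s" "s < cyc_gap n X x - u" for s
      unfolding hs using that u cyc_gap_props(4)[OF x, of "u + s"] ne[OF x, of "u + s"] by auto
  qed (use u in simp)
  show "(h + cyc_gap n (insert h X) h) mod n \<in> X"
    unfolding * hs using u cyc_gap_props(2)[OF x] by simp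
  show "cyc_gap n (insert h X) y = cyc_gap n X y" if "y \<in> X - {x}" for y
    using cyc_gap_props[of y] ne[of y] that by (intro cyc_gap_eqI) auto
qed

end

text \<open>Two elements make the ends of every arc distinct; a ball off \<open>A\<close> then has
  two possible landing sites with complementary probabilities.\<close>

lemma sum_hit_prob:
  assumes p: "0 \<le> p" "p \<le> 1" and A: "A \<subseteq> {..<n}" "2 \<le> card A" and b: "b < n"
  shows "(\<Sum>h\<in>A. hit_prob n p A b h) = 1"
proof -
  have fin: "finite A" using A finite_subset by auto
  have "A \<noteq> {}" using A by auto
  from cyc_position_exists[OF A(1) this b] obtain y s
    where ys: "y \<in> A" "s < cyc_gap n A y" "b = (y + s) mod n" by blast
  have "card (A - {y}) \<noteq> 0" using A ys fin by simp
  then obtain z where z: "z \<in> A" "z \<noteq> y" by (metis Diff_iff card.empty ex_in_conv insertI1)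
  let ?z = "(y + cyc_gap n A y) mod n"
  note props = cyc_gap_props[OF A(1) ys(1)]
  have zA: "?z \<in> A" "?z \<noteq> y" using props cyc_next_neq[OF A(1) ys(1) z] by auto
  show ?thesis
  proof (cases "s = 0")
    case True
    then have "b = y" using ys A by auto
    then show ?thesis using hit_prob_self[OF ys(1)] ys A fin by (auto simp: sum.delta)
  next
    case False
    let ?r = "up_prob p s (cyc_gap n A y - s)"
    have "(\<Sum>h\<in>A. hit_prob n p A b h) = (\<Sum>h\<in>A. (if h = y then 1 - ?r else 0) + (if h = ?z then ?r else 0))"
      using hit_prob_between[OF p, of y n s "cyc_gap n A y" A] False ys A props zA
      by (intro sum.cong refl) auto
    also have "\<dots> = 1" using fin ys zA by (simp add: sum.distrib)
    finally show ?thesis .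
  qed
qed

text \<open>A uniform ball that ends in the inserted hole started on it, or in one of the two arcs
  next to it; each arc contributes through its length only.\<close>

lemma sum_hit_prob_insert:
  assumes p: "0 \<le> p" "p \<le> 1" and X: "X \<subseteq> {..<n}" and x: "x \<in> X" and u: "0 < u" "u < cyc_gap n X x"
  defines "h \<equiv> (x + u) mod n" and "v \<equiv> cyc_gap n X x - u"
  shows "(\<Sum>b<n. hit_prob n p (insert h X) b h) =
    1 + (\<Sum>s\<in>{1..<v}. 1 - up_prob p s (v - s)) + (\<Sum>s\<in>{1..<u}. up_prob p s (u - s))"
proof -
  let ?Y = "insert h X"
  let ?d = "cyc_gap n ?Y"
  have n: "n > 0" and fin: "finite X" using X x finite_subset by auto
  have h: "h \<notin> X" using cyc_gap_props(4)[OF X x u] by (simp add: h_def)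
  have Y: "?Y \<subseteq> {..<n}" using X n by (auto simp: h_def)
  note ins = cyc_gap_insert_left[OF X x u, folded h_def] cyc_gap_insert_new[OF X x u, folded h_def v_def]
    cyc_gap_insert_other[OF X x u, folded h_def] cyc_next_insert_new[OF X x u, folded h_def]
  have hit: "hit_prob n p ?Y ((y + s) mod n) h =
      (if h = y then 1 - up_prob p s (?d y - s) else if h = (y + ?d y) mod n then up_prob p s (?d y - s) else 0)"
    if "y \<in> ?Y" "0 < s" "s < ?d y" "(y + ?d y) mod n \<noteq> y" for y s
    using cyc_gap_props[OF Y that(1)] Y that by (intro hit_prob_between[OF p]) auto
  have hit0: "hit_prob n p ?Y ((y + 0) mod n) h = (if h = y then 1 else 0)" if "y \<in> ?Y" for y
    using Y that by (subst hit_prob_self) auto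
  have split: "(\<Sum>s<?d y. f s) = f 0 + (\<Sum>s\<in>{1..<?d y}. f s)" if "y \<in> ?Y" for y and f :: "nat \<Rightarrow> real"
    using cyc_gap_props(1)[OF Y that] by (simp add: lessThan_atLeast0 sum.atLeast_Suc_lessThan)
  \<comment> \<open>The summand 1 is the ball that starts on \<open>h\<close>; balls in the arc
    after \<open>h\<close> reach it by a downward exit, those in the arc before it by an upward
    one.\<close>
  have new: "(\<Sum>s<?d h. hit_prob n p ?Y ((h + s) mod n) h) = 1 + (\<Sum>s\<in>{1..<v}. 1 - up_prob p s (v - s))"
  proof -
    have "(h + ?d h) mod n \<noteq> h" using ins(4) h by auto
    then have "(\<Sum>s\<in>{1..<?d h}. hit_prob n p ?Y ((h + s) mod n) h) = (\<Sum>s\<in>{1..<v}. 1 - up_prob p s (v - s))"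
      using hit[of h] ins(2) by (intro sum.cong) auto
    then show ?thesis using split[of h] hit0[of h] by simp
  qed
  have left: "(\<Sum>s<?d x. hit_prob n p ?Y ((x + s) mod n) h) = (\<Sum>s\<in>{1..<u}. up_prob p s (u - s))"
  proof -
    have "(x + ?d x) mod n = h" "h \<noteq> x" using ins(1) h x by (auto simp: h_def)
    then have "(\<Sum>s\<in>{1..<?d x}. hit_prob n p ?Y ((x + s) mod n) h) = (\<Sum>s\<in>{1..<u}. up_prob p s (u - s))"
      using hit[of x] ins(1) x by (intro sum.cong) auto
    then show ?thesis using split[of x] hit0[of x] x \<open>h \<noteq> x\<close> by simp
  qed
  have other: "(\<Sum>s<?d y. hit_prob n p ?Y ((y + s) mod n) h) = 0" if y: "y \<in> X - {x}" for y
  proof -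
    have hy: "h \<noteq> y" using h y by auto
    have "(y + ?d y) mod n \<in> X" using ins(3)[OF y] cyc_gap_props(2)[OF X] y by auto
    then have hn: "h \<noteq> (y + ?d y) mod n" using h by auto
    have "hit_prob n p ?Y ((y + s) mod n) h = 0" if s: "s \<in> {1..<?d y}" for s
      using hit[of y s] y s hy hn cyc_next_neq[OF Y, of y h] by auto
    then show ?thesis using split[of y] hit0[of y] y hy by simp
  qed
  have "(\<Sum>b<n. hit_prob n p ?Y b h) = (\<Sum>y\<in>?Y. \<Sum>s<?d y. hit_prob n p ?Y ((y + s) mod n) h)"
    by (rule sum_cyc_position[OF Y]) simp
  also have "\<dots> = (\<Sum>s<?d h. hit_prob n p ?Y ((h + s) mod n) h) + (\<Sum>s<?d x. hit_prob n p ?Y ((x + s) mod n) h)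
      + (\<Sum>y\<in>X - {x}. \<Sum>s<?d y. hit_prob n p ?Y ((y + s) mod n) h)"
    using fin h x by (simp add: sum.remove[of X x])
  finally show ?thesis using new left other by simp
qed

text \<open>Holes at distances \<open>u\<close> and \<open>v\<close> from the ends of an arc are exchanged by reflection. The two
  hitting sums add up to the length of the arc, whatever the bias of the walk.\<close>

lemma sum_hit_prob_reflect:
  assumes p: "0 \<le> p" "p \<le> 1" and X: "X \<subseteq> {..<n}" and x: "x \<in> X"
    and sym: "\<And>u v. w u v = w v (u::nat)"
  defines "D \<equiv> cyc_gap n X x"
  shows "(\<Sum>u\<in>{1..<D}. w u (D - u) * (\<Sum>b<n. hit_prob n p (insert ((x + u) mod n) X) b ((x + u) mod n)))
    = real D / 2 * (\<Sum>u\<in>{1..<D}. w u (D - u))"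
proof -
  define a where "a u = (\<Sum>b<n. hit_prob n p (insert ((x + u) mod n) X) b ((x + u) mod n))" for u
  \<comment> \<open>The exit probabilities of either piece enter once as \<open>up_prob\<close> and
    once as its complement, so only counts remain:
    \<open>2 + (D - u - 1) + (u - 1) = D\<close>.\<close>
  have a: "a u + a (D - u) = D" if "u \<in> {1..<D}" for u
  proof -
    have "a u = 1 + (\<Sum>s\<in>{1..<D - u}. 1 - up_prob p s (D - u - s)) + (\<Sum>s\<in>{1..<u}. up_prob p s (u - s))"
      unfolding a_def using that by (subst sum_hit_prob_insert[OF p X x]) (auto simp: D_def)
    moreover have "a (D - u) = 1 + (\<Sum>s\<in>{1..<u}. 1 - up_prob p s (u - s)) + (\<Sum>s\<in>{1..<D - u}. up_prob p s (D - u - s))"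
      unfolding a_def using that by (subst sum_hit_prob_insert[OF p X x]) (auto simp: D_def)
    ultimately show ?thesis using that by (simp add: sum_subtractf)
  qed
  have reflect: "(\<Sum>u\<in>{1..<D}. f u) = (\<Sum>u\<in>{1..<D}. f (D - u))" for f :: "nat \<Rightarrow> real"
    by (rule sum.reindex_bij_witness[of _ "\<lambda>u. D - u" "\<lambda>u. D - u"]) auto
  have "2 * (\<Sum>u\<in>{1..<D}. w u (D - u) * a u) =
      (\<Sum>u\<in>{1..<D}. w u (D - u) * a u) + (\<Sum>u\<in>{1..<D}. w (D - u) (D - (D - u)) * a (D - u))"
    by (subst (2) reflect) simp
  also have "\<dots> = (\<Sum>u\<in>{1..<D}. w u (D - u) * (a u + a (D - u)))"
    unfolding sum.distrib[symmetric] by (intro sum.cong refl) (auto simp: algebra_simps sym[of "D - u" u for u])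
  also have "\<dots> = (\<Sum>u\<in>{1..<D}. w u (D - u) * D)"
    by (intro sum.cong refl) (simp only: a)
  finally have "2 * (\<Sum>u\<in>{1..<D}. w u (D - u) * a u) = (\<Sum>u\<in>{1..<D}. w u (D - u)) * D"
    unfolding sum_distrib_right .
  moreover have "2 * s = t * real D \<Longrightarrow> s = real D / 2 * t" for s t by (simp add: mult.commute)
  ultimately show ?thesis unfolding a_def[symmetric] by blast
qed

section \<open>The chain of hole sets under uniform balls\<close>

text \<open>Every launch has its own factor \<open>hit_prob\<close>, as for independent walks, so
  sites may repeat in \<open>bs\<close>. For the golf process, where a walk belongs to a site, this
  is the law of a run along distinct sites.\<close>

fun run_prob :: "nat \<Rightarrow> real \<Rightarrow> nat list \<Rightarrow> nat set \<Rightarrow> nat set \<Rightarrow> real" where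
  "run_prob n p [] A X = (if A = X then 1 else 0)"
| "run_prob n p (b # bs) A X = (\<Sum>h\<in>A. hit_prob n p A b h * run_prob n p bs (A - {h}) X)"

text \<open>The forward operator on weights of hole sets. Starting sites are summed and not
  averaged, so \<open>k\<close> steps carry a factor \<open>n ^ k\<close> relative to
  probabilities.\<close>

definition chain_step :: "nat \<Rightarrow> real \<Rightarrow> (nat set \<Rightarrow> real) \<Rightarrow> nat set \<Rightarrow> real" where
  "chain_step n p \<mu> X =
    (\<Sum>h\<in>{..<n} - X. \<mu> (insert h X) * (\<Sum>b<n. hit_prob n p (insert h X) b h))"

abbreviation sites_lists :: "nat \<Rightarrow> nat \<Rightarrow> nat list set" where
  "sites_lists n k \<equiv> {bs. set bs \<subseteq> {..<n} \<and> length bs = k}"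

abbreviation sites_sets :: "nat \<Rightarrow> nat \<Rightarrow> nat set set" where
  "sites_sets n k \<equiv> {A. A \<subseteq> {..<n} \<and> card A = k}"

lemma finite_sites_sets: "finite (sites_sets n k)"
  by (rule finite_subset[of _ "Pow {..<n}"]) auto

lemma finite_sites_lists: "finite (sites_lists n k)"
  by (rule finite_lists_length_eq) simp

lemma sum_sites_lists_Suc:
  "(\<Sum>bs\<in>sites_lists n (Suc k). f bs) = (\<Sum>b<n. \<Sum>bs\<in>sites_lists n k. f (b # bs))"
proof -
  have "inj_on (\<lambda>(xs, n). n # xs) S" for S :: "(nat list \<times> nat) set" by (auto simp: inj_on_def)
  then have "(\<Sum>bs\<in>sites_lists n (Suc k). f bs) = (\<Sum>(bs, b)\<in>sites_lists n k \<times> {..<n}. f (b # bs))"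
    unfolding lists_length_Suc_eq by (subst sum.reindex) (auto simp: case_prod_unfold)
  also have "\<dots> = (\<Sum>bs\<in>sites_lists n k. \<Sum>b<n. f (b # bs))"
    by (simp add: sum.cartesian_product)
  also have "\<dots> = (\<Sum>b<n. \<Sum>bs\<in>sites_lists n k. f (b # bs))" by (rule sum.swap)
  finally show ?thesis .
qed

text \<open>Double counting: mark an element of the larger set, or a missing site of the smaller
  one.\<close>

lemma sum_sites_sets_remove:
  "(\<Sum>A\<in>sites_sets n (Suc k). \<Sum>h\<in>A. f A h) =
   (\<Sum>A\<in>sites_sets n k. \<Sum>h\<in>{..<n} - A. f (insert h A) h)"
proof -
  have fin: "finite A" if "A \<in> sites_sets n k" for A k using that finite_subset by auto
  have "(\<Sum>A\<in>sites_sets n (Suc k). \<Sum>h\<in>A. f A h) = (\<Sum>(A, h)\<in>(SIGMA A:sites_sets n (Suc k). A). f A h)"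
    using fin by (subst sum.Sigma) (auto simp: finite_sites_sets)
  also have "\<dots> = (\<Sum>(A, h)\<in>(SIGMA A:sites_sets n k. {..<n} - A). f (insert h A) h)"
  proof (rule sum.reindex_bij_witness[of _ "\<lambda>(A, h). (insert h A, h)" "\<lambda>(A, h). (A - {h}, h)"])
    show "(case a of (A, h) \<Rightarrow> (A - {h}, h)) \<in> (SIGMA A:sites_sets n k. {..<n} - A)"
      if "a \<in> (SIGMA A:sites_sets n (Suc k). A)" for a
      using that fin[of "fst a" "Suc k"] by (auto simp: split_beta)
    show "(case a of (A, h) \<Rightarrow> (insert h A, h)) \<in> (SIGMA A:sites_sets n (Suc k). A)"
      if "a \<in> (SIGMA A:sites_sets n k. {..<n} - A)" for a
      using that fin[of "fst a" k] by (auto simp: split_beta)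
  qed (auto simp: insert_absorb)
  also have "\<dots> = (\<Sum>A\<in>sites_sets n k. \<Sum>h\<in>{..<n} - A. f (insert h A) h)"
    by (subst sum.Sigma) (auto simp: finite_sites_sets)
  finally show ?thesis .
qed

text \<open>\<open>run_prob\<close> peels off the first ball. Keeping \<open>\<mu>\<close> arbitrary
  in the induction lets this ball be absorbed into the initial weight.\<close>

lemma sum_run_prob_chain:
  assumes "X \<in> sites_sets n L"
  shows "(\<Sum>bs\<in>sites_lists n k. \<Sum>A\<in>sites_sets n (L + k). \<mu> A * run_prob n p bs A X) =
    (chain_step n p ^^ k) \<mu> X"
proof (induction k arbitrary: \<mu>)
  case 0
  have "sites_lists n 0 = {[]}" by auto
  then show ?case using assms by (simp add: if_distrib[of "(*) _"] finite_sites_sets cong: if_cong)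
next
  case (Suc k)
  have "(\<Sum>bs\<in>sites_lists n (Suc k). \<Sum>A\<in>sites_sets n (L + Suc k). \<mu> A * run_prob n p bs A X) =
    (\<Sum>b<n. \<Sum>bs\<in>sites_lists n k. \<Sum>A\<in>sites_sets n (Suc (L + k)). \<Sum>h\<in>A. \<mu> A * (hit_prob n p A b h * run_prob n p bs (A - {h}) X))"
    by (simp add: sum_sites_lists_Suc sum_distrib_left)
  also have "\<dots> = (\<Sum>b<n. \<Sum>bs\<in>sites_lists n k. \<Sum>A\<in>sites_sets n (L + k). \<Sum>h\<in>{..<n} - A.
      \<mu> (insert h A) * (hit_prob n p (insert h A) b h * run_prob n p bs A X))"
    unfolding sum_sites_sets_remove by (intro sum.cong refl) simp
  also have "\<dots> = (\<Sum>bs\<in>sites_lists n k. \<Sum>A\<in>sites_sets n (L + k). \<Sum>h\<in>{..<n} - A. \<Sum>b<n.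
      \<mu> (insert h A) * (hit_prob n p (insert h A) b h * run_prob n p bs A X))"
    by (subst sum.swap, rule sum.cong[OF refl], subst sum.swap, rule sum.cong[OF refl], rule sum.swap)
  also have "\<dots> = (\<Sum>bs\<in>sites_lists n k. \<Sum>A\<in>sites_sets n (L + k). chain_step n p \<mu> A * run_prob n p bs A X)"
    by (simp add: chain_step_def sum_distrib_left sum_distrib_right mult.assoc)
  also have "\<dots> = (chain_step n p ^^ Suc k) \<mu> X"
    by (simp add: Suc funpow_swap1)
  finally show ?case .
qed

lemma run_prob_nonneg: "0 \<le> run_prob n p bs A X"
  by (induction bs arbitrary: A) (auto intro!: sum_nonneg mult_nonneg_nonneg hit_prob_nonneg)

text \<open>\<open>L > 0\<close> guarantees that at least two holes are open at every launch, as
  \<open>sum_hit_prob\<close> demands.\<close>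

lemma sum_run_prob:
  assumes p: "0 \<le> p" "p \<le> 1" and "L > 0"
    and "set bs \<subseteq> {..<n}" "A \<subseteq> {..<n}" "card A = L + length bs"
  shows "(\<Sum>X\<in>sites_sets n L. run_prob n p bs A X) = 1"
  using assms(4-)
proof (induction bs arbitrary: A)
  case Nil
  then show ?case by (simp add: finite_sites_sets)
next
  case (Cons b bs)
  have fin: "finite A" using Cons.prems finite_subset by auto
  have "(\<Sum>X\<in>sites_sets n L. run_prob n p (b # bs) A X) =
      (\<Sum>h\<in>A. hit_prob n p A b h * (\<Sum>X\<in>sites_sets n L. run_prob n p bs (A - {h}) X))"
    by (simp add: sum_distrib_left) (rule sum.swap)
  also have "\<dots> = (\<Sum>h\<in>A. hit_prob n p A b h)"
    using Cons.prems fin by (intro sum.cong refl) (subst Cons.IH, auto)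
  also have "\<dots> = 1" using Cons.prems \<open>L > 0\<close> by (intro sum_hit_prob[OF p]) auto
  finally show ?case .
qed

text \<open>An exponential generating function in the number of balls: the last of
  \<open>Suc b\<close> balls fills a hole that cut the arc into \<open>u\<close> and
  \<open>l - u\<close>, and the earlier balls are shared by the two pieces. The 2 is the reflection
  average, the factor \<open>Suc b\<close> below comes from the derivative.\<close>

function arc_coeff :: "nat \<Rightarrow> nat \<Rightarrow> real" where
  "arc_coeff 0 l = 1"
| "arc_coeff (Suc b) l = real l / (2 * real (Suc b)) *
     (\<Sum>u\<in>{1..<l}. \<Sum>a\<in>{0..b}. arc_coeff a u * arc_coeff (b - a) (l - u))"
  by pat_completeness auto
termination by (relation "Wellfounded.measure fst") auto

definition arc_fps :: "nat \<Rightarrow> real fps" where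
  "arc_fps l = Abs_fps (\<lambda>b. arc_coeff b l)"

lemma fps_deriv_arc_fps:
  "fps_deriv (arc_fps l) = fps_const (real l / 2) * (\<Sum>u\<in>{1..<l}. arc_fps u * arc_fps (l - u))"
  by (rule fps_ext, unfold fps_mult_left_const_nth)
     (simp add: arc_fps_def fps_mult_nth fps_sum_nth del: of_nat_Suc)

lemma fps_deriv_prod:
  fixes f :: "'a \<Rightarrow> 'b :: comm_ring_1 fps"
  assumes "finite A"
  shows "fps_deriv (\<Prod>x\<in>A. f x) = (\<Sum>x\<in>A. fps_deriv (f x) * (\<Prod>y\<in>A - {x}. f y))"
  using assms
proof (induction A rule: finite_induct)
  case (insert a A)
  have "insert a A - {a} = A" using insert by auto
  moreover have "(\<Prod>y\<in>insert a A - {x}. f y) = f a * (\<Prod>y\<in>A - {x}. f y)" if "x \<in> A" for x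
  proof -
    have "insert a A - {x} = insert a (A - {x})" using insert that by auto
    then show ?thesis using insert by simp
  qed
  ultimately show ?case using insert by (simp add: sum_distrib_left algebra_simps)
qed simp

text \<open>The weights of the hole set after \<open>k\<close> uniform balls depend only on its arcs, and on these
  symmetrically; this keeps the hypothesis of the reflection argument alive along the induction.\<close>

lemma chain_step_power_arcs:
  assumes p: "0 \<le> p" "p \<le> 1"
  shows "X \<subseteq> {..<n} \<Longrightarrow> X \<noteq> {} \<Longrightarrow>
    (chain_step n p ^^ k) (\<lambda>_. 1) X = fact k * fps_nth (\<Prod>x\<in>X. arc_fps (cyc_gap n X x)) k"
proof (induction k arbitrary: X)
  case 0
  have "finite X" using 0 finite_subset by auto
  then have "fps_nth (\<Prod>x\<in>X. f x) 0 = (\<Prod>x\<in>X. fps_nth (f x) 0)" for f :: "nat \<Rightarrow> real fps"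
    by (induction X rule: finite_induct) auto
  then show ?case by (simp add: arc_fps_def)
next
  case (Suc k)
  note X = Suc.prems
  have fin: "finite X" using X finite_subset by auto
  let ?D = "cyc_gap n X"
  define R where "R x = (\<Prod>y\<in>X - {x}. arc_fps (?D y))" for x
  define w where "w x u v = fact k * fps_nth (arc_fps u * arc_fps v * R x) k" for x u v
  let ?h = "\<lambda>x u. (x + u) mod n"
  have IH: "(chain_step n p ^^ k) (\<lambda>_. 1) (insert (?h x u) X) = w x u (?D x - u)"
    if x: "x \<in> X" and u: "u \<in> {1..<?D x}" for x u
  proof -
    have u': "0 < u" "u < ?D x" using u by auto
    have h: "?h x u \<notin> X" using cyc_gap_props(4)[OF X(1) x u'] .
    have "insert (?h x u) X \<subseteq> {..<n}" using X by auto
    then have "(chain_step n p ^^ k) (\<lambda>_. 1) (insert (?h x u) X) =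
      fact k * fps_nth (\<Prod>y\<in>insert (?h x u) X. arc_fps (cyc_gap n (insert (?h x u) X) y)) k"
      by (intro Suc.IH) auto
    also have "(\<Prod>y\<in>insert (?h x u) X. arc_fps (cyc_gap n (insert (?h x u) X) y)) =
      arc_fps u * arc_fps (?D x - u) * (\<Prod>y\<in>X - {x}. arc_fps (cyc_gap n (insert (?h x u) X) y))"
      using fin h x by (simp add: prod.remove[of X x] cyc_gap_insert_left[OF X(1) x u']
        cyc_gap_insert_new[OF X(1) x u'] mult_ac)
    also have "(\<Prod>y\<in>X - {x}. arc_fps (cyc_gap n (insert (?h x u) X) y)) = R x"
      unfolding R_def using cyc_gap_insert_other[OF X(1) x u'] by (intro prod.cong) auto
    finally show ?thesis by (simp add: w_def)
  qed
  have "(chain_step n p ^^ Suc k) (\<lambda>_. 1) X = chain_step n p ((chain_step n p ^^ k) (\<lambda>_. 1)) X"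
    by simp
  also have "\<dots> = (\<Sum>x\<in>X. \<Sum>u\<in>{1..<?D x}. w x u (?D x - u) *
      (\<Sum>b<n. hit_prob n p (insert (?h x u) X) b (?h x u)))"
  proof -
    have "chain_step n p f X = (\<Sum>x\<in>X. \<Sum>u\<in>{1..<?D x}. f (insert (?h x u) X) *
      (\<Sum>b<n. hit_prob n p (insert (?h x u) X) b (?h x u)))" for f
      unfolding chain_step_def sum_cyc_position_outside[OF X] ..
    then show ?thesis by (simp only:) (intro sum.cong refl, simp only: IH)
  qed
  also have "\<dots> = (\<Sum>x\<in>X. real (?D x) / 2 * (\<Sum>u\<in>{1..<?D x}. w x u (?D x - u)))"
    by (intro sum.cong refl sum_hit_prob_reflect[OF p X(1)]) (auto simp: w_def mult_ac)
  also have "\<dots> = fact k * fps_nth (\<Sum>x\<in>X. fps_deriv (arc_fps (?D x)) * R x) k"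
    by (simp add: fps_deriv_arc_fps fps_sum_nth sum_distrib_left sum_distrib_right w_def mult.assoc)
       (simp add: mult_ac)
  \<comment> \<open>The sum over the arc that was hit last is the Leibniz rule. Coefficient
    \<open>k\<close> of a derivative is \<open>Suc k\<close> times the next coefficient, which turns
    \<open>fact k\<close> into \<open>fact (Suc k)\<close>.\<close>
  also have "\<dots> = fact k * fps_nth (fps_deriv (\<Prod>x\<in>X. arc_fps (?D x))) k"
    by (simp add: fps_deriv_prod[OF fin] R_def)
  finally show ?case by (simp add: mult_ac)
qed

section \<open>Total mass of the chain and closed form of the coefficients\<close>

lemma card_sites_sets: "card (sites_sets n k) = n choose k"
  using n_subsets[of "{..<n}" k] by simp

lemma card_sites_lists: "card (sites_lists n k) = n ^ k"
  using card_lists_length_eq[of "{..<n}" k] by simp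

text \<open>Mass is conserved: each launch list together with an initial hole set contributes
  exactly one.\<close>

lemma sum_chain_power_total:
  assumes p: "0 \<le> p" "p \<le> 1" and "L > 0"
  shows "(\<Sum>X\<in>sites_sets n L. (chain_step n p ^^ k) (\<lambda>_. 1) X) = real (n ^ k * (n choose (L + k)))"
proof -
  have "(\<Sum>X\<in>sites_sets n L. (chain_step n p ^^ k) (\<lambda>_. 1) X) =
    (\<Sum>X\<in>sites_sets n L. \<Sum>bs\<in>sites_lists n k. \<Sum>A\<in>sites_sets n (L + k). run_prob n p bs A X)"
    using sum_run_prob_chain[of _ n L "\<lambda>_. 1" p k] by (intro sum.cong refl) auto
  also have "\<dots> = (\<Sum>bs\<in>sites_lists n k. \<Sum>A\<in>sites_sets n (L + k). \<Sum>X\<in>sites_sets n L. run_prob n p bs A X)"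
    by (subst sum.swap, rule sum.cong[OF refl], rule sum.swap)
  also have "\<dots> = (\<Sum>bs\<in>sites_lists n k. \<Sum>A\<in>sites_sets n (L + k). 1)"
    by (intro sum.cong refl sum_run_prob[OF p \<open>L > 0\<close>]) auto
  also have "\<dots> = real (n ^ k * (n choose (L + k)))"
    by (simp add: card_sites_sets card_sites_lists)
  finally show ?thesis .
qed

text \<open>With a single surviving hole, rotational symmetry makes it uniform: this evaluates the
  coefficients without solving their quadratic recursion.\<close>

lemma arc_coeff_eq:
  assumes "n > 0"
  shows "real n * fact b * arc_coeff b n = real n ^ b * real (n choose Suc b)"
proof -
  \<comment> \<open>\<open>arc_coeff\<close> does not involve the bias, so any admissible value may
    be chosen; here every step goes up.\<close>
  have "(\<Sum>X\<in>sites_sets n 1. (chain_step n 1 ^^ b) (\<lambda>_. 1) X) = (\<Sum>X\<in>sites_sets n 1. fact b * arc_coeff b n)"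
  proof (rule sum.cong[OF refl])
    fix X assume X: "X \<in> sites_sets n 1"
    then obtain x where x: "X = {x}" by (auto simp: card_1_singleton_iff)
    have "cyc_gap n X x = n" using sum_cyc_gap[of X n] X by (simp add: x)
    then show "(chain_step n 1 ^^ b) (\<lambda>_. 1) X = fact b * arc_coeff b n"
      using X by (subst chain_step_power_arcs) (auto simp: x arc_fps_def)
  qed
  then show ?thesis
    using sum_chain_power_total[where p=1 and L=1 and n=n and k=b] by (simp add: card_sites_sets mult_ac)
qed

section \<open>Clocks and walks\<close>

abbreviation clock_space :: "real measure" where
  "clock_space \<equiv> uniform_measure lborel {0..1}"

abbreviation ball_space :: "real \<Rightarrow> (real \<times> bool stream) measure" where
  "ball_space p \<equiv> clock_space \<Otimes>\<^sub>M coin_space p"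

abbreviation balls_space :: "nat \<Rightarrow> real \<Rightarrow> (nat \<Rightarrow> real \<times> bool stream) measure" where
  "balls_space n p \<equiv> (\<Pi>\<^sub>M x\<in>{..<n}. ball_space p)"

abbreviation clocks_space :: "nat \<Rightarrow> (nat \<Rightarrow> real) measure" where
  "clocks_space n \<equiv> (\<Pi>\<^sub>M x\<in>{..<n}. clock_space)"

lemma prob_space_clock_space: "prob_space clock_space"
  by (rule prob_space_uniform_measure) auto

lemma prob_space_ball_space: "prob_space (ball_space p)"
proof -
  interpret A: prob_space clock_space by (rule prob_space_clock_space)
  interpret B: prob_space "coin_space p" by (rule prob_space_coin_space)
  interpret pair_prob_space clock_space "coin_space p" ..
  show ?thesis by unfold_locales
qed

lemma prob_space_balls_space: "prob_space (balls_space n p)"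
  by (intro prob_space_PiM prob_space_ball_space)

lemma prob_space_clocks_space: "prob_space (clocks_space n)"
  by (intro prob_space_PiM prob_space_clock_space)

lemma space_ball_space [simp]: "space (ball_space p) = UNIV"
  by (simp add: space_pair_measure)

text \<open>Outside the index set a coordinate is the constant \<open>undefined\<close>. Allowing
  every index lets runs be treated for arbitrary lists of sites.\<close>

lemma measurable_coordinate:
  assumes "space N = UNIV"
  shows "(\<lambda>W. W b) \<in> (\<Pi>\<^sub>M x\<in>I. N) \<rightarrow>\<^sub>M N"
proof (cases "b \<in> I")
  case False
  then have "(\<lambda>W. W b) \<in> (\<Pi>\<^sub>M x\<in>I. N) \<rightarrow>\<^sub>M N \<longleftrightarrow> (\<lambda>W. undefined) \<in> (\<Pi>\<^sub>M x\<in>I. N) \<rightarrow>\<^sub>M N"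
    by (intro measurable_cong) (auto simp: space_PiM PiE_def extensional_def)
  then show ?thesis using assms by simp
qed simp

lemma measurable_clocks_coordinate: "(\<lambda>c. c z) \<in> borel_measurable (clocks_space n)"
proof -
  have "(\<lambda>c. c z) \<in> clocks_space n \<rightarrow>\<^sub>M clock_space" by (rule measurable_coordinate) simp
  moreover have "sets clock_space = sets borel" by simp
  ultimately show ?thesis using measurable_cong_sets[OF refl] by blast
qed

lemma measurable_clock: "(\<lambda>W. fst (W b)) \<in> balls_space n p \<rightarrow>\<^sub>M clock_space"
  by (rule measurable_compose[OF measurable_coordinate measurable_fst]) simp

lemma measurable_walk: "(\<lambda>W. snd (W b)) \<in> balls_space n p \<rightarrow>\<^sub>M coin_space p"
  by (rule measurable_compose[OF measurable_coordinate measurable_snd]) simp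

lemma measurable_clocks: "(\<lambda>W. \<lambda>x\<in>{..<n}. fst (W x)) \<in> balls_space n p \<rightarrow>\<^sub>M clocks_space n"
  by (rule measurable_restrict) (rule measurable_clock)

lemma sets_balls_space_walk:
  "V \<in> sets (coin_space p) \<Longrightarrow> {W \<in> space (balls_space n p). snd (W x) \<in> V} \<in> sets (balls_space n p)"
  using measurable_sets[OF measurable_walk] by (simp add: vimage_def Int_def conj_commute)

lemma sets_balls_space_clocks:
  "C \<in> sets (clocks_space n) \<Longrightarrow>
    {W \<in> space (balls_space n p). (\<lambda>x\<in>{..<n}. fst (W x)) \<in> C} \<in> sets (balls_space n p)"
  using measurable_sets[OF measurable_clocks] by (simp add: vimage_def Int_def conj_commute)

text \<open>The clock event is arbitrary because an order of the clocks is not a product event.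
  Restricting to the walk event and projecting to the clocks gives a finite measure that agrees on
  boxes with a constant multiple of the clock law, hence everywhere.\<close>

lemma prob_clocks_walks:
  assumes C: "C \<in> sets (clocks_space n)" and J: "J \<subseteq> {..<n}" and V: "\<And>x. x \<in> J \<Longrightarrow> V x \<in> sets (coin_space p)"
  shows "measure (balls_space n p) {W \<in> space (balls_space n p). (\<lambda>x\<in>{..<n}. fst (W x)) \<in> C \<and> (\<forall>x\<in>J. snd (W x) \<in> V x)}
    = measure (clocks_space n) C * (\<Prod>x\<in>J. measure (coin_space p) (V x))"
proof -
  let ?I = "{..<n}" and ?M = "balls_space n p" and ?K = "clocks_space n"
  define Z where "Z = {W \<in> space ?M. (\<lambda>x\<in>?I. fst (W x)) \<in> C \<and> (\<forall>x\<in>J. snd (W x) \<in> V x)}"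
  \<comment> \<open>Sites outside \<open>J\<close> get the trivial constraint, so that the walk
    event becomes a product over all sites.\<close>
  define V' where "V' x = (if x \<in> J then V x else UNIV)" for x
  have V' [measurable]: "V' x \<in> sets (coin_space p)" for x
    using V sets.top[of "coin_space p"] by (auto simp: V'_def)
  interpret A: prob_space clock_space by (rule prob_space_clock_space)
  interpret B: prob_space "coin_space p" by (rule prob_space_coin_space)
  interpret AB: prob_space "ball_space p" by (rule prob_space_ball_space)
  interpret K: prob_space ?K by (rule prob_space_clocks_space)
  interpret M: prob_space ?M by (rule prob_space_balls_space)
  interpret PA: product_sigma_finite "\<lambda>_. clock_space" ..
  interpret PAB: product_sigma_finite "\<lambda>_. ball_space p" ..
  define S where "S = {W \<in> space ?M. \<forall>x\<in>?I. snd (W x) \<in> V' x}"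
  have S: "S \<in> sets ?M"
    unfolding S_def by (rule sets.sets_Collect_finite_All[OF sets_balls_space_walk[OF V'] finite_lessThan])
  define c where "c = (\<Prod>x\<in>?I. emeasure (coin_space p) (V' x))"
  define T where "T W = (\<lambda>x\<in>?I. fst (W x))" for W :: "nat \<Rightarrow> real \<times> bool stream"
  have T: "T \<in> ?M \<rightarrow>\<^sub>M ?K" unfolding T_def by (rule measurable_clocks)
  have restr: "emeasure (distr (density ?M (indicator S)) ?K T) C = emeasure ?M (S \<inter> (T -` C \<inter> space ?M))"
    if "C \<in> sets ?K" for C
  proof -
    have "emeasure (distr (density ?M (indicator S)) ?K T) C = emeasure (density ?M (indicator S)) (T -` C \<inter> space ?M)"
      using T that by (subst emeasure_distr) auto
    also have "\<dots> = emeasure ?M (S \<inter> (T -` C \<inter> space ?M))"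
      by (rule emeasure_restricted[OF S measurable_sets[OF T that]])
    finally show ?thesis .
  qed
  have "distr (density ?M (indicator S)) ?K T = density ?K (\<lambda>_. c)"
  proof (rule measure_eqI_PiM_finite[where I = ?I and M = "\<lambda>_. clock_space" and A = "\<lambda>_. space ?K"])
    fix E assume E: "\<And>i. i \<in> ?I \<Longrightarrow> E i \<in> sets clock_space"
    have PE: "Pi\<^sub>E ?I E \<in> sets ?K" using E by (intro sets_PiM_I_finite) auto
    have eq: "S \<inter> (T -` Pi\<^sub>E ?I E \<inter> space ?M) = Pi\<^sub>E ?I (\<lambda>x. E x \<times> V' x)"
    proof (intro set_eqI iffI)
      fix W assume "W \<in> S \<inter> (T -` Pi\<^sub>E ?I E \<inter> space ?M)"
      then show "W \<in> Pi\<^sub>E ?I (\<lambda>x. E x \<times> V' x)"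
        by (auto simp: T_def S_def space_PiM PiE_iff mem_Times_iff)
    next
      fix W assume "W \<in> Pi\<^sub>E ?I (\<lambda>x. E x \<times> V' x)"
      then show "W \<in> S \<inter> (T -` Pi\<^sub>E ?I E \<inter> space ?M)"
        by (simp add: T_def S_def space_PiM PiE_iff mem_Times_iff space_pair_measure)
    qed
    have "emeasure (distr (density ?M (indicator S)) ?K T) (Pi\<^sub>E ?I E) = emeasure ?M (Pi\<^sub>E ?I (\<lambda>x. E x \<times> V' x))"
      using restr[OF PE] eq by simp
    also have "\<dots> = (\<Prod>x\<in>?I. emeasure (ball_space p) (E x \<times> V' x))"
      using E by (intro PAB.emeasure_PiM) auto
    also have "\<dots> = (\<Prod>x\<in>?I. emeasure clock_space (E x) * emeasure (coin_space p) (V' x))"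
      using E by (intro prod.cong refl B.emeasure_pair_measure_Times) auto
    also have "\<dots> = c * emeasure ?K (Pi\<^sub>E ?I E)"
      using E by (subst PA.emeasure_PiM) (auto simp: prod.distrib c_def mult.commute)
    also have "\<dots> = emeasure (density ?K (\<lambda>_. c)) (Pi\<^sub>E ?I E)"
      using PE by (simp add: emeasure_density_const)
    finally show "emeasure (distr (density ?M (indicator S)) ?K T) (Pi\<^sub>E ?I E) = emeasure (density ?K (\<lambda>_. c)) (Pi\<^sub>E ?I E)" .
  next
    show "range (\<lambda>_::nat. space ?K) \<subseteq> prod_algebra ?I (\<lambda>_. clock_space)"
      by (auto simp: space_PiM intro!: prod_algebraI_finite)
    show "emeasure (distr (density ?M (indicator S)) ?K T) (space ?K) \<noteq> \<infinity>"
      using restr[OF sets.top] by simp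
  qed auto
  then have "emeasure (distr (density ?M (indicator S)) ?K T) C = emeasure (density ?K (\<lambda>_. c)) C" by simp
  also have "emeasure (distr (density ?M (indicator S)) ?K T) C = emeasure ?M (S \<inter> (T -` C \<inter> space ?M))"
    by (rule restr[OF C])
  also have "S \<inter> (T -` C \<inter> space ?M) = Z"
    unfolding Z_def using J by (auto simp: S_def T_def V'_def)
  also have "emeasure (density ?K (\<lambda>_. c)) C = c * emeasure ?K C"
    using C by (simp add: emeasure_density_const)
  also have "c = (\<Prod>x\<in>J. emeasure (coin_space p) (V x))"
    unfolding c_def using J B.emeasure_space_1 by (intro prod.mono_neutral_cong_right) (auto simp: V'_def)
  also have "\<dots> = ennreal (\<Prod>x\<in>J. measure (coin_space p) (V x))"
    by (simp only: B.emeasure_eq_measure) (simp add: prod_ennreal)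
  finally have "ennreal (measure ?M Z) = ennreal (measure ?K C * (\<Prod>x\<in>J. measure (coin_space p) (V x)))"
    by (simp only: M.emeasure_eq_measure K.emeasure_eq_measure)
       (simp add: ennreal_mult[symmetric] prod_nonneg mult.commute)
  then show ?thesis
    unfolding Z_def by (subst (asm) ennreal_inj) (auto intro!: mult_nonneg_nonneg prod_nonneg)
qed

text \<open>Fubini in coordinate \<open>x\<close>: once the other clocks are fixed, a tie confines
  this clock to a single point.\<close>

lemma prob_clock_tie:
  assumes "x < n" "y < n" "x \<noteq> y"
  shows "{c \<in> space (clocks_space n). c x = c y} \<in> null_sets (clocks_space n)"
proof -
  let ?K = "clocks_space n"
  interpret A: prob_space clock_space by (rule prob_space_clock_space)
  interpret PA: product_sigma_finite "\<lambda>_. clock_space" ..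
  have meas: "{c \<in> space ?K. c x = c y} \<in> sets ?K"
    by (rule borel_measurable_eq) (rule measurable_clocks_coordinate)+
  define I where "I = {..<n} - {x}"
  have K: "?K = (\<Pi>\<^sub>M i\<in>insert x I. clock_space)"
    using assms by (simp add: I_def insert_absorb)
  have single: "emeasure clock_space {t} = 0" for t
  proof -
    have "emeasure lborel ({0..1} \<inter> {t}) \<le> emeasure lborel {t}" by (intro emeasure_mono) auto
    then show ?thesis by (simp add: emeasure_uniform_measure)
  qed
  define T where "T = {c \<in> space ?K. c x = c y}"
  have "emeasure ?K T = (\<integral>\<^sup>+c. indicator T c \<partial>?K)"
    using meas by (simp add: T_def)
  also have "\<dots> = (\<integral>\<^sup>+c. (\<integral>\<^sup>+t. indicator T (c(x := t)) \<partial>clock_space) \<partial>(\<Pi>\<^sub>M i\<in>I. clock_space))"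
    using meas unfolding K T_def by (intro PA.product_nn_integral_insert) (auto simp: I_def)
  also have "\<dots> \<le> (\<integral>\<^sup>+c. (\<integral>\<^sup>+t. indicator {c y} t \<partial>clock_space) \<partial>(\<Pi>\<^sub>M i\<in>I. clock_space))"
    using assms by (intro nn_integral_mono) (auto simp: T_def split: split_indicator)
  also have "\<dots> = (\<integral>\<^sup>+c. emeasure clock_space {c y} \<partial>(\<Pi>\<^sub>M i\<in>I. clock_space))"
    by (intro nn_integral_cong nn_integral_indicator) simp
  also have "\<dots> = 0" by (simp only: single nn_integral_const) simp
  finally show ?thesis using meas by (auto simp: null_sets_def T_def)
qed

text \<open>Lists over a countable type form a countable type, so one may split according to the
  sorted tail; inserting into a fixed list takes finitely many comparisons.\<close>

lemma measurable_sort_key: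
  fixes f :: "'a \<Rightarrow> 'b::countable \<Rightarrow> real"
  assumes f: "\<And>x. (\<lambda>c. f c x) \<in> borel_measurable M"
  shows "(\<lambda>c. sort_key (f c) xs) \<in> M \<rightarrow>\<^sub>M count_space UNIV"
proof (induction xs)
  case (Cons x xs)
  have ins: "(\<lambda>c. insort_key (f c) x ys) \<in> M \<rightarrow>\<^sub>M count_space UNIV" for ys
  proof (induction ys)
    case (Cons y ys)
    have "(\<lambda>c. y # insort_key (f c) x ys) \<in> M \<rightarrow>\<^sub>M count_space UNIV"
      by (rule measurable_compose[OF Cons]) simp
    then show ?case using f by (simp add: measurable_If)
  qed simp
  show ?case unfolding sort_key_simps
    by (rule measurable_compose_countable[OF ins Cons])
qed simp

lemma sets_sort_key:
  "{c \<in> space (clocks_space n). sort_key c xs = bs} \<in> sets (clocks_space n)"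
proof -
  have "(\<lambda>c. sort_key (\<lambda>x. c x) xs) \<in> clocks_space n \<rightarrow>\<^sub>M count_space UNIV"
    by (intro measurable_sort_key measurable_clocks_coordinate)
  from measurable_sets[OF this, of "{bs}"] show ?thesis by (simp add: vimage_def Int_def conj_commute)
qed

text \<open>Exchangeability: up to ties, the events of the different launch orders arise from each
  other by relabelling coordinates, hence are equally likely, and exactly one of them
  occurs.\<close>

lemma prob_sort_key:
  assumes B: "B \<subseteq> {..<n}" and bs: "bs \<in> permutations_of_set B"
  shows "measure (clocks_space n) {c \<in> space (clocks_space n). sort_key c (sorted_list_of_set B) = bs} = 1 / fact (card B)"
proof -
  let ?K = "clocks_space n"
  interpret K: prob_space ?K by (rule prob_space_clocks_space)
  have fin: "finite B" using B finite_subset by auto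
  define N where "N = card B"
  define C where "C bs = {c \<in> space ?K. sort_key c (sorted_list_of_set B) = bs}" for bs
  define S where "S bs = {c \<in> space ?K. \<forall>i<N. \<forall>j<N. i < j \<longrightarrow> c (bs ! i) < c (bs ! j)}" for bs
  define S0 where "S0 = {c \<in> space (clocks_space N). \<forall>i<N. \<forall>j<N. i < j \<longrightarrow> c i < c j}"
  define tie where "tie = (\<Union>x\<in>B. \<Union>y\<in>B - {x}. {c \<in> space ?K. c x = c y})"
  have C: "C bs \<in> sets ?K" for bs unfolding C_def by (rule sets_sort_key)
  have ordered: "{c \<in> space (clocks_space m). \<forall>i<N. \<forall>j<N. i < j \<longrightarrow> c (f i) < c (f j)} \<in> sets (clocks_space m)" for m f
  proof -
    have [measurable]: "Measurable.pred (clocks_space m) (\<lambda>c. c (f i) < c (f j))" for i j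
      by (intro borel_measurable_pred_less measurable_clocks_coordinate)
    show ?thesis by measurable
  qed
  have S: "S bs \<in> sets ?K" for bs unfolding S_def by (rule ordered)
  have S0: "S0 \<in> sets (clocks_space N)" unfolding S0_def by (rule ordered)
  have perm: "set bs = B" "distinct bs" "length bs = N" if "bs \<in> permutations_of_set B" for bs
    using that permutations_of_setD[OF that] distinct_card[of bs] by (auto simp: N_def)
  have sub: "S bs \<subseteq> C bs" if bs: "bs \<in> permutations_of_set B" for bs
  proof
    fix c assume c: "c \<in> S bs"
    have strict: "sorted_wrt (<) (map c bs)"
      using c perm[OF bs] by (auto simp: S_def sorted_wrt_iff_nth_less)
    then have "inj_on c (set bs)" using strict_sorted_iff[of "map c bs"] by (simp add: distinct_map)
    moreover have "mset (sorted_list_of_set B) = mset bs"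
      using perm[OF bs] fin by (intro set_eq_iff_mset_eq_distinct[THEN iffD1]) auto
    ultimately have "sort_key c (sorted_list_of_set B) = bs"
      using strict strict_sorted_iff[of "map c bs"] perm(1)[OF bs] fin by (intro sort_key_inj_key_eq) auto
    then show "c \<in> C bs" using c by (simp add: C_def S_def)
  qed
  \<comment> \<open>Sorting leaves a weak order only; it can fail to be strict only when two clocks
    coincide.\<close>
  have sup: "C bs \<subseteq> S bs \<union> tie" if bs: "bs \<in> permutations_of_set B" for bs
  proof
    fix c assume c: "c \<in> C bs"
    then have srt: "sorted (map c bs)" using sorted_sort_key[of c "sorted_list_of_set B"] by (auto simp: C_def)
    show "c \<in> S bs \<union> tie"
    proof (cases "inj_on c B")
      case True
      then have "sorted_wrt (<) (map c bs)"
        using srt perm[OF bs] by (simp add: strict_sorted_iff distinct_map)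
      then show ?thesis using c perm[OF bs] by (auto simp: S_def C_def sorted_wrt_iff_nth_less)
    next
      case False
      then show ?thesis using c by (auto simp: inj_on_def tie_def C_def)
    qed
  qed
  have tie: "tie \<in> null_sets ?K"
    unfolding tie_def using fin B
    by (intro null_sets_UN' countable_finite prob_clock_tie) auto
  have CS: "measure ?K (C bs) = measure ?K (S bs)" if bs: "bs \<in> permutations_of_set B" for bs
  proof (rule antisym)
    have "measure ?K (C bs) \<le> measure ?K (S bs \<union> tie)"
      using sup[OF bs] S tie by (intro K.finite_measure_mono) auto
    also have "\<dots> = measure ?K (S bs)" using S tie by (rule measure_Un_null_set)
    finally show "measure ?K (C bs) \<le> measure ?K (S bs)" .
    show "measure ?K (S bs) \<le> measure ?K (C bs)" using sub[OF bs] C by (intro K.finite_measure_mono) auto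
  qed
  \<comment> \<open>Reading the clocks along \<open>bs\<close> is an injective selection of
    coordinates, which carries the product law to that of \<open>N\<close> clocks.\<close>
  have const: "measure ?K (S bs) = measure (clocks_space N) S0" if bs: "bs \<in> permutations_of_set B" for bs
  proof -
    have "inj_on (\<lambda>i. bs ! i) {..<N}" "(\<lambda>i. bs ! i) \<in> {..<N} \<rightarrow> {..<n}"
      using perm[OF bs] B by (auto simp: inj_on_def nth_eq_iff_index_eq dest: nth_mem)
    from distr_PiM_reindex[OF _ this, of "\<lambda>_. clock_space"] prob_space_clock_space
    have "measure (clocks_space N) S0 = measure (distr ?K (clocks_space N) (\<lambda>\<omega>. \<lambda>i\<in>{..<N}. \<omega> (bs ! i))) S0"
      by simp
    also have "\<dots> = measure ?K ((\<lambda>\<omega>. \<lambda>i\<in>{..<N}. \<omega> (bs ! i)) -` S0 \<inter> space ?K)"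
      using S0 by (intro measure_distr measurable_restrict measurable_coordinate) auto
    also have "(\<lambda>\<omega>. \<lambda>i\<in>{..<N}. \<omega> (bs ! i)) -` S0 \<inter> space ?K = S bs"
      by (auto simp: S0_def S_def space_PiM)
    finally show ?thesis by simp
  qed
  have "(\<Sum>bs\<in>permutations_of_set B. measure ?K (C bs)) = measure ?K (\<Union>bs\<in>permutations_of_set B. C bs)"
    using C by (intro K.finite_measure_finite_Union[symmetric]) (auto simp: disjoint_family_on_def C_def)
  also have "(\<Union>bs\<in>permutations_of_set B. C bs) = space ?K"
    using fin by (auto simp: C_def permutations_of_set_def)
  finally have "fact N * measure (clocks_space N) S0 = 1"
    using fin by (simp add: CS const K.prob_space N_def)
  then show ?thesis using CS[OF bs] const[OF bs] by (simp add: C_def N_def field_simps)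
qed

section \<open>Runs along a fixed launch order\<close>

abbreviation golf_run :: "nat \<Rightarrow> nat set \<Rightarrow> (nat \<Rightarrow> real \<times> bool stream) \<Rightarrow> nat set \<Rightarrow> nat list \<Rightarrow> nat set" where
  "golf_run n H W \<equiv> foldl (\<lambda>F b. F \<union> golf_hit n H F b (snd (W b)))"

lemma walk_pos_less: "n > 0 \<Longrightarrow> walk_pos n b w k < n"
  by (simp add: walk_pos_def nat_less_iff)

lemma golf_hit_subset: "n > 0 \<Longrightarrow> golf_hit n H F b w \<subseteq> {..<n}"
  by (simp add: golf_hit_def walk_pos_less)

text \<open>Holes off the sites are invisible to the walk, so a run depends on the hole set only
  through one of finitely many traces.\<close>

lemma golf_hit_restrict:
  assumes "n > 0"
  shows "golf_hit n (H \<inter> {..<n}) F b w = golf_hit n H F b w"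
proof -
  have "walk_pos n b w k \<in> H \<inter> {..<n} - F \<longleftrightarrow> walk_pos n b w k \<in> H - F" for k
    using walk_pos_less[OF assms, of b w k] by blast
  then show ?thesis by (simp only: golf_hit_def)
qed

lemma golf_hit_Diff: "golf_hit n H F b w = golf_hit n (H - F) {} b w"
  by (simp add: golf_hit_def)

lemma golf_run_subset:
  assumes "n > 0"
  shows "F \<subseteq> {..<n} \<Longrightarrow> golf_run n H W F bs \<subseteq> {..<n}"
proof (induction bs arbitrary: F)
  case (Cons b bs)
  have "F \<union> golf_hit n H F b (snd (W b)) \<subseteq> {..<n}"
    using Cons.prems golf_hit_subset[OF assms] by (rule Un_least)
  then show ?case using Cons.IH by (simp only: foldl.simps)
qed simp

lemma measurable_golf_run:
  assumes n: "n > 0"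
  shows "F \<subseteq> {..<n} \<Longrightarrow> (\<lambda>W. golf_run n H W F bs) \<in> balls_space n p \<rightarrow>\<^sub>M count_space (Pow {..<n})"
proof (induction bs arbitrary: F)
  case (Cons b bs)
  have "(\<lambda>w. golf_hit n H F b w) \<in> coin_space p \<rightarrow>\<^sub>M count_space (Pow {..<n})"
  proof (subst measurable_count_space_eq2)
    have "golf_hit n H F b -` {S} = {w. golf_hit n H F b w = S}" for S by auto
    then show "(\<lambda>w. golf_hit n H F b w) \<in> space (coin_space p) \<rightarrow> Pow {..<n} \<and>
        (\<forall>S\<in>Pow {..<n}. (\<lambda>w. golf_hit n H F b w) -` {S} \<inter> space (coin_space p) \<in> sets (coin_space p))"
      using golf_hit_subset[OF n] measurable_golf_hit by simp
  qed simp
  then have "(\<lambda>W. golf_hit n H F b (snd (W b))) \<in> balls_space n p \<rightarrow>\<^sub>M count_space (Pow {..<n})"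
    by (rule measurable_compose[OF measurable_walk])
  moreover have "(\<lambda>A. F \<union> A) \<in> count_space (Pow {..<n}) \<rightarrow>\<^sub>M count_space (Pow {..<n})"
    using Cons.prems by auto
  ultimately have g: "(\<lambda>W. F \<union> golf_hit n H F b (snd (W b))) \<in> balls_space n p \<rightarrow>\<^sub>M count_space (Pow {..<n})"
    by (rule measurable_compose)
  have "(\<lambda>W. golf_run n H W (F \<union> golf_hit n H F b (snd (W b))) bs) \<in>
      balls_space n p \<rightarrow>\<^sub>M count_space (Pow {..<n})"
    by (rule measurable_compose_countable'[OF _ g]) (auto intro!: Cons.IH countable_finite)
  then show ?case by (simp only: foldl.simps)
qed simp

text \<open>The sites in \<open>bs\<close> are distinct, so each launch reads a fresh walk. The
  induction moves the launched ball into \<open>J\<close> and records its landing site as a further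
  constraint in \<open>V\<close>; the clock event \<open>C\<close> rides along to bring in the
  random order later.\<close>

lemma prob_golf_run:
  assumes p: "0 \<le> p" "p \<le> 1" and n: "n > 0" and C: "C \<in> sets (clocks_space n)"
    and A: "A \<subseteq> {..<n}"
  shows "F \<subseteq> A \<Longrightarrow> distinct bs \<Longrightarrow> set bs \<subseteq> {..<n} \<Longrightarrow> J \<subseteq> {..<n} \<Longrightarrow> J \<inter> set bs = {} \<Longrightarrow>
    (\<And>x. x \<in> J \<Longrightarrow> V x \<in> sets (coin_space p)) \<Longrightarrow> length bs < card (A - F) \<Longrightarrow>
    measure (balls_space n p) {W \<in> space (balls_space n p). (\<lambda>x\<in>{..<n}. fst (W x)) \<in> C \<and>
        (\<forall>x\<in>J. snd (W x) \<in> V x) \<and> A - golf_run n A W F bs = X}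
    = measure (clocks_space n) C * (\<Prod>x\<in>J. measure (coin_space p) (V x)) * run_prob n p bs (A - F) X"
proof (induction bs arbitrary: F J V)
  case Nil
  show ?case
  proof (cases "A - F = X")
    case True
    have "measure (balls_space n p) {W \<in> space (balls_space n p). (\<lambda>x\<in>{..<n}. fst (W x)) \<in> C \<and> (\<forall>x\<in>J. snd (W x) \<in> V x)}
        = measure (clocks_space n) C * (\<Prod>x\<in>J. measure (coin_space p) (V x))"
      using Nil by (intro prob_clocks_walks[OF C]) auto
    then show ?thesis by (simp only: foldl.simps True simp_thms run_prob.simps if_True mult_1_right)
  qed simp
next
  case (Cons b bs)
  let ?M = "balls_space n p"
  interpret M: prob_space ?M by (rule prob_space_balls_space)
  interpret B: prob_space "coin_space p" by (rule prob_space_coin_space)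
  have finA: "finite A" using A finite_subset by auto
  have bn: "b < n" and bJ: "b \<notin> J" using Cons.prems by auto
  have finJ: "finite J" using finite_subset[OF Cons.prems(4)] by simp
  define hitset where "hitset h = {w. golf_hit n (A - F) {} b w = {h}}" for h
  define miss where "miss = {w. golf_hit n (A - F) {} b w = {}}"
  have [measurable]: "hitset h \<in> sets (coin_space p)" "miss \<in> sets (coin_space p)" for h
    unfolding hitset_def miss_def by (rule measurable_golf_hit)+
  have hit_cases: "w \<in> miss \<or> (\<exists>h\<in>A - F. w \<in> hitset h)" for w
    using LeastI_ex[of "\<lambda>k. walk_pos n b w k \<in> A - F"] by (auto simp: miss_def hitset_def golf_hit_def)
  \<comment> \<open>At least two holes are open, so the landing probabilities already sum to one and
    never hitting is a null event.\<close>
  have miss0: "measure (coin_space p) miss = 0"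
  proof -
    have "1 = (\<Sum>h\<in>A - F. measure (coin_space p) (hitset h))"
      using sum_hit_prob[OF p, of "A - F" n b] A Cons.prems bn by (auto simp: hit_prob_def hitset_def)
    also have "\<dots> = measure (coin_space p) (\<Union>h\<in>A - F. hitset h)"
      using finA by (intro B.finite_measure_finite_Union[symmetric]) (auto simp: disjoint_family_on_def hitset_def measurable_golf_hit)
    finally have one: "measure (coin_space p) (\<Union>h\<in>A - F. hitset h) = 1" by simp
    have "measure (coin_space p) (miss \<union> (\<Union>h\<in>A - F. hitset h)) =
        measure (coin_space p) miss + measure (coin_space p) (\<Union>h\<in>A - F. hitset h)"
      using finA by (intro B.finite_measure_Union) (auto simp: miss_def hitset_def measurable_golf_hit)
    then show ?thesis using one B.prob_le_1[of "miss \<union> (\<Union>h\<in>A - F. hitset h)"] measure_nonneg[of "coin_space p" miss]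
      by linarith
  qed
  define E where "E bs' F' J' V' = {W \<in> space ?M. (\<lambda>x\<in>{..<n}. fst (W x)) \<in> C \<and>
        (\<forall>x\<in>J'. snd (W x) \<in> V' x) \<and> A - golf_run n A W F' bs' = X}" for bs' F' J' V'
  have E_sets: "E bs' F' J' V' \<in> sets ?M"
    if "F' \<subseteq> A" "finite J'" "\<And>x. x \<in> J' \<Longrightarrow> V' x \<in> sets (coin_space p)" for bs' F' J' V'
  proof -
    have "(\<lambda>W. golf_run n A W F' bs') \<in> ?M \<rightarrow>\<^sub>M count_space (Pow {..<n})"
      using that A by (intro measurable_golf_run[OF n]) auto
    moreover have "{F \<in> Pow {..<n}. A - F = X} \<in> sets (count_space (Pow {..<n}))" by auto
    ultimately have "(\<lambda>W. golf_run n A W F' bs') -` {F \<in> Pow {..<n}. A - F = X} \<inter> space ?M \<in> sets ?M"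
      by (rule measurable_sets)
    then have "{W \<in> space ?M. golf_run n A W F' bs' \<subseteq> {..<n} \<and> A - golf_run n A W F' bs' = X} \<in> sets ?M"
      by (simp add: vimage_def Int_def conj_commute)
    moreover have "golf_run n A W F' bs' \<subseteq> {..<n}" for W using that A golf_run_subset[OF n] by blast
    ultimately have "{W \<in> space ?M. A - golf_run n A W F' bs' = X} \<in> sets ?M" by simp
    then show ?thesis
      unfolding E_def using that
      by (intro sets.sets_Collect_conj sets_balls_space_clocks[OF C] sets.sets_Collect_finite_All sets_balls_space_walk)
         (auto intro!: sets.sets_Collect_finite_All sets_balls_space_walk)
  qed
  define V' where "V' h = V(b := hitset h)" for h
  have V': "V' h b = hitset h" "x \<in> J \<Longrightarrow> V' h x = V x" for h x using bJ by (auto simp: V'_def)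
  have E_hit: "measure ?M (E bs (insert h F) (insert b J) (V' h)) = measure (clocks_space n) C *
      (\<Prod>x\<in>J. measure (coin_space p) (V x)) * (hit_prob n p (A - F) b h * run_prob n p bs (A - F - {h}) X)"
    if h: "h \<in> A - F" for h
  proof -
    have "measure ?M (E bs (insert h F) (insert b J) (V' h)) = measure (clocks_space n) C *
      (\<Prod>x\<in>insert b J. measure (coin_space p) (V' h x)) * run_prob n p bs (A - insert h F) X"
      unfolding E_def
    proof (rule Cons.IH)
      have "card (A - insert h F) = card (A - F) - 1"
        using h finA by (metis Diff_insert card_Diff_singleton finite_Diff)
      then show "length bs < card (A - insert h F)" using Cons.prems by simp
    qed (use Cons.prems h bn in \<open>auto simp: V'\<close>)
    also have "(\<Prod>x\<in>insert b J. measure (coin_space p) (V' h x)) =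
        hit_prob n p (A - F) b h * (\<Prod>x\<in>J. measure (coin_space p) (V x))"
      using finJ bJ by (simp add: hit_prob_def hitset_def V' cong: prod.cong)
    also have "A - insert h F = A - F - {h}" by auto
    finally show ?thesis by (simp add: mult_ac)
  qed
  \<comment> \<open>Off the null event the walk of \<open>b\<close> determines its landing site
    \<open>h\<close>, and only the event for this \<open>h\<close> is possible.\<close>
  have iff: "W \<in> E (b # bs) F J V \<longleftrightarrow> W \<in> (\<Union>h\<in>A - F. E bs (insert h F) (insert b J) (V' h))"
    if miss: "snd (W b) \<notin> miss" for W
  proof -
    obtain h where h: "h \<in> A - F" "snd (W b) \<in> hitset h" using hit_cases miss by blast
    then have hit: "golf_hit n A F b (snd (W b)) = {h}" using golf_hit_Diff by (simp add: hitset_def)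
    have "W \<in> E (b # bs) F J V \<longleftrightarrow> W \<in> E bs (insert h F) (insert b J) (V' h)"
      using h by (auto simp: E_def hit V')
    moreover have "h' = h" if "W \<in> E bs (insert h' F) (insert b J) (V' h')" for h'
    proof -
      have "snd (W b) \<in> hitset h'" using that by (simp add: E_def V')
      then show ?thesis using h by (simp add: hitset_def)
    qed
    ultimately show ?thesis using h by blast
  qed
  have "{W \<in> space ?M. snd (W b) \<in> miss} \<in> null_sets ?M"
  proof -
    have "measure ?M {W \<in> space ?M. snd (W b) \<in> miss} = 0"
      using prob_clocks_walks[OF sets.top, of "{b}" n "\<lambda>_. miss" p] bn miss0
        measurable_space[OF measurable_clocks, of _ n p] by (auto cong: conj_cong)
    then show ?thesis using sets_balls_space_walk[of miss p n b] by (simp add: null_sets_def M.emeasure_eq_measure)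
  qed
  then have "AE W in ?M. snd (W b) \<notin> miss" by (rule AE_I') auto
  then have "AE W in ?M. W \<in> E (b # bs) F J V \<longleftrightarrow> W \<in> (\<Union>h\<in>A - F. E bs (insert h F) (insert b J) (V' h))"
    by (rule AE_mp) (use iff in auto)
  then have "measure ?M (E (b # bs) F J V) = measure ?M (\<Union>h\<in>A - F. E bs (insert h F) (insert b J) (V' h))"
    using Cons.prems finA finJ by (intro M.finite_measure_eq_AE sets.finite_UN E_sets) (auto simp: V')
  also have "\<dots> = (\<Sum>h\<in>A - F. measure ?M (E bs (insert h F) (insert b J) (V' h)))"
  proof (rule M.finite_measure_finite_Union)
    show "(\<lambda>h. E bs (insert h F) (insert b J) (V' h)) ` (A - F) \<subseteq> sets ?M"
      using Cons.prems finA finJ by (auto intro!: E_sets simp: V')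
    show "disjoint_family_on (\<lambda>h. E bs (insert h F) (insert b J) (V' h)) (A - F)"
      by (auto simp: disjoint_family_on_def E_def V') (auto simp: hitset_def)
  qed (use finA in auto)
  also have "\<dots> = measure (clocks_space n) C * (\<Prod>x\<in>J. measure (coin_space p) (V x)) * run_prob n p (b # bs) (A - F) X"
    by (simp add: E_hit sum_distrib_left)
  finally show ?case unfolding E_def .
qed

section \<open>The law of the golf process\<close>

lemma golf_filled_restrict:
  assumes "n > 0"
  shows "golf_filled n B H W = golf_run n (H \<inter> {..<n}) W {} (sort_key (\<lambda>b. fst (W b)) (sorted_list_of_set B))"
  using golf_hit_restrict[OF assms] by (simp add: golf_filled_def)

lemma measurable_golf_order:
  "(\<lambda>W. sort_key (\<lambda>b. fst (W b)) xs) \<in> balls_space n p \<rightarrow>\<^sub>M count_space UNIV"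
proof (rule measurable_sort_key)
  have "sets clock_space = sets borel" by simp
  then show "(\<lambda>W. fst (W b)) \<in> borel_measurable (balls_space n p)" for b
    using measurable_clock[of b n p] measurable_cong_sets[OF refl] by blast
qed

lemma measurable_golf_filled_list:
  assumes "n > 0"
  shows "(\<lambda>W. golf_run n A W {} (sort_key (\<lambda>b. fst (W b)) xs)) \<in> balls_space n p \<rightarrow>\<^sub>M count_space (Pow {..<n})"
  by (rule measurable_compose_countable[OF measurable_golf_run[OF assms] measurable_golf_order]) simp

lemma measurable_pmf_any:
  "f \<in> space (measure_pmf q) \<rightarrow> space N \<Longrightarrow> f \<in> measure_pmf q \<rightarrow>\<^sub>M N"
  by (simp add: measurable_def)

text \<open>The configurations form an uncountable type, so joint measurability has to go through the
  countably many possible traces on the sites.\<close>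

lemma measurable_golf_H1:
  fixes \<gamma> :: "nat set \<Rightarrow> real"
  assumes n: "n > 0"
  shows "(\<lambda>\<omega>. \<gamma> (golf_H1 n \<omega>)) \<in> borel_measurable (measure_pmf q \<Otimes>\<^sub>M balls_space n p)"
proof -
  let ?N = "measure_pmf q \<Otimes>\<^sub>M balls_space n p"
  define trace where "trace \<omega> = (sorted_list_of_set (fst (fst \<omega>)), snd (fst \<omega>) \<inter> {..<n})"
    for \<omega> :: "(nat set \<times> nat set) \<times> (nat \<Rightarrow> real \<times> bool stream)"
  define filled where "filled t \<omega> = golf_run n (snd t) (snd \<omega>) {} (sort_key (\<lambda>b. fst (snd \<omega> b)) (fst t))"
    for t and \<omega> :: "(nat set \<times> nat set) \<times> (nat \<Rightarrow> real \<times> bool stream)"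
  have cnt: "countable ((UNIV :: nat list set) \<times> Pow {..<n})"
    by (intro countable_SIGMA countableI_type countable_finite) auto
  have "(\<lambda>c. (sorted_list_of_set (fst c), snd c \<inter> {..<n})) \<in> measure_pmf q \<rightarrow>\<^sub>M count_space (UNIV \<times> Pow {..<n})"
    by (rule measurable_pmf_any) auto
  from measurable_compose[OF measurable_fst this]
  have trace: "trace \<in> ?N \<rightarrow>\<^sub>M count_space (UNIV \<times> Pow {..<n})"
    by (simp add: trace_def[abs_def])
  have filled: "filled t \<in> ?N \<rightarrow>\<^sub>M count_space (Pow {..<n})" for t
    unfolding filled_def[abs_def]
    by (rule measurable_compose[OF measurable_snd measurable_golf_filled_list[OF n]])
  have F: "(\<lambda>\<omega>. filled (trace \<omega>) \<omega>) \<in> ?N \<rightarrow>\<^sub>M count_space (Pow {..<n})"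
    by (rule measurable_compose_countable'[OF filled trace cnt])
  have G: "(\<lambda>\<omega>. \<gamma> (snd (fst \<omega>) - F)) \<in> borel_measurable ?N" for F
    by (rule measurable_compose[OF measurable_fst], rule measurable_pmf_any) simp
  have "(\<lambda>\<omega>. \<gamma> (snd (fst \<omega>) - filled (trace \<omega>) \<omega>)) \<in> borel_measurable ?N"
    by (rule measurable_compose_countable'[OF G F]) (simp add: countable_finite)
  moreover have "golf_H1 n \<omega> = snd (fst \<omega>) - filled (trace \<omega>) \<omega>" for \<omega>
    by (cases \<omega>) (auto simp: golf_H1_def filled_def trace_def golf_filled_restrict[OF n])
  ultimately show ?thesis by simp
qed

text \<open>Every term of the recursion fills one hole per launch, so outcomes of the wrong size get
  no weight; this trims sums over all sets of sites to \<open>sites_sets\<close>.\<close>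

lemma run_prob_eq_0:
  "finite A \<Longrightarrow> card A \<noteq> card X + length bs \<Longrightarrow> length bs \<le> card A \<Longrightarrow> run_prob n p bs A X = 0"
proof (induction bs arbitrary: A)
  case (Cons b bs)
  have "run_prob n p bs (A - {h}) X = 0" if "h \<in> A" for h
    using Cons.prems that by (intro Cons.IH) auto
  then show ?case by simp
qed auto

lemma sort_key_cong_on:
  assumes "\<And>x. x \<in> set xs \<Longrightarrow> f x = g x"
  shows "sort_key f xs = sort_key g xs"
  using assms
proof (induction xs)
  case (Cons x xs)
  have "insort_key f x ys = insort_key g x ys" if "\<And>y. y \<in> insert x (set ys) \<Longrightarrow> f y = g y" for ys
    using that by (induction ys) auto
  from this[of "sort_key g xs"] have "insort_key f x (sort_key g xs) = insort_key g x (sort_key g xs)"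
    using Cons.prems by simp
  moreover have "sort_key f xs = sort_key g xs" using Cons by simp
  ultimately show ?case by (simp only: sort_key_simps)
qed simp

text \<open>The clocks enter through the launch order alone, which is uniform, and the outcome takes
  finitely many values; the integral is a finite sum over pairs of order and surviving set.\<close>

lemma integral_golf_fixed_configuration:
  fixes \<gamma> :: "nat set \<Rightarrow> real"
  assumes p: "0 \<le> p" "p \<le> 1" and BH: "(B, H) \<in> golf_configs n Nb Nh" and less: "Nb < Nh"
  shows "(\<integral>W. \<gamma> (golf_H1 n ((B, H), W)) \<partial>balls_space n p) =
    (\<Sum>bs\<in>permutations_of_set B. \<Sum>X\<in>sites_sets n (Nh - Nb). run_prob n p bs H X * \<gamma> X) / fact Nb"
proof -
  let ?M = "balls_space n p"
  interpret M: prob_space ?M by (rule prob_space_balls_space)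
  have B: "B \<subseteq> {..<n}" "card B = Nb" and H: "H \<subseteq> {..<n}" "card H = Nh"
    using BH by (auto simp: golf_configs_def)
  have finB: "finite B" and finH: "finite H" using finite_subset[OF B(1)] finite_subset[OF H(1)] by auto
  have n: "n > 0" using H less by (cases n) auto
  define ord where "ord W = sort_key (\<lambda>b. fst (W b)) (sorted_list_of_set B)" for W :: "nat \<Rightarrow> real \<times> bool stream"
  define E where "E bs X = {W \<in> space ?M. ord W = bs \<and> H - golf_run n H W {} bs = X}" for bs X
  define C where "C bs = {c \<in> space (clocks_space n). sort_key c (sorted_list_of_set B) = bs}" for bs
  have ord: "ord W \<in> permutations_of_set B" for W
    using finB by (auto simp: ord_def permutations_of_set_def)
  have ord_clock: "ord W = sort_key (\<lambda>x\<in>{..<n}. fst (W x)) (sorted_list_of_set B)" for W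
    unfolding ord_def using B finB by (intro sort_key_cong_on) auto
  \<comment> \<open>The launch order becomes an event of the clocks, and the walks carry no
    constraint yet, which is the form that \<open>prob_golf_run\<close> takes.\<close>
  have E_eq: "E bs X = {W \<in> space ?M. (\<lambda>x\<in>{..<n}. fst (W x)) \<in> C bs \<and> (\<forall>x\<in>{}. snd (W x) \<in> UNIV) \<and>
      H - golf_run n H W {} bs = X}" for bs X
    using measurable_space[OF measurable_clocks, of _ n p] by (auto simp: E_def C_def ord_clock)
  have prob_E: "measure ?M (E bs X) = run_prob n p bs H X / fact Nb" if bs: "bs \<in> permutations_of_set B" for bs X
  proof -
    have len: "length bs = Nb" "set bs = B" "distinct bs"
      using permutations_of_setD[OF bs] distinct_card[of bs] B by auto
    have "measure ?M (E bs X) = measure (clocks_space n) (C bs) *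
        (\<Prod>x\<in>({}::nat set). measure (coin_space p) UNIV) * run_prob n p bs (H - {}) X"
      unfolding E_eq using len B H less
      by (intro prob_golf_run[where V = "\<lambda>_. UNIV" and J = "{}" and F = "{}" and A = H and C = "C bs" and bs = bs and X = X, OF p n])
        (auto simp: C_def sets_sort_key)
    also have "measure (clocks_space n) (C bs) = 1 / fact Nb"
      using prob_sort_key[OF B(1) bs] B by (simp add: C_def)
    finally show ?thesis by simp
  qed
  have E_sets: "E bs X \<in> sets ?M" for bs X
  proof -
    have "(\<lambda>W. golf_run n H W {} bs) -` {F \<in> Pow {..<n}. H - F = X} \<inter> space ?M \<in> sets ?M"
      by (rule measurable_sets[OF measurable_golf_run[OF n]]) auto
    moreover have "ord -` {bs} \<inter> space ?M \<in> sets ?M"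
      unfolding ord_def by (rule measurable_sets[OF measurable_golf_order]) simp
    moreover have "E bs X = (\<lambda>W. golf_run n H W {} bs) -` {F \<in> Pow {..<n}. H - F = X} \<inter> space ?M \<inter> (ord -` {bs} \<inter> space ?M)"
      using golf_run_subset[OF n, of "{}"] by (auto simp: E_def)
    ultimately show ?thesis by simp
  qed
  have "(\<integral>W. \<gamma> (golf_H1 n ((B, H), W)) \<partial>?M) =
    (\<integral>W. (\<Sum>bs\<in>permutations_of_set B. \<Sum>X\<in>Pow {..<n}. \<gamma> X * indicator (E bs X) W) \<partial>?M)"
  proof (rule Bochner_Integration.integral_cong[OF refl])
    fix W assume W: "W \<in> space ?M"
    let ?X = "H - golf_run n H W {} (ord W)"
    have "(\<Sum>bs\<in>permutations_of_set B. \<Sum>X\<in>Pow {..<n}. \<gamma> X * indicator (E bs X) W) =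
      (\<Sum>bs\<in>permutations_of_set B. if bs = ord W then \<Sum>X\<in>Pow {..<n}. if X = ?X then \<gamma> X else 0 else 0)"
      using W by (intro sum.cong refl) (auto simp: E_def indicator_def intro!: sum.cong)
    also have "\<dots> = \<gamma> ?X"
      using ord[of W] H(1) finB by auto
    finally show "\<gamma> (golf_H1 n ((B, H), W)) = (\<Sum>bs\<in>permutations_of_set B. \<Sum>X\<in>Pow {..<n}. \<gamma> X * indicator (E bs X) W)"
      by (simp add: golf_H1_def golf_filled_def ord_def)
  qed
  also have "\<dots> = (\<Sum>bs\<in>permutations_of_set B. \<Sum>X\<in>Pow {..<n}. \<gamma> X * measure ?M (E bs X))"
  proof -
    have I: "integrable ?M (\<lambda>W. \<gamma> X * indicator (E bs X) W)" for bs X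
      using E_sets by (intro integrable_mult_right integrable_real_indicator) (auto simp: M.emeasure_eq_measure)
    have "(\<integral>W. \<gamma> X * indicator (E bs X) W \<partial>?M) = \<gamma> X * measure ?M (E bs X)" for bs X
      using sets.Int_space_eq2[OF E_sets] by (subst integral_mult_right_zero) simp
    then show ?thesis
      by (subst Bochner_Integration.integral_sum, intro Bochner_Integration.integrable_sum I)
         (intro sum.cong refl, subst Bochner_Integration.integral_sum, intro I, simp only:)
  qed
  also have "\<dots> = (\<Sum>bs\<in>permutations_of_set B. \<Sum>X\<in>Pow {..<n}. run_prob n p bs H X * \<gamma> X / fact Nb)"
    by (intro sum.cong refl) (simp add: prob_E)
  also have "\<dots> = (\<Sum>bs\<in>permutations_of_set B. \<Sum>X\<in>sites_sets n (Nh - Nb). run_prob n p bs H X * \<gamma> X / fact Nb)"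
  proof (rule sum.cong[OF refl])
    fix bs assume bs: "bs \<in> permutations_of_set B"
    have "length bs = Nb" using permutations_of_setD[OF bs] distinct_card[of bs] B by auto
    then have "run_prob n p bs H X = 0" if "X \<in> Pow {..<n} - sites_sets n (Nh - Nb)" for X
      using that H less finH by (intro run_prob_eq_0) auto
    then show "(\<Sum>X\<in>Pow {..<n}. run_prob n p bs H X * \<gamma> X / fact Nb) =
        (\<Sum>X\<in>sites_sets n (Nh - Nb). run_prob n p bs H X * \<gamma> X / fact Nb)"
      by (intro sum.mono_neutral_right) auto
  qed
  finally show ?thesis by (simp add: sum_divide_distrib)
qed

lemma finite_golf_configs: "finite (golf_configs n Nb Nh)"
  by (rule finite_subset[of _ "Pow {..<n} \<times> Pow {..<n}"]) (auto simp: golf_configs_def)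

lemma card_golf_configs: "card (golf_configs n Nb Nh) = (n choose Nh) * ((n - Nh) choose Nb)"
proof -
  have "golf_configs n Nb Nh = (\<lambda>(H, B). (B, H)) ` (SIGMA H:sites_sets n Nh. {B. B \<subseteq> {..<n} - H \<and> card B = Nb})"
    by (auto simp: golf_configs_def image_iff)
  then have "card (golf_configs n Nb Nh) = card (SIGMA H:sites_sets n Nh. {B. B \<subseteq> {..<n} - H \<and> card B = Nb})"
    by (simp add: card_image inj_on_def split_beta prod_eq_iff)
  also have "\<dots> = (\<Sum>H\<in>sites_sets n Nh. card {B. B \<subseteq> {..<n} - H \<and> card B = Nb})"
    by (intro card_SigmaI finite_sites_sets) auto
  also have "\<dots> = (\<Sum>H\<in>sites_sets n Nh. (n - Nh) choose Nb)"
    by (intro sum.cong refl) (auto simp: n_subsets card_Diff_subset finite_subset)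
  finally show ?thesis by (simp add: card_sites_sets)
qed

lemma integral_golf_space:
  fixes \<gamma> :: "nat set \<Rightarrow> real"
  assumes p: "0 \<le> p" "p \<le> 1" and less: "Nb < Nh" and n: "Nb + Nh \<le> n" and bdd: "bounded (range \<gamma>)"
  shows "(\<integral>\<omega>. \<gamma> (golf_H1 n \<omega>) \<partial>golf_space n Nb Nh p) =
    (\<Sum>(B, H)\<in>golf_configs n Nb Nh. \<Sum>bs\<in>permutations_of_set B. \<Sum>X\<in>sites_sets n (Nh - Nb).
       run_prob n p bs H X * \<gamma> X) / (fact Nb * real (card (golf_configs n Nb Nh)))"
proof -
  let ?M = "balls_space n p" and ?q = "golf_config n Nb Nh"
  interpret M: prob_space ?M by (rule prob_space_balls_space)
  interpret Q: prob_space "measure_pmf ?q" by (rule measure_pmf.prob_space_axioms)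
  interpret QM: pair_prob_space "measure_pmf ?q" ?M ..
  have "card (golf_configs n Nb Nh) > 0"
    using n by (simp add: card_golf_configs)
  then have ne: "golf_configs n Nb Nh \<noteq> {}" by auto
  obtain K where K: "\<And>X. norm (\<gamma> X) \<le> K" using bdd by (auto simp: bounded_iff)
  have int: "integrable (measure_pmf ?q \<Otimes>\<^sub>M ?M) (\<lambda>\<omega>. \<gamma> (golf_H1 n \<omega>))"
    using less n K by (intro QM.P.integrable_const_bound[where B = K] measurable_golf_H1) auto
  have "(\<integral>\<omega>. \<gamma> (golf_H1 n \<omega>) \<partial>golf_space n Nb Nh p) =
      (\<integral>c. (\<integral>W. \<gamma> (golf_H1 n (c, W)) \<partial>?M) \<partial>measure_pmf ?q)"
    unfolding golf_space_def by (rule QM.integral_fst'[OF int, symmetric])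
  also have "\<dots> = (\<Sum>c\<in>golf_configs n Nb Nh. \<integral>W. \<gamma> (golf_H1 n (c, W)) \<partial>?M) / card (golf_configs n Nb Nh)"
    unfolding golf_config_def by (rule integral_pmf_of_set[OF ne finite_golf_configs])
  also have "(\<Sum>c\<in>golf_configs n Nb Nh. \<integral>W. \<gamma> (golf_H1 n (c, W)) \<partial>?M) =
    (\<Sum>(B, H)\<in>golf_configs n Nb Nh. (\<Sum>bs\<in>permutations_of_set B. \<Sum>X\<in>sites_sets n (Nh - Nb). run_prob n p bs H X * \<gamma> X) / fact Nb)"
    by (intro sum.cong refl) (auto simp: integral_golf_fixed_configuration[OF p _ less])
  finally show ?thesis by (simp add: split_beta sum_divide_distrib[symmetric])
qed

text \<open>The configurations with distinct ball sites off the holes are all but a vanishing fraction of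
  the unrestricted ones, for which the hole set is a Markov chain.\<close>

lemma golf_space_chain_difference:
  fixes \<gamma> :: "nat set \<Rightarrow> real"
  assumes p: "0 \<le> p" "p \<le> 1" and less: "Nb < Nh" and n: "Nb + Nh \<le> n" and K: "\<And>X. \<bar>\<gamma> X\<bar> \<le> K"
  shows "\<bar>(\<integral>\<omega>. \<gamma> (golf_H1 n \<omega>) \<partial>golf_space n Nb Nh p) * (fact Nb * real (card (golf_configs n Nb Nh)))
     - (\<Sum>X\<in>sites_sets n (Nh - Nb). (chain_step n p ^^ Nb) (\<lambda>_. 1) X * \<gamma> X)\<bar>
   \<le> K * (real (n ^ Nb * (n choose Nh)) - fact Nb * real (card (golf_configs n Nb Nh)))"
proof -
  define \<psi> where "\<psi> = (\<lambda>(bs, H). \<Sum>X\<in>sites_sets n (Nh - Nb). run_prob n p bs H X * \<gamma> X)"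
  define All where "All = sites_lists n Nb \<times> sites_sets n Nh"
  \<comment> \<open>A ball set with a launch order amounts to a list of distinct sites; the ball set
    is recovered as the set of entries, so nothing is counted twice.\<close>
  define Good where "Good = (\<lambda>((B, H), bs). (bs, H)) ` (SIGMA c:golf_configs n Nb Nh. permutations_of_set (fst c))"
  have len: "length bs = card B \<and> set bs = B" if "bs \<in> permutations_of_set B" for bs B
    using permutations_of_setD[OF that] distinct_card[of bs] by auto
  have finB: "finite (fst c)" if "c \<in> golf_configs n Nb Nh" for c
    using that finite_subset[OF _ finite_lessThan[of n]] by (auto simp: golf_configs_def)
  have inj: "inj_on (\<lambda>((B, H), bs). (bs, H)) (SIGMA c:golf_configs n Nb Nh. permutations_of_set (fst c))"
    by (auto simp: inj_on_def permutations_of_set_def)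
  have fin: "finite All" by (simp add: All_def finite_sites_lists finite_sites_sets)
  have sub: "Good \<subseteq> All"
  proof
    fix z assume "z \<in> Good"
    then obtain B H bs where z: "z = (bs, H)" "(B, H) \<in> golf_configs n Nb Nh" "bs \<in> permutations_of_set B"
      by (auto simp: Good_def)
    then show "z \<in> All" using len[OF z(3)] by (auto simp: All_def golf_configs_def)
  qed
  have cardGood: "card Good = fact Nb * card (golf_configs n Nb Nh)"
  proof -
    have "card Good = (\<Sum>c\<in>golf_configs n Nb Nh. card (permutations_of_set (fst c)))"
      unfolding Good_def card_image[OF inj] by (intro card_SigmaI finite_golf_configs) auto
    also have "\<dots> = (\<Sum>c\<in>golf_configs n Nb Nh. fact Nb)"
    proof (rule sum.cong[OF refl])
      fix c assume c: "c \<in> golf_configs n Nb Nh"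
      then have "card (fst c) = Nb" by (auto simp: golf_configs_def)
      then show "card (permutations_of_set (fst c)) = fact Nb" using finB[OF c] by simp
    qed
    finally show ?thesis by simp
  qed
  have cardAll: "card All = n ^ Nb * (n choose Nh)"
    by (simp add: All_def card_cartesian_product card_sites_lists card_sites_sets)
  have sumGood: "(\<Sum>x\<in>Good. \<psi> x) =
      (\<integral>\<omega>. \<gamma> (golf_H1 n \<omega>) \<partial>golf_space n Nb Nh p) * (fact Nb * real (card (golf_configs n Nb Nh)))"
  proof -
    have "bounded (range \<gamma>)" using K by (auto simp: bounded_iff)
    note int = integral_golf_space[OF p less n this]
    have "card (golf_configs n Nb Nh) > 0" using n by (simp add: card_golf_configs)
    have "(\<Sum>x\<in>Good. \<psi> x) = (\<Sum>(c, bs)\<in>(SIGMA c:golf_configs n Nb Nh. permutations_of_set (fst c)). \<psi> (bs, snd c))"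
      unfolding Good_def sum.reindex[OF inj] by (intro sum.cong refl) auto
    also have "\<dots> = (\<Sum>c\<in>golf_configs n Nb Nh. \<Sum>bs\<in>permutations_of_set (fst c). \<psi> (bs, snd c))"
      by (rule sum.Sigma[symmetric]) (auto simp: finite_golf_configs)
    finally show ?thesis
      using \<open>card (golf_configs n Nb Nh) > 0\<close> unfolding int \<psi>_def by (simp add: split_beta)
  qed
  have sumAll: "(\<Sum>x\<in>All. \<psi> x) = (\<Sum>X\<in>sites_sets n (Nh - Nb). (chain_step n p ^^ Nb) (\<lambda>_. 1) X * \<gamma> X)"
  proof -
    have "(\<Sum>x\<in>All. \<psi> x) = (\<Sum>bs\<in>sites_lists n Nb. \<Sum>H\<in>sites_sets n Nh. \<Sum>X\<in>sites_sets n (Nh - Nb). run_prob n p bs H X * \<gamma> X)"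
      unfolding All_def \<psi>_def by (rule sum.cartesian_product[symmetric])
    also have "\<dots> = (\<Sum>bs\<in>sites_lists n Nb. \<Sum>X\<in>sites_sets n (Nh - Nb). \<Sum>H\<in>sites_sets n Nh. run_prob n p bs H X * \<gamma> X)"
      by (rule sum.cong[OF refl], rule sum.swap)
    also have "\<dots> = (\<Sum>X\<in>sites_sets n (Nh - Nb). \<Sum>bs\<in>sites_lists n Nb. \<Sum>H\<in>sites_sets n Nh. run_prob n p bs H X * \<gamma> X)"
      by (rule sum.swap)
    also have "\<dots> = (\<Sum>X\<in>sites_sets n (Nh - Nb). (\<Sum>bs\<in>sites_lists n Nb. \<Sum>H\<in>sites_sets n (Nh - Nb + Nb). 1 * run_prob n p bs H X) * \<gamma> X)"
      using less by (simp add: sum_distrib_right)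
    also have "\<dots> = (\<Sum>X\<in>sites_sets n (Nh - Nb). (chain_step n p ^^ Nb) (\<lambda>_. 1) X * \<gamma> X)"
      by (intro sum.cong refl arg_cong2[of _ _ _ _ "(*)"] sum_run_prob_chain)
    finally show ?thesis .
  qed
  \<comment> \<open>The run probabilities sum to one over the outcomes, so \<open>\<psi>\<close> is
    an average of values of \<open>\<gamma>\<close>.\<close>
  have bound: "\<bar>\<psi> x\<bar> \<le> K" if xA: "x \<in> All" for x
  proof -
    obtain bs H where x: "x = (bs, H)" "set bs \<subseteq> {..<n}" "length bs = Nb" "H \<subseteq> {..<n}" "card H = Nh"
      using xA unfolding All_def by blast
    have "\<bar>\<psi> x\<bar> \<le> (\<Sum>X\<in>sites_sets n (Nh - Nb). \<bar>run_prob n p bs H X * \<gamma> X\<bar>)"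
      unfolding \<psi>_def x by (simp add: sum_abs)
    also have "\<dots> \<le> (\<Sum>X\<in>sites_sets n (Nh - Nb). run_prob n p bs H X * K)"
      using K by (intro sum_mono) (auto simp: abs_mult run_prob_nonneg intro!: mult_left_mono)
    also have "\<dots> = K"
      using x less by (simp add: sum_distrib_right[symmetric] sum_run_prob[OF p])
    finally show ?thesis .
  qed
  have "(\<Sum>x\<in>All. \<psi> x) - (\<Sum>x\<in>Good. \<psi> x) = (\<Sum>x\<in>All - Good. \<psi> x)"
    using sum.subset_diff[OF sub fin, of \<psi>] by simp
  then have "\<bar>(\<Sum>x\<in>Good. \<psi> x) - (\<Sum>x\<in>All. \<psi> x)\<bar> = \<bar>\<Sum>x\<in>All - Good. \<psi> x\<bar>" by linarith
  also have "\<dots> \<le> (\<Sum>x\<in>All - Good. K)"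
    using bound by (intro order_trans[OF sum_abs] sum_mono) auto
  also have "\<dots> = K * (real (card All) - real (card Good))"
    using sub fin by (simp add: card_Diff_subset finite_subset card_mono of_nat_diff mult.commute)
  finally show ?thesis unfolding sumGood sumAll cardAll cardGood by simp
qed

section \<open>Hole sets and gap vectors\<close>

text \<open>The least hole is \<open>t\<close>, and \<open>hole_pos e t j\<close> is
  \<open>x_(j+1)\<close> in the listing of the holes. Gap 0 runs from the last hole across the end
  of the site range to \<open>t\<close>, which is why the sum starts with gap 1.\<close>

definition hole_pos :: "(nat \<Rightarrow> nat) \<Rightarrow> nat \<Rightarrow> nat \<Rightarrow> nat" where
  "hole_pos e t j = t + (\<Sum>i<j. e (Suc i) + 1)"

definition hole_set :: "nat \<Rightarrow> (nat \<Rightarrow> nat) \<Rightarrow> nat \<Rightarrow> nat set" where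
  "hole_set L e t = hole_pos e t ` {..<L}"

lemma hole_pos_0 [simp]: "hole_pos e t 0 = t"
  by (simp add: hole_pos_def)

lemma hole_pos_Suc: "hole_pos e t (Suc j) = hole_pos e t j + e (Suc j) + 1"
  by (simp add: hole_pos_def)

lemma strict_mono_hole_pos: "strict_mono (hole_pos e t)"
  by (simp add: strict_mono_Suc_iff hole_pos_Suc)

lemma sum_add_1: "(\<Sum>i<l. f i + 1) = (\<Sum>i<l. f i) + (l::nat)"
  by (induction l) auto

context
  fixes L n :: nat and e :: "nat \<Rightarrow> nat" and t :: nat
  assumes L: "L > 0" and n: "(\<Sum>i<L. e i) + L = n" and t: "t \<le> e 0"
begin

text \<open>The wrapping gap closes the cycle. Together with \<open>t \<le> e 0\<close> this puts
  the last hole below \<open>n\<close>.\<close>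

lemma hole_pos_last: "hole_pos e t (L - 1) + e 0 + 1 = t + n"
proof -
  obtain l where l: "L = Suc l" using L by (cases L) auto
  have "(\<Sum>i<l. e (Suc i) + 1) + e 0 + 1 = n"
    using n unfolding sum_add_1 l sum.lessThan_Suc_shift by simp
  then show ?thesis by (simp add: hole_pos_def l)
qed

lemma hole_pos_less: "j < L \<Longrightarrow> hole_pos e t j < n"
proof -
  assume "j < L"
  then have "hole_pos e t j \<le> hole_pos e t (L - 1)"
    using strict_mono_hole_pos[of e t] by (simp add: strict_mono_less_eq)
  then show ?thesis using hole_pos_last t by simp
qed

lemma sorted_hole_set: "sorted_list_of_set (hole_set L e t) = map (hole_pos e t) [0..<L]"
proof -
  have "sorted_wrt (<) (map (hole_pos e t) [0..<L])"
    using strict_mono_hole_pos[of e t] by (simp add: sorted_wrt_iff_nth_less strict_mono_less)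
  moreover have "set (map (hole_pos e t) [0..<L]) = hole_set L e t"
    by (simp add: hole_set_def lessThan_atLeast0)
  ultimately show ?thesis
    by (metis strict_sorted_iff sorted_list_of_set.idem_if_sorted_distinct)
qed

lemma card_hole_set: "card (hole_set L e t) = L"
  unfolding hole_set_def
  by (subst card_image) (auto intro: inj_on_subset[OF strict_mono_imp_inj_on[OF strict_mono_hole_pos]])

lemma hole_set_sites: "hole_set L e t \<in> sites_sets n L"
  using card_hole_set hole_pos_less by (auto simp: hole_set_def)

lemma gap_hole_set:
  assumes i: "i < L"
  shows "gap n (hole_set L e t) i = e i"
proof -
  have succ_idx: "((i + 1) mod L + L - 1) mod L = i"
  proof (cases "i + 1 < L")
    case False
    then have "i + 1 = L" using i by simp
    then show ?thesis by simp
  qed simp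
  have next_elt: "list_elt (hole_set L e t) ((i + 1) mod L) = hole_pos e t i"
    unfolding list_elt_def sorted_hole_set card_hole_set succ_idx using i by simp
  have e0: "e 0 < n" using hole_pos_last L hole_pos_less[of 0] t n sum_mono2[of "{..<L}" "{0}" e] by auto
  show ?thesis
  proof (cases i)
    case 0
    have prev: "list_elt (hole_set L e t) (i mod L) = hole_pos e t (L - 1)"
      unfolding list_elt_def sorted_hole_set card_hole_set using L by (simp add: 0)
    \<comment> \<open>For gap 0 the plain difference is negative; reduction modulo \<open>n\<close>
      restores one full turn.\<close>
    have "int t - int (hole_pos e t (L - 1)) - 1 = int (e 0) - int n"
      using hole_pos_last by linarith
    then have "(int t - int (hole_pos e t (L - 1)) - 1) mod int n = int (e 0) mod int n"
      by (simp only: minus_mod_self2)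
    then show ?thesis
      using e0 unfolding gap_def card_hole_set next_elt prev by (simp add: 0)
  next
    case (Suc j)
    have "(Suc j + L - 1) mod L = j" using i Suc by simp
    then have prev: "list_elt (hole_set L e t) (i mod L) = hole_pos e t j"
      unfolding list_elt_def sorted_hole_set card_hole_set using i by (simp add: Suc)
    have "int (hole_pos e t i) - int (hole_pos e t j) - 1 = int (e i)"
      by (simp add: Suc hole_pos_Suc)
    moreover have "e i < n" using n i sum_mono2[of "{..<L}" "{i}" e] L by auto
    ultimately show ?thesis
      unfolding gap_def card_hole_set next_elt prev by simp
  qed
qed

text \<open>Gap 0 precedes the first hole, so hole \<open>j\<close> is followed by gap
  \<open>Suc j\<close>, and the last hole by gap 0. The added 1 counts the hole that ends the
  arc.\<close>

lemma cyc_gap_hole_set: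
  assumes j: "j < L"
  shows "cyc_gap n (hole_set L e t) (hole_pos e t j) = (if j = L - 1 then e 0 else e (Suc j)) + 1"
proof (cases "j = L - 1")
  case True
  have "t < n" using hole_pos_less[OF L] by simp
  show ?thesis unfolding True if_P[OF refl]
  proof (rule cyc_gap_eqI)
    have "hole_pos e t (L - 1) + (e 0 + 1) = t + n" using hole_pos_last by simp
    then show "(hole_pos e t (L - 1) + (e 0 + 1)) mod n \<in> hole_set L e t"
      using \<open>t < n\<close> L by (simp add: hole_set_def image_iff) (metis hole_pos_0 lessThan_iff)
    fix s assume s: "0 < s" "s < e 0 + 1"
    have notin: "hole_pos e t j' \<noteq> (hole_pos e t (L - 1) + s) mod n" if "j' < L" for j'
    proof -
      have up: "hole_pos e t j' \<le> hole_pos e t (L - 1)" "t \<le> hole_pos e t j'"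
        using that strict_mono_less_eq[OF strict_mono_hole_pos, of e t j' "L - 1"]
          by (auto simp: hole_pos_def)
      show ?thesis
      proof (cases "hole_pos e t (L - 1) + s < n")
        case True
        then show ?thesis using up s by simp
      next
        case False
        then have "(hole_pos e t (L - 1) + s) mod n = hole_pos e t (L - 1) + s - n"
          using s hole_pos_last \<open>t < n\<close> by (simp add: mod_if)
        then show ?thesis using up s hole_pos_last False by linarith
      qed
    qed
    then show "(hole_pos e t (L - 1) + s) mod n \<notin> hole_set L e t"
      unfolding hole_set_def by (metis imageE lessThan_iff)
  qed simp
next
  case False
  then have j': "Suc j < L" using j by simp
  show ?thesis unfolding if_not_P[OF False]
  proof (rule cyc_gap_eqI)
    have "hole_pos e t j + (e (Suc j) + 1) = hole_pos e t (Suc j)" by (simp add: hole_pos_Suc)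
    then show "(hole_pos e t j + (e (Suc j) + 1)) mod n \<in> hole_set L e t"
      using hole_pos_less[OF j'] j' by (simp add: hole_set_def)
    fix s assume s: "0 < s" "s < e (Suc j) + 1"
    then have b: "hole_pos e t j < hole_pos e t j + s" "hole_pos e t j + s < hole_pos e t (Suc j)"
      by (simp_all add: hole_pos_Suc)
    have "hole_pos e t j'' \<noteq> hole_pos e t j + s" for j''
    proof
      assume eq: "hole_pos e t j'' = hole_pos e t j + s"
      then have "j < j''" "j'' < Suc j"
        using b strict_mono_less[OF strict_mono_hole_pos, of e t] by metis+
      then show False by simp
    qed
    moreover have "(hole_pos e t j + s) mod n = hole_pos e t j + s"
      using b hole_pos_less[OF j'] by simp
    ultimately show "(hole_pos e t j + s) mod n \<notin> hole_set L e t"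
      unfolding hole_set_def by (metis imageE)
  qed simp
qed

lemma prod_cyc_gap_hole_set:
  fixes f :: "nat \<Rightarrow> 'a::comm_monoid_mult"
  shows "(\<Prod>x\<in>hole_set L e t. f (cyc_gap n (hole_set L e t) x)) = (\<Prod>i<L. f (e i + 1))"
proof -
  obtain l where l: "L = Suc l" using L by (cases L) auto
  have "(\<Prod>x\<in>hole_set L e t. f (cyc_gap n (hole_set L e t) x)) =
      (\<Prod>j<L. f (cyc_gap n (hole_set L e t) (hole_pos e t j)))"
    unfolding hole_set_def
    by (subst prod.reindex) (auto intro: inj_on_subset[OF strict_mono_imp_inj_on[OF strict_mono_hole_pos]])
  also have "\<dots> = (\<Prod>j<L. f ((if j = L - 1 then e 0 else e (Suc j)) + 1))"
    by (intro prod.cong refl) (simp add: cyc_gap_hole_set)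
  also have "\<dots> = (\<Prod>j<l. f (e (Suc j) + 1)) * f (e 0 + 1)"
    by (simp add: l)
  also have "\<dots> = (\<Prod>i<L. f (e i + 1))"
    unfolding l prod.lessThan_Suc_shift by (simp add: mult.commute)
  finally show ?thesis .
qed

end

lemma hole_set_surj:
  assumes L: "L > 0" and X: "X \<in> sites_sets n L"
  obtains e t where "(\<Sum>i<L. e i) + L = n" "t \<le> e 0" "X = hole_set L e t"
proof -
  define xs where "xs = sorted_list_of_set X"
  have fin: "finite X" using X finite_subset by auto
  have xs: "length xs = L" "set xs = X" "sorted_wrt (<) xs"
    using fin X by (auto simp: xs_def)
  have less: "xs ! i < n" if "i < L" for i using that xs X nth_mem[of i xs] by auto
  have strict: "xs ! i < xs ! j" if "i < j" "j < L" for i j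
    using that xs by (simp add: sorted_wrt_iff_nth_less)
  obtain l where l: "L = Suc l" using L by (cases L) auto
  \<comment> \<open>Entry 0 joins the stretch after the last hole to the one before the first; the
    truncated subtractions are exact because \<open>xs\<close> increases strictly and stays below
    \<open>n\<close>.\<close>
  define e where "e i = (if i = 0 then n - 1 - xs ! l + xs ! 0 else xs ! i - xs ! (i - 1) - 1)" for i
  have pos: "hole_pos e (xs ! 0) j = xs ! j" if "j < L" for j
    using that
  proof (induction j)
    case (Suc j)
    then show ?case using strict[of j "Suc j"] by (simp add: hole_pos_Suc e_def)
  qed simp
  have "X = hole_set L e (xs ! 0)"
  proof -
    have "X = (\<lambda>j. xs ! j) ` {..<L}" using xs by (auto simp: in_set_conv_nth image_iff)
    then show ?thesis using pos by (simp add: hole_set_def)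
  qed
  moreover have "xs ! 0 \<le> e 0" by (simp add: e_def)
  moreover have "(\<Sum>i<L. e i) + L = n"
  proof -
    have "(\<Sum>i<l. e (Suc i) + 1) + xs ! 0 = xs ! l" using pos[of l] by (simp add: hole_pos_def l)
    moreover have "e 0 + xs ! l + 1 = n + xs ! 0" using less[of l] by (simp add: e_def l)
    moreover have "(\<Sum>i<L. e i) + L = e 0 + 1 + (\<Sum>i<l. e (Suc i) + 1)"
      unfolding sum_add_1 l sum.lessThan_Suc_shift by simp
    ultimately show ?thesis by linarith
  qed
  ultimately show ?thesis using that by blast
qed

text \<open>To be read with \<open>k = L - 1\<close> free gaps and \<open>m = n - L\<close> sites
  off the surviving holes. Extensional functions make the box finite and match the coordinates of
  the product Lebesgue measure.\<close>

definition gap_box :: "nat \<Rightarrow> nat \<Rightarrow> (nat \<Rightarrow> nat) set" where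
  "gap_box k m = {d \<in> {..<k} \<rightarrow>\<^sub>E UNIV. (\<Sum>i<k. d i) \<le> m}"

text \<open>Discrete counterpart of \<open>simplex_point\<close>; the truncated subtraction is exact
  inside \<open>gap_box\<close>.\<close>

definition gap_complete :: "nat \<Rightarrow> nat \<Rightarrow> (nat \<Rightarrow> nat) \<Rightarrow> nat \<Rightarrow> nat" where
  "gap_complete k m d i = (if i < k then d i else if i = k then m - (\<Sum>j<k. d j) else 0)"

lemma finite_gap_box: "finite (gap_box k m)"
proof (rule finite_subset)
  have "d i \<le> m" if "d \<in> gap_box k m" "i < k" for d i
    using that sum_mono2[of "{..<k}" "{i}" d] by (auto simp: gap_box_def)
  then show "gap_box k m \<subseteq> {..<k} \<rightarrow>\<^sub>E {..m}"
    unfolding subset_eq by (simp add: gap_box_def PiE_iff)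
qed (simp add: finite_PiE)

lemma sum_gap_complete: "d \<in> gap_box k m \<Longrightarrow> (\<Sum>i<Suc k. gap_complete k m d i) = m"
  by (simp add: gap_complete_def gap_box_def)

text \<open>The starting point \<open>t\<close> is the only freedom left by the gaps. Its range
  refers to the completed vector, since for \<open>k = 0\<close> the first gap is also the
  last.\<close>

lemma bij_betw_hole_set:
  "bij_betw (\<lambda>(d, t). hole_set (Suc k) (gap_complete k m d) t)
     (SIGMA d:gap_box k m. {..gap_complete k m d 0}) (sites_sets (m + Suc k) (Suc k))"
proof (rule bij_betw_imageI)
  let ?e = "gap_complete k m" and ?n = "m + Suc k"
  have e: "(\<Sum>i<Suc k. ?e d i) + Suc k = ?n" if "d \<in> gap_box k m" for d
    using sum_gap_complete[OF that] by simp
  show "inj_on (\<lambda>(d, t). hole_set (Suc k) (?e d) t) (SIGMA d:gap_box k m. {..?e d 0})"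
  proof (rule inj_onI)
    fix x y
    assume x: "x \<in> (SIGMA d:gap_box k m. {..?e d 0})" and y: "y \<in> (SIGMA d:gap_box k m. {..?e d 0})"
      and xy: "(case x of (d, t) \<Rightarrow> hole_set (Suc k) (?e d) t) = (case y of (d, t) \<Rightarrow> hole_set (Suc k) (?e d) t)"
    obtain d t where x_eq: "x = (d, t)" by (cases x)
    obtain d' t' where y_eq: "y = (d', t')" by (cases y)
    have d: "d \<in> gap_box k m" "t \<in> {..?e d 0}" "d' \<in> gap_box k m" "t' \<in> {..?e d' 0}"
      and eq: "hole_set (Suc k) (?e d) t = hole_set (Suc k) (?e d') t'"
      using x y xy unfolding x_eq y_eq by auto
    have tt: "t \<le> ?e d 0" "t' \<le> ?e d' 0" using d by auto
    have "?e d i = ?e d' i" if "i < Suc k" for i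
      using gap_hole_set[OF _ e[OF d(1)] tt(1) that] gap_hole_set[OF _ e[OF d(3)] tt(2) that] eq by simp
    then have "d i = d' i" if "i < k" for i
      using that less_SucI[OF that] \<open>\<And>i. i < Suc k \<Longrightarrow> ?e d i = ?e d' i\<close>[of i] by (simp add: gap_complete_def)
    note agree = this
    have "d \<in> {..<k} \<rightarrow>\<^sub>E UNIV" "d' \<in> {..<k} \<rightarrow>\<^sub>E UNIV" using d by (auto simp: gap_box_def)
    from PiE_ext[OF this] agree have "d = d'" by simp
    moreover have "map (hole_pos (?e d) t) [0..<Suc k] = map (hole_pos (?e d') t') [0..<Suc k]"
      using sorted_hole_set[OF _ e[OF d(1)] tt(1)] sorted_hole_set[OF _ e[OF d(3)] tt(2)] eq by simp
    then have "t = t'" by (metis hole_pos_0 map_eq_conv atLeastLessThan_iff set_upt zero_less_Suc le0)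
    ultimately show "x = y" unfolding x_eq y_eq by simp
  qed
  show "(\<lambda>(d, t). hole_set (Suc k) (?e d) t) ` (SIGMA d:gap_box k m. {..?e d 0}) = sites_sets ?n (Suc k)"
  proof (intro equalityI subsetI)
    fix X assume "X \<in> (\<lambda>(d, t). hole_set (Suc k) (?e d) t) ` (SIGMA d:gap_box k m. {..?e d 0})"
    then obtain d t where "d \<in> gap_box k m" "t \<le> ?e d 0" "X = hole_set (Suc k) (?e d) t" by auto
    then show "X \<in> sites_sets ?n (Suc k)" using hole_set_sites[OF _ e] by blast
  next
    fix X assume X: "X \<in> sites_sets ?n (Suc k)"
    obtain e t where et: "(\<Sum>i<Suc k. e i) + Suc k = ?n" "t \<le> e 0" "X = hole_set (Suc k) e t"
      using hole_set_surj[OF _ X] by blast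
    define d where "d = restrict e {..<k}"
    have sum: "(\<Sum>i<k. d i) + e k = m" using et(1) by (simp add: d_def)
    then have d: "d \<in> gap_box k m" by (auto simp: gap_box_def d_def)
    have agree: "?e d i = e i" if "i < Suc k" for i
      using that sum by (auto simp: gap_complete_def d_def less_Suc_eq)
    have "hole_pos (?e d) t j = hole_pos e t j" if "j < Suc k" for j
      unfolding hole_pos_def using that agree by (intro arg_cong2[of _ _ _ _ "(+)"] sum.cong refl) auto
    then have "hole_set (Suc k) (?e d) t = X" unfolding et(3) hole_set_def by (intro image_cong) auto
    moreover have "t \<le> ?e d 0" using et(2) agree[of 0] by simp
    ultimately show "X \<in> (\<lambda>(d, t). hole_set (Suc k) (?e d) t) ` (SIGMA d:gap_box k m. {..?e d 0})"
      using d by (auto simp: image_iff)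
  qed
qed

text \<open>Passes from lists of exponents to extensional functions, the index set of the sum in
  \<open>golf_density\<close>.\<close>

lemma fps_nth_prod_lessThan:
  fixes f :: "nat \<Rightarrow> real fps"
  assumes "L > 0"
  shows "fps_nth (\<Prod>i<L. f i) N =
    (\<Sum>b\<in>{b. b \<in> {..<L} \<rightarrow>\<^sub>E {..N} \<and> sum b {..<L} = N}. \<Prod>i<L. fps_nth (f i) (b i))"
proof -
  obtain l where l: "L = Suc l" using assms by (cases L) auto
  have I: "{0..l} = {..<L}" by (auto simp: l)
  have "fps_nth (\<Prod>i<L. f i) N = (\<Sum>v\<in>natpermute N L. \<Prod>i<L. fps_nth (f i) (v ! i))"
    using fps_prod_nth[of f l N] unfolding I by (simp only: l Suc_eq_plus1)
  also have "\<dots> = (\<Sum>b\<in>{b. b \<in> {..<L} \<rightarrow>\<^sub>E {..N} \<and> sum b {..<L} = N}. \<Prod>i<L. fps_nth (f i) (b i))"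
  proof (rule sum.reindex_bij_witness[of _ "\<lambda>b. map b [0..<L]" "\<lambda>v. \<lambda>i\<in>{..<L}. v ! i"])
    fix v assume v: "v \<in> natpermute N L"
    then have v': "length v = L" "sum_list v = N" by (auto simp: natpermute_def)
    then show "map (\<lambda>i\<in>{..<L}. v ! i) [0..<L] = v" by (simp add: list_eq_iff_nth_eq)
    have "v ! i \<le> N" if "i < L" for i using that v' member_le_sum_list[of "v ! i" v] by auto
    then show "(\<lambda>i\<in>{..<L}. v ! i) \<in> {b. b \<in> {..<L} \<rightarrow>\<^sub>E {..N} \<and> sum b {..<L} = N}"
      using v' by (auto simp: sum_list_sum_nth lessThan_atLeast0)
  next
    fix b assume b: "b \<in> {b. b \<in> {..<L} \<rightarrow>\<^sub>E {..N} \<and> sum b {..<L} = N}"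
    then show "(\<lambda>i\<in>{..<L}. map b [0..<L] ! i) = b"
      by (auto simp: PiE_iff extensional_def restrict_def fun_eq_iff)
    show "map b [0..<L] \<in> natpermute N L"
      using b by (simp add: natpermute_def sum_list_sum_nth lessThan_atLeast0)
  qed auto
  finally show ?thesis .
qed

section \<open>Asymptotics\<close>

lemma real_binomial_prod: "real (n choose k) = (\<Prod>i<k. real n - real i) / fact k"
  by (simp add: binomial_gbinomial gbinomial_prod_rev lessThan_atLeast0)

text \<open>A polynomial of degree \<open>2 * b\<close> in \<open>l\<close> with leading coefficient
  \<open>1 / (fact b * fact (Suc b))\<close>, in a form where each factor can be rescaled
  separately.\<close>

lemma arc_coeff_prod:
  assumes "l > 0"
  shows "arc_coeff b l = real l ^ b * (\<Prod>i<b. real l - real (Suc i)) / (fact b * fact (Suc b))"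
proof -
  have "real l * fact b * arc_coeff b l = real l ^ b * (real l * (\<Prod>i<b. real l - real (Suc i)) / fact (Suc b))"
    unfolding arc_coeff_eq[OF assms] real_binomial_prod prod.lessThan_Suc_shift by simp
  moreover have "c * f * A = x * (c * z / s) \<Longrightarrow> c \<noteq> 0 \<Longrightarrow> f \<noteq> 0 \<Longrightarrow> s \<noteq> 0 \<Longrightarrow> A = x * z / (f * s)"
    for A x z c f s :: real by (simp add: field_simps)
  ultimately have "real l \<noteq> 0 \<Longrightarrow> (fact b :: real) \<noteq> 0 \<Longrightarrow> (fact (Suc b) :: real) \<noteq> 0 \<Longrightarrow>
      arc_coeff b l = real l ^ b * (\<Prod>i<b. real l - real (Suc i)) / (fact b * fact (Suc b))" by blast
  then show ?thesis using assms by (simp only: fact_nonzero of_nat_eq_0_iff) simp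
qed

text \<open>For domination: an arc has length at most \<open>n\<close>, so a coefficient divided by
  \<open>n ^ (2 * b)\<close> lies between 0 and 1.\<close>

lemma arc_coeff_bounds:
  assumes "l > 0"
  shows "0 \<le> arc_coeff b l" "arc_coeff b l \<le> real l ^ (2 * b)"
proof -
  have eq: "arc_coeff b l = real l ^ b * real (l choose Suc b) / (real l * fact b)"
    using arc_coeff_eq[OF assms, of b] assms by (simp add: field_simps)
  show "0 \<le> arc_coeff b l" unfolding eq by simp
  have "l choose Suc b \<le> l ^ Suc b"
    by (cases "Suc b \<le> l") (simp_all only: binomial_le_pow, simp add: binomial_eq_0)
  then have "real (l choose Suc b) \<le> real l * real l ^ b"
    by (metis of_nat_le_iff of_nat_mult of_nat_power power_Suc)
  then have "real l ^ b * real (l choose Suc b) \<le> real l ^ b * (real l * real l ^ b)"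
    by (rule mult_left_mono) simp
  then have "arc_coeff b l \<le> real l ^ b * (real l * real l ^ b) / (real l * fact b)"
    unfolding eq by (rule divide_right_mono) simp
  also have "\<dots> = real l ^ (2 * b) / fact b"
    using assms by (simp add: mult_2 power_add)
  also have "\<dots> \<le> real l ^ (2 * b) / 1"
    by (rule divide_left_mono) (auto simp: fact_ge_1)
  finally show "arc_coeff b l \<le> real l ^ (2 * b)" by simp
qed

lemma tendsto_inverse_sites: "(\<lambda>j. c / real (j + q)) \<longlonglongrightarrow> 0"
proof -
  have "filterlim (\<lambda>j. real (j + q)) at_top sequentially"
    using filterlim_tendsto_add_at_top[OF tendsto_const[of "real q"] filterlim_real_sequentially]
    by (simp add: add.commute)
  then show ?thesis by (intro tendsto_divide_0[OF tendsto_const] filterlim_at_top_imp_at_infinity)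
qed

lemma tendsto_arc_coeff:
  assumes lim: "(\<lambda>j. real (l j) / real (j + q)) \<longlonglongrightarrow> y" and l: "\<And>j. l j > 0" and q: "q > 0"
  shows "(\<lambda>j. arc_coeff b (l j) / real (j + q) ^ (2 * b)) \<longlonglongrightarrow> y ^ (2 * b) / (fact b * fact (b + 1))"
proof -
  have eq: "arc_coeff b (l j) / real (j + q) ^ (2 * b) =
    (real (l j) / real (j + q)) ^ b * (\<Prod>i<b. real (l j) / real (j + q) - real (Suc i) / real (j + q)) / (fact b * fact (b + 1))" for j
  proof -
    have "(\<Prod>i<b. real (l j) / real (j + q) - real (Suc i) / real (j + q)) = (\<Prod>i<b. real (l j) - real (Suc i)) / real (j + q) ^ b"
      by (simp add: diff_divide_distrib[symmetric] prod_dividef)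
    then show ?thesis
      by (simp add: arc_coeff_prod[OF l] power_divide mult_2 power_add)
  qed
  have "(\<lambda>j. (real (l j) / real (j + q)) ^ b * (\<Prod>i<b. real (l j) / real (j + q) - real (Suc i) / real (j + q)) / (fact b * fact (b + 1)))
     \<longlonglongrightarrow> y ^ b * (\<Prod>i<b. y - 0) / (fact b * fact (b + 1))"
    by (intro tendsto_intros lim tendsto_inverse_sites) auto
  moreover have "y ^ b * (\<Prod>i<b. y - 0) = y ^ (2 * b)" by (simp add: mult_2 power_add)
  ultimately show ?thesis by (simp only: eq)
qed

text \<open>With \<open>r = Nh\<close> this limit produces \<open>fact Nh\<close> in the
  density.\<close>

lemma tendsto_binomial_ratio:
  assumes q: "q > 0"
  shows "(\<lambda>j. real (j + q) ^ r / real (j + q choose r)) \<longlonglongrightarrow> fact r"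
proof -
  have eq: "real (j + q) ^ r / real (j + q choose r) = fact r / (\<Prod>i<r. 1 - real i / real (j + q))" for j
  proof -
    have "(\<Prod>i<r. 1 - real i / real (j + q)) = (\<Prod>i<r. (real (j + q) - real i) / real (j + q))"
      using q by (intro prod.cong refl) (simp add: field_simps)
    also have "\<dots> = (\<Prod>i<r. real (j + q) - real i) / real (j + q) ^ r"
      by (simp add: prod_dividef)
    finally show ?thesis unfolding real_binomial_prod by simp
  qed
  have "(\<lambda>j. fact r / (\<Prod>i<r. 1 - real i / real (j + q))) \<longlonglongrightarrow> fact r / (\<Prod>i<r. 1 - 0)"
    by (intro tendsto_intros tendsto_inverse_sites) auto
  then show ?thesis unfolding eq by simp
qed

text \<open>Continuity of the test functions refers to the product topology on all
  sequences.\<close>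

lemma tendsto_fun_coordinatewise:
  fixes f :: "nat \<Rightarrow> 'a \<Rightarrow> real"
  assumes "\<And>i. (\<lambda>j. f j i) \<longlonglongrightarrow> l i"
  shows "f \<longlonglongrightarrow> l"
proof -
  have "limitin (product_topology (\<lambda>i. euclidean) UNIV) f l sequentially"
    unfolding limitin_componentwise using assms by (simp add: euclidean_product_topology)
  then show ?thesis by (simp add: euclidean_product_topology)
qed

section \<open>Sums over a grid as integrals of step functions\<close>

definition cell :: "nat \<Rightarrow> nat \<Rightarrow> (nat \<Rightarrow> real) \<Rightarrow> nat \<Rightarrow> nat" where
  "cell k m x = (\<lambda>i\<in>{..<k}. nat \<lfloor>real m * x i\<rfloor>)"

text \<open>Negative coordinates are excluded explicitly: \<open>nat\<close> sends their floor to 0,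
  which would extend the lowest cells to minus infinity.\<close>

definition cell_fun :: "nat \<Rightarrow> nat \<Rightarrow> (nat \<Rightarrow> nat) set \<Rightarrow> ((nat \<Rightarrow> nat) \<Rightarrow> real) \<Rightarrow> (nat \<Rightarrow> real) \<Rightarrow> real" where
  "cell_fun k m D \<phi> x = (if (\<forall>i<k. 0 \<le> x i) \<and> cell k m x \<in> D then \<phi> (cell k m x) else 0)"

text \<open>The cells are disjoint half-open cubes of side \<open>1 / m\<close>, each of volume
  \<open>1 / m ^ k\<close>.\<close>

lemma
  fixes \<phi> :: "(nat \<Rightarrow> nat) \<Rightarrow> real"
  assumes m: "m > 0" and D: "finite D" "D \<subseteq> {..<k} \<rightarrow>\<^sub>E UNIV"
  shows measurable_cell_fun: "cell_fun k m D \<phi> \<in> borel_measurable (\<Pi>\<^sub>M i\<in>{..<k}. lborel)"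
    and integral_cell_fun: "(\<integral>x. cell_fun k m D \<phi> x \<partial>(\<Pi>\<^sub>M i\<in>{..<k}. lborel)) = (\<Sum>d\<in>D. \<phi> d) / real m ^ k"
proof -
  let ?M = "\<Pi>\<^sub>M i\<in>{..<k}. lborel :: real measure"
  interpret product_sigma_finite "\<lambda>_. lborel :: real measure" ..
  define box where "box d = Pi\<^sub>E {..<k} (\<lambda>i. {real (d i) / real m..<(real (d i) + 1) / real m})" for d :: "nat \<Rightarrow> nat"
  have box_sets: "box d \<in> sets ?M" for d
    unfolding box_def by (intro sets_PiM_I_finite) auto
  have em: "emeasure ?M (box d) = ennreal (1 / real m ^ k)" for d
  proof -
    have "emeasure ?M (box d) = (\<Prod>i<k. emeasure lborel {real (d i) / real m..<(real (d i) + 1) / real m})"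
      unfolding box_def by (intro emeasure_PiM) auto
    also have "\<dots> = (\<Prod>i<k. ennreal (1 / real m))"
      using m by (intro prod.cong refl) (simp add: diff_divide_distrib[symmetric] divide_right_mono)
    also have "\<dots> = ennreal (1 / real m ^ k)"
      by (simp add: ennreal_power power_divide)
    finally show ?thesis .
  qed
  have coord: "a \<in> {real d / real m..<(real d + 1) / real m} \<longleftrightarrow> 0 \<le> a \<and> nat \<lfloor>real m * a\<rfloor> = d" for a d
  proof -
    have "a \<in> {real d / real m..<(real d + 1) / real m} \<longleftrightarrow> real d \<le> real m * a \<and> real m * a < real d + 1"
      using m by (simp add: field_simps)
    also have "\<dots> \<longleftrightarrow> \<lfloor>real m * a\<rfloor> = int d" by (simp add: floor_eq_iff)
    also have "\<dots> \<longleftrightarrow> 0 \<le> \<lfloor>real m * a\<rfloor> \<and> nat \<lfloor>real m * a\<rfloor> = d"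
      by (auto simp del: zero_le_floor)
    also have "0 \<le> \<lfloor>real m * a\<rfloor> \<longleftrightarrow> 0 \<le> a" using m by (simp add: zero_le_mult_iff)
    finally show ?thesis .
  qed
  have box_iff: "x \<in> box d \<longleftrightarrow> (\<forall>i<k. 0 \<le> x i) \<and> cell k m x = d" if x: "x \<in> space ?M" and d: "d \<in> D" for x d
  proof -
    have "x \<in> box d \<longleftrightarrow> (\<forall>i<k. 0 \<le> x i \<and> nat \<lfloor>real m * x i\<rfloor> = d i)"
      using x unfolding box_def PiE_iff coord by (auto simp: space_PiM PiE_iff)
    moreover have "cell k m x = d \<longleftrightarrow> (\<forall>i<k. nat \<lfloor>real m * x i\<rfloor> = d i)"
    proof
      assume "\<forall>i<k. nat \<lfloor>real m * x i\<rfloor> = d i"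
      moreover have "cell k m x \<in> {..<k} \<rightarrow>\<^sub>E UNIV" "d \<in> {..<k} \<rightarrow>\<^sub>E UNIV" using d D by (auto simp: cell_def)
      from PiE_ext[OF this] calculation show "cell k m x = d" by (simp add: cell_def)
    qed (auto simp: cell_def)
    ultimately show ?thesis by blast
  qed
  have eq: "cell_fun k m D \<phi> x = (\<Sum>d\<in>D. \<phi> d * indicator (box d) x)" if x: "x \<in> space ?M" for x
  proof -
    have "(\<Sum>d\<in>D. \<phi> d * indicator (box d) x) = (\<Sum>d\<in>D. if d = cell k m x then (if \<forall>i<k. 0 \<le> x i then \<phi> d else 0) else 0)"
      using box_iff[OF x] by (intro sum.cong refl) (auto simp: indicator_def)
    then show ?thesis using D by (simp add: cell_fun_def sum.delta)
  qed
  have I: "integrable ?M (\<lambda>x. \<phi> d * indicator (box d) x)" for d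
    using box_sets em by (intro integrable_mult_right integrable_real_indicator) auto
  have "(\<lambda>x. \<Sum>d\<in>D. \<phi> d * indicator (box d) x) \<in> borel_measurable ?M"
    using box_sets by (intro borel_measurable_sum borel_measurable_times borel_measurable_const borel_measurable_indicator)
  then show "cell_fun k m D \<phi> \<in> borel_measurable ?M"
    using eq by (subst measurable_cong) auto
  have "(\<integral>x. cell_fun k m D \<phi> x \<partial>?M) = (\<integral>x. (\<Sum>d\<in>D. \<phi> d * indicator (box d) x) \<partial>?M)"
    using eq by (intro Bochner_Integration.integral_cong refl)
  also have "\<dots> = (\<Sum>d\<in>D. \<integral>x. \<phi> d * indicator (box d) x \<partial>?M)"
    by (rule Bochner_Integration.integral_sum) (rule I)
  also have "\<dots> = (\<Sum>d\<in>D. \<phi> d / real m ^ k)"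
  proof (intro sum.cong refl)
    fix d
    have "measure ?M (box d) = 1 / real m ^ k" by (simp add: measure_def em)
    then show "(\<integral>x. \<phi> d * indicator (box d) x \<partial>?M) = \<phi> d / real m ^ k"
      using sets.Int_space_eq2[OF box_sets] by (subst integral_mult_right_zero) simp
  qed
  finally show "(\<integral>x. cell_fun k m D \<phi> x \<partial>?M) = (\<Sum>d\<in>D. \<phi> d) / real m ^ k"
    by (simp add: sum_divide_distrib)
qed

definition occupation_tuples :: "nat \<Rightarrow> nat \<Rightarrow> (nat \<Rightarrow> nat) set" where
  "occupation_tuples L N = {b. b \<in> {..<L} \<rightarrow>\<^sub>E {..N} \<and> sum b {..<L} = N}"

text \<open>With \<open>n = j + (k + 2)\<close> and \<open>L = Suc k\<close>, the factor
  \<open>Suc j\<close> is \<open>m = n - L\<close>. Cells are scaled by \<open>m\<close> but gaps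
  are divided by \<open>n\<close>; the ratio tends to one.\<close>

lemma tendsto_nat_floor_div:
  assumes "0 \<le> a"
  shows "(\<lambda>j. real (nat \<lfloor>real (Suc j) * a\<rfloor>) / real (j + (k + 2))) \<longlonglongrightarrow> a"
proof (rule tendsto_sandwich)
  let ?n = "\<lambda>j. real (j + (k + 2))"
  have n: "?n j > 0" for j by simp
  have eq: "real (Suc j) / ?n j = 1 - (real k + 1) / ?n j" for j by (simp add: field_simps)
  have lim: "(\<lambda>j. real (Suc j) / ?n j) \<longlonglongrightarrow> 1 - 0"
    unfolding eq by (intro tendsto_intros tendsto_inverse_sites)
  show "(\<lambda>j. real (Suc j) / ?n j * a - 1 / ?n j) \<longlonglongrightarrow> a"
    using tendsto_diff[OF tendsto_mult[OF lim tendsto_const[of a]] tendsto_inverse_sites[of 1 "k + 2"]] by simp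
  show "(\<lambda>j. real (Suc j) / ?n j * a) \<longlonglongrightarrow> a"
    using tendsto_mult[OF lim tendsto_const[of a]] by simp
  have fl: "real (Suc j) * a - 1 \<le> real (nat \<lfloor>real (Suc j) * a\<rfloor>)" "real (nat \<lfloor>real (Suc j) * a\<rfloor>) \<le> real (Suc j) * a" for j
  proof -
    have "0 \<le> real (Suc j) * a" using assms by simp
    then have "0 \<le> \<lfloor>real (Suc j) * a\<rfloor>" by (simp only: zero_le_floor)
    then have "real (nat \<lfloor>real (Suc j) * a\<rfloor>) = of_int \<lfloor>real (Suc j) * a\<rfloor>" by simp
    then show "real (Suc j) * a - 1 \<le> real (nat \<lfloor>real (Suc j) * a\<rfloor>)" "real (nat \<lfloor>real (Suc j) * a\<rfloor>) \<le> real (Suc j) * a"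
      by linarith+
  qed
  show "\<forall>\<^sub>F j in sequentially. real (Suc j) / ?n j * a - 1 / ?n j \<le> real (nat \<lfloor>real (Suc j) * a\<rfloor>) / ?n j"
  proof (rule always_eventually, rule allI)
    fix j
    have "(real (Suc j) * a - 1) / ?n j \<le> real (nat \<lfloor>real (Suc j) * a\<rfloor>) / ?n j"
      using fl(1) n by (intro divide_right_mono) auto
    then show "real (Suc j) / ?n j * a - 1 / ?n j \<le> real (nat \<lfloor>real (Suc j) * a\<rfloor>) / ?n j"
      by (simp only: diff_divide_distrib times_divide_eq_left)
  qed
  show "\<forall>\<^sub>F j in sequentially. real (nat \<lfloor>real (Suc j) * a\<rfloor>) / ?n j \<le> real (Suc j) / ?n j * a"
  proof (rule always_eventually, rule allI)
    fix j
    have "real (nat \<lfloor>real (Suc j) * a\<rfloor>) / ?n j \<le> (real (Suc j) * a) / ?n j"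
      using fl(2) n by (intro divide_right_mono) auto
    then show "real (nat \<lfloor>real (Suc j) * a\<rfloor>) / ?n j \<le> real (Suc j) / ?n j * a"
      by (simp only: times_divide_eq_left)
  qed
qed

text \<open>Contribution of one gap vector to the expectation under uniform balls:
  \<open>e 0 + 1\<close> starting points, the chain weight, the test function, and the total mass
  from \<open>sum_chain_power_total\<close> as denominator.\<close>

definition gap_term :: "nat \<Rightarrow> nat \<Rightarrow> ((nat \<Rightarrow> real) \<Rightarrow> real) \<Rightarrow> nat \<Rightarrow> (nat \<Rightarrow> nat) \<Rightarrow> real" where
  "gap_term k N g n e = (real (e 0) + 1) *
     (fact N * (\<Sum>b\<in>occupation_tuples (Suc k) N. \<Prod>i<Suc k. arc_coeff (b i) (e i + 1))) *
     g (\<lambda>i. if i < Suc k then real (e i) / real n else 0) / (real n ^ N * real (n choose (N + Suc k)))"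

text \<open>The powers of \<open>n\<close> balance: \<open>k\<close> from the cells, one from the
  first gap and \<open>2 * N\<close> from the arcs match the \<open>N + (N + Suc k)\<close> of the
  total mass, so each factor on the right can converge by itself.\<close>

lemma gap_term_scaled:
  assumes "n > 0"
  shows "m ^ k * gap_term k N g n e = (m / real n) ^ k * ((real (e 0) + 1) / real n) *
    (fact N * (\<Sum>b\<in>occupation_tuples (Suc k) N. \<Prod>i<Suc k. arc_coeff (b i) (e i + 1) / real n ^ (2 * b i))) *
    g (\<lambda>i. if i < Suc k then real (e i) / real n else 0) * (real n ^ (N + Suc k) / real (n choose (N + Suc k)))"
proof -
  have n: "real n \<noteq> 0" using assms by simp
  have "(\<Prod>i<Suc k. arc_coeff (b i) (e i + 1) / real n ^ (2 * b i)) =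
      (\<Prod>i<Suc k. arc_coeff (b i) (e i + 1)) / real n ^ (2 * N)" if b: "b \<in> occupation_tuples (Suc k) N" for b
  proof -
    have "sum b {..<Suc k} = N" using b by (simp add: occupation_tuples_def)
    then have "(\<Prod>i<Suc k. real n ^ (2 * b i)) = real n ^ (2 * N)"
      by (simp only: power_sum[symmetric] sum_distrib_left[symmetric])
    then show ?thesis by (simp only: prod_dividef)
  qed
  then have sum: "(\<Sum>b\<in>occupation_tuples (Suc k) N. \<Prod>i<Suc k. arc_coeff (b i) (e i + 1) / real n ^ (2 * b i)) =
      (\<Sum>b\<in>occupation_tuples (Suc k) N. \<Prod>i<Suc k. arc_coeff (b i) (e i + 1)) / real n ^ (2 * N)"
    by (simp only: sum_divide_distrib cong: sum.cong)
  have "m ^ k * (a * (f * S) * G / (z ^ N * C)) = (m / z) ^ k * (a / z) * (f * (S / z ^ (2 * N))) * G * (z ^ (N + Suc k) / C)"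
    if "z \<noteq> 0" for a f S G z C :: real
    using that by (simp add: power_divide power_add power_mult field_simps power2_eq_square mult_2)
  from this[OF n] show ?thesis unfolding gap_term_def sum .
qed

lemma gap_complete_le:
  assumes "d \<in> gap_box k m"
  shows "gap_complete k m d i \<le> m"
proof -
  have "d i \<le> m" if "i < k"
    using that assms sum_mono2[of "{..<k}" "{i}" d] by (auto simp: gap_box_def)
  then show ?thesis by (simp add: gap_complete_def)
qed

text \<open>Cells of side \<open>1 / m\<close> with \<open>m = n - L\<close>: the cell of every point of the closed simplex is then
  admissible, so no null set has to be discarded.\<close>

lemma gap_sum_limit:
  fixes g :: "(nat \<Rightarrow> real) \<Rightarrow> real"
  assumes g: "continuous_on UNIV g" and K: "\<And>x. \<bar>g x\<bar> \<le> K"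
  shows "(\<lambda>j. \<Sum>d\<in>gap_box k (Suc j). gap_term k N g (j + (k + 2)) (gap_complete k (Suc j) d))
    \<longlonglongrightarrow> (\<integral>x. g (simplex_point (Suc k) x) * golf_density N (N + Suc k) x \<partial>(\<Pi>\<^sub>M i\<in>{..<k}. lborel))"
proof -
  let ?M = "\<Pi>\<^sub>M i\<in>{..<k}. lborel :: real measure"
  let ?n = "\<lambda>j. j + (k + 2)"
  let ?e = "\<lambda>j. gap_complete k (Suc j)"
  let ?B = "occupation_tuples (Suc k) N"
  interpret product_sigma_finite "\<lambda>_. lborel :: real measure" ..
  \<comment> \<open>The factor \<open>real (Suc j) ^ k\<close> cancels the volume of a cell.\<close>
  define \<phi> where "\<phi> j d = real (Suc j) ^ k * gap_term k N g (?n j) (?e j d)" for j d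
  define s where "s j = cell_fun k (Suc j) (gap_box k (Suc j)) (\<phi> j)" for j
  define f where "f x = g (simplex_point (Suc k) x) * golf_density N (N + Suc k) x" for x
  have box: "finite (gap_box k m)" "gap_box k m \<subseteq> {..<k} \<rightarrow>\<^sub>E UNIV" for m
    by (rule finite_gap_box, auto simp: gap_box_def)
  have s_meas: "s j \<in> borel_measurable ?M" for j
    unfolding s_def by (intro measurable_cell_fun box) simp
  have s_int: "(\<integral>x. s j x \<partial>?M) = (\<Sum>d\<in>gap_box k (Suc j). gap_term k N g (?n j) (?e j d))" for j
  proof -
    have "(\<integral>x. s j x \<partial>?M) = (\<Sum>d\<in>gap_box k (Suc j). \<phi> j d) / real (Suc j) ^ k"
      unfolding s_def by (intro integral_cell_fun box) simp
    then show ?thesis by (simp add: \<phi>_def sum_distrib_left[symmetric])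
  qed
  have ratio: "(\<lambda>j. real (?n j) ^ (N + Suc k) / real (?n j choose (N + Suc k))) \<longlonglongrightarrow> fact (N + Suc k)"
    by (rule tendsto_binomial_ratio) simp
  then have "Bseq (\<lambda>j. real (?n j) ^ (N + Suc k) / real (?n j choose (N + Suc k)))"
    by (rule convergent_imp_Bseq[OF convergentI])
  then obtain R where R': "\<forall>j. norm (real (?n j) ^ (N + Suc k) / real (?n j choose (N + Suc k))) \<le> R"
    by (elim BseqE)
  have R: "\<bar>real (?n j) ^ (N + Suc k) / real (?n j choose (N + Suc k))\<bar> \<le> R" for j
    using R'[rule_format, of j] by (simp only: real_norm_def)
  have K0: "0 \<le> K" using K[of undefined] by linarith
  have R0: "0 \<le> R" using R[of 0] by linarith
  \<comment> \<open>Each product of rescaled arc coefficients is at most 1, so the sum over tuples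
    is at most their number; \<open>R\<close> bounds the convergent ratio.\<close>
  define W where "W = fact N * real (card ?B) * K * R"
  have \<phi>_bound: "\<bar>\<phi> j d\<bar> \<le> W" if d: "d \<in> gap_box k (Suc j)" for j d
  proof -
    let ?S = "\<Sum>b\<in>?B. \<Prod>i<Suc k. arc_coeff (b i) (?e j d i + 1) / real (?n j) ^ (2 * b i)"
    have le: "real (?e j d i + 1) \<le> real (?n j)" for i using gap_complete_le[OF d, of i] by simp
    have unit: "0 \<le> arc_coeff b (?e j d i + 1) / real (?n j) ^ (2 * b)" "arc_coeff b (?e j d i + 1) / real (?n j) ^ (2 * b) \<le> 1" for b i
    proof -
      show "0 \<le> arc_coeff b (?e j d i + 1) / real (?n j) ^ (2 * b)" using arc_coeff_bounds(1)[of "?e j d i + 1" b] by simp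
      have "arc_coeff b (?e j d i + 1) \<le> real (?e j d i + 1) ^ (2 * b)" by (rule arc_coeff_bounds) simp
      also have "\<dots> \<le> real (?n j) ^ (2 * b)" using le by (intro power_mono) auto
      finally show "arc_coeff b (?e j d i + 1) / real (?n j) ^ (2 * b) \<le> 1" by (simp add: divide_le_eq)
    qed
    have S: "0 \<le> ?S" "?S \<le> real (card ?B)"
    proof -
      show "0 \<le> ?S" using unit by (intro sum_nonneg prod_nonneg) auto
      have "?S \<le> (\<Sum>b\<in>?B. 1)" using unit by (intro sum_mono prod_le_1) auto
      then show "?S \<le> real (card ?B)" by simp
    qed
    have scaled: "\<phi> j d = (real (Suc j) / real (?n j)) ^ k * ((real (?e j d 0) + 1) / real (?n j)) * (fact N * ?S) *
        g (\<lambda>i. if i < Suc k then real (?e j d i) / real (?n j) else 0) *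
        (real (?n j) ^ (N + Suc k) / real (?n j choose (N + Suc k)))"
      unfolding \<phi>_def by (rule gap_term_scaled) simp
    have nonneg: "\<bar>(real (Suc j) / real (?n j)) ^ k\<bar> = (real (Suc j) / real (?n j)) ^ k"
      "\<bar>(real (?e j d 0) + 1) / real (?n j)\<bar> = (real (?e j d 0) + 1) / real (?n j)"
      "\<bar>fact N * ?S\<bar> = fact N * ?S"
      using S(1) by (intro abs_of_nonneg; simp)+
    have "\<bar>\<phi> j d\<bar> = (real (Suc j) / real (?n j)) ^ k * ((real (?e j d 0) + 1) / real (?n j)) * (fact N * ?S) *
        \<bar>g (\<lambda>i. if i < Suc k then real (?e j d i) / real (?n j) else 0)\<bar> *
        \<bar>real (?n j) ^ (N + Suc k) / real (?n j choose (N + Suc k))\<bar>"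
      unfolding scaled abs_mult[of _ "real (?n j) ^ (N + Suc k) / real (?n j choose (N + Suc k))"]
        abs_mult[of _ "g (\<lambda>i. if i < Suc k then real (?e j d i) / real (?n j) else 0)"]
        abs_mult[of _ "fact N * ?S"] abs_mult[of "(real (Suc j) / real (?n j)) ^ k"] nonneg ..
    also have "\<dots> \<le> 1 * 1 * (fact N * real (card ?B)) * K * R"
      using le[of 0] S K R K0 R0 by (intro mult_mono) (auto intro!: power_le_one divide_nonneg_nonneg mult_nonneg_nonneg)
    finally show ?thesis by (simp add: W_def)
  qed
  have W0: "0 \<le> W" using K0 R0 by (simp add: W_def)
  \<comment> \<open>A cell in the box forces \<open>x i < 1 + 1 / m \<le> 2\<close>, so this cube
    serves for all \<open>j\<close> at once.\<close>
  define w where "w x = W * indicator (Pi\<^sub>E {..<k} (\<lambda>_. {0..2})) x" for x :: "nat \<Rightarrow> real"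
  have s_bound: "norm (s j x) \<le> w x" if x: "x \<in> space ?M" for j x
  proof (cases "(\<forall>i<k. 0 \<le> x i) \<and> cell k (Suc j) x \<in> gap_box k (Suc j)")
    case True
    have "x i \<le> 2" if i: "i < k" for i
    proof -
      have "gap_complete k (Suc j) (cell k (Suc j) x) i \<le> Suc j" using True by (intro gap_complete_le) simp
      then have "nat \<lfloor>real (Suc j) * x i\<rfloor> \<le> Suc j" using i by (simp add: gap_complete_def cell_def)
      then have "real (Suc j) * x i < real (Suc j) + 1" by linarith
      also have "\<dots> \<le> real (Suc j) * 2" by simp
      finally have "x i < 2" by (subst (asm) mult_less_cancel_left_pos) auto
      then show ?thesis by simp
    qed
    then have "x \<in> Pi\<^sub>E {..<k} (\<lambda>_. {0..2})" using True x by (auto simp: space_PiM PiE_iff)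
    then show ?thesis using \<phi>_bound True by (simp add: s_def cell_fun_def w_def)
  next
    case False
    then have "s j x = 0" unfolding s_def cell_fun_def by (rule if_not_P)
    then show ?thesis using W0 by (simp add: w_def)
  qed
  have w: "integrable ?M w"
  proof -
    have "emeasure ?M (Pi\<^sub>E {..<k} (\<lambda>_. {0..2})) = (\<Prod>i<k. emeasure lborel {0..2::real})"
      by (intro emeasure_PiM) auto
    also have "\<dots> < \<infinity>" by (simp add: less_top[symmetric] power_eq_top_ennreal)
    finally show ?thesis
      unfolding w_def by (intro integrable_mult_right integrable_real_indicator sets_PiM_I_finite) auto
  qed
  have lim: "(\<lambda>j. s j x) \<longlonglongrightarrow> f x" if x: "x \<in> space ?M" for x
  proof (cases "(\<forall>i<k. 0 \<le> x i) \<and> (\<Sum>i<k. x i) \<le> 1")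
    case False
    have "f x = 0"
    proof -
      have "\<not> in_simplex (Suc k) (simplex_point (Suc k) x)"
      proof
        assume *: "in_simplex (Suc k) (simplex_point (Suc k) x)"
        have "0 \<le> x i" if "i < k" for i
          using * that unfolding in_simplex_def by (auto simp: simplex_point_def dest!: spec[of _ i])
        moreover have "0 \<le> simplex_point (Suc k) x k" using * unfolding in_simplex_def by blast
        ultimately show False using False by (simp add: simplex_point_def)
      qed
      then show ?thesis by (simp add: f_def golf_density_def Let_def)
    qed
    moreover have "\<forall>\<^sub>F j in sequentially. s j x = 0"
    proof (cases "\<forall>i<k. 0 \<le> x i")
      case True
      then have gt: "(\<Sum>i<k. x i) - 1 > 0" using False by simp
      \<comment> \<open>Rounding down loses at most 1 per coordinate; once \<open>m\<close> times
        the excess of the sum over 1 is larger than \<open>k\<close>, the cell has left the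
        box.\<close>
      have "\<forall>\<^sub>F j in sequentially. real k / ((\<Sum>i<k. x i) - 1) < real j"
        by (rule filterlim_at_top_dense[THEN iffD1, rule_format, OF filterlim_real_sequentially])
      then show ?thesis
      proof eventually_elim
        case (elim j)
        have "real (Suc j) * ((\<Sum>i<k. x i) - 1) > real k"
        proof -
          have "real k < real j * ((\<Sum>i<k. x i) - 1)" using elim gt by (simp add: divide_less_eq)
          also have "\<dots> \<le> real (Suc j) * ((\<Sum>i<k. x i) - 1)" using gt by (intro mult_right_mono) auto
          finally show ?thesis .
        qed
        moreover have "a * (b - 1) > real k \<Longrightarrow> a < a * b - real k" for a b by (simp add: algebra_simps)
        ultimately have "real (Suc j) < real (Suc j) * (\<Sum>i<k. x i) - real k" by blast
        also have "\<dots> = (\<Sum>i<k. real (Suc j) * x i - 1)"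
          unfolding sum_subtractf sum_distrib_left by simp
        also have "\<dots> \<le> (\<Sum>i<k. real (nat \<lfloor>real (Suc j) * x i\<rfloor>))" by (intro sum_mono) linarith
        also have "\<dots> = real (\<Sum>i<k. cell k (Suc j) x i)" by (simp add: cell_def)
        finally have "\<not> (\<Sum>i<k. cell k (Suc j) x i) \<le> Suc j" by (simp only: of_nat_less_iff not_le)
        then have "cell k (Suc j) x \<notin> gap_box k (Suc j)" by (simp add: gap_box_def)
        then show ?case by (simp add: s_def cell_fun_def)
      qed
    next
      case False
      then have "s j x = 0" for j unfolding s_def cell_fun_def by (intro if_not_P) blast
      then show ?thesis by simp
    qed
    ultimately show ?thesis by (simp add: tendsto_eventually)
  next
    case True
    let ?y = "simplex_point (Suc k) x"
    define c where "c j = ?e j (cell k (Suc j) x)" for j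
    have fl: "real (nat \<lfloor>real (Suc j) * x i\<rfloor>) \<le> real (Suc j) * x i" if "i < k" for i j
    proof -
      have "0 \<le> real (Suc j) * x i" using True that by simp
      then show ?thesis by linarith
    qed
    have in_box: "cell k (Suc j) x \<in> gap_box k (Suc j)" for j
    proof -
      have "real (\<Sum>i<k. cell k (Suc j) x i) = (\<Sum>i<k. real (nat \<lfloor>real (Suc j) * x i\<rfloor>))" by (simp add: cell_def)
      also have "\<dots> \<le> (\<Sum>i<k. real (Suc j) * x i)" using fl by (intro sum_mono) auto
      also have "\<dots> = real (Suc j) * (\<Sum>i<k. x i)" by (rule sum_distrib_left[symmetric])
      also have "\<dots> \<le> real (Suc j) * 1" using True by (intro mult_left_mono) auto
      finally have "(\<Sum>i<k. cell k (Suc j) x i) \<le> Suc j" by (simp only: mult_1_right of_nat_le_iff)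
      moreover have "cell k (Suc j) x \<in> {..<k} \<rightarrow>\<^sub>E UNIV" by (simp add: cell_def)
      ultimately show ?thesis unfolding gap_box_def by blast
    qed
    have s_eq: "s j x = \<phi> j (cell k (Suc j) x)" for j using True in_box by (simp add: s_def cell_fun_def)
    have scale: "(\<lambda>j. real (Suc j) / real (?n j)) \<longlonglongrightarrow> 1"
      using tendsto_nat_floor_div[of 1 k] by simp
    have first: "(\<lambda>j. real (c j i) / real (?n j)) \<longlonglongrightarrow> ?y i" if "i < k" for i
      using tendsto_nat_floor_div[of "x i" k] True that by (simp add: c_def gap_complete_def cell_def simplex_point_def)
    \<comment> \<open>The last gap is the remainder of \<open>m\<close>, so its limit follows from
      \<open>m / n\<close> tending to one.\<close>
    have last: "(\<lambda>j. real (c j k) / real (?n j)) \<longlonglongrightarrow> ?y k"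
    proof -
      have "real (c j k) = real (Suc j) - (\<Sum>i<k. real (c j i))" for j
        using in_box[of j] by (simp add: c_def gap_complete_def gap_box_def of_nat_diff)
      then have "real (c j k) / real (?n j) = real (Suc j) / real (?n j) - (\<Sum>i<k. real (c j i) / real (?n j))" for j
        by (simp only: diff_divide_distrib sum_divide_distrib)
      moreover have "(\<lambda>j. real (Suc j) / real (?n j) - (\<Sum>i<k. real (c j i) / real (?n j))) \<longlonglongrightarrow> 1 - (\<Sum>i<k. ?y i)"
        using first by (intro tendsto_intros scale) auto
      moreover have "1 - (\<Sum>i<k. ?y i) = ?y k" by (simp add: simplex_point_def)
      ultimately show ?thesis by (simp only:)
    qed
    have all: "(\<lambda>j. real (c j i) / real (?n j)) \<longlonglongrightarrow> ?y i" if "i < Suc k" for i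
      using first last that by (cases "i = k") auto
    have all1: "(\<lambda>j. real (c j i + 1) / real (?n j)) \<longlonglongrightarrow> ?y i" if "i < Suc k" for i
      using tendsto_add[OF all[OF that] tendsto_inverse_sites[of 1 "k + 2"]]
      by (simp add: add_divide_distrib add.commute)
    have first1: "(\<lambda>j. (real (c j 0) + 1) / real (?n j)) \<longlonglongrightarrow> ?y 0"
      using all1[OF zero_less_Suc] by (simp only: of_nat_add of_nat_1)
    have vec: "(\<lambda>j. g (\<lambda>i. if i < Suc k then real (c j i) / real (?n j) else 0)) \<longlonglongrightarrow> g ?y"
    proof -
      have "(\<lambda>j. \<lambda>i. if i < Suc k then real (c j i) / real (?n j) else 0) \<longlonglongrightarrow> ?y"
      proof (rule tendsto_fun_coordinatewise)
        fix i
        show "(\<lambda>j. if i < Suc k then real (c j i) / real (?n j) else 0) \<longlonglongrightarrow> ?y i"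
        proof (cases "i < Suc k")
          case False
          then show ?thesis by (simp add: simplex_point_def)
        next
          case True
          then show ?thesis using all[OF True] by (simp only: if_True True)
        qed
      qed
      then show ?thesis by (rule continuous_on_tendsto_compose[OF g]) auto
    qed
    let ?P = "\<lambda>b. \<Prod>i<Suc k. ?y i ^ (2 * b i) / (fact (b i) * fact (b i + 1))"
    have coeffs: "(\<lambda>j. \<Sum>b\<in>?B. \<Prod>i<Suc k. arc_coeff (b i) (c j i + 1) / real (?n j) ^ (2 * b i)) \<longlonglongrightarrow> (\<Sum>b\<in>?B. ?P b)"
      by (intro tendsto_sum tendsto_prod tendsto_arc_coeff all1) auto
    have "(\<lambda>j. (real (Suc j) / real (?n j)) ^ k * ((real (c j 0) + 1) / real (?n j)) *
        (fact N * (\<Sum>b\<in>?B. \<Prod>i<Suc k. arc_coeff (b i) (c j i + 1) / real (?n j) ^ (2 * b i))) *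
        g (\<lambda>i. if i < Suc k then real (c j i) / real (?n j) else 0) *
        (real (?n j) ^ (N + Suc k) / real (?n j choose (N + Suc k))))
      \<longlonglongrightarrow> 1 ^ k * ?y 0 * (fact N * (\<Sum>b\<in>?B. ?P b)) * g ?y * fact (N + Suc k)"
      by (intro tendsto_mult tendsto_power scale coeffs vec ratio tendsto_const first1)
    moreover have "s j x = (real (Suc j) / real (?n j)) ^ k * ((real (c j 0) + 1) / real (?n j)) *
        (fact N * (\<Sum>b\<in>?B. \<Prod>i<Suc k. arc_coeff (b i) (c j i + 1) / real (?n j) ^ (2 * b i))) *
        g (\<lambda>i. if i < Suc k then real (c j i) / real (?n j) else 0) *
        (real (?n j) ^ (N + Suc k) / real (?n j choose (N + Suc k)))" for j
      unfolding s_eq \<phi>_def c_def by (rule gap_term_scaled) simp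
    moreover have "f x = 1 ^ k * ?y 0 * (fact N * (\<Sum>b\<in>?B. ?P b)) * g ?y * fact (N + Suc k)"
    proof -
      have "in_simplex (Suc k) ?y"
        using True by (auto simp: in_simplex_def simplex_point_def less_Suc_eq)
      then have "golf_density N (N + Suc k) x = ?y 0 * fact N * fact (N + Suc k) * (\<Sum>b\<in>?B. ?P b)"
        unfolding golf_density_def occupation_tuples_def Let_def by (simp only: diff_add_inverse if_True mult_1_right)
      then show ?thesis by (simp add: f_def)
    qed
    ultimately show ?thesis by presburger
  qed
  \<comment> \<open>Convergence of the step functions also gives measurability of the limit, with no
    separate analysis of the density.\<close>
  have f_meas: "f \<in> borel_measurable ?M"
    by (rule borel_measurable_LIMSEQ_real[where u = s, OF lim s_meas])
  have "(\<lambda>j. \<integral>x. s j x \<partial>?M) \<longlonglongrightarrow> (\<integral>x. f x \<partial>?M)"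
    by (rule integral_dominated_convergence[where w = w, OF f_meas s_meas w AE_I2[OF lim] AE_I2[OF s_bound]])
  then show ?thesis unfolding s_int f_def .
qed

text \<open>Weight and test function see a hole set only through its gaps, so summing over the
  starting point is a plain factor \<open>e 0 + 1\<close>.\<close>

lemma sum_chain_power_gaps:
  fixes g :: "(nat \<Rightarrow> real) \<Rightarrow> real"
  assumes p: "0 \<le> p" "p \<le> 1" and n: "n = m + Suc k"
  defines "\<gamma> X \<equiv> g (\<lambda>i. if i < Suc k then real (gap n X i) / real n else 0)"
  shows "(\<Sum>X\<in>sites_sets n (Suc k). (chain_step n p ^^ N) (\<lambda>_. 1) X * \<gamma> X) / real (n ^ N * (n choose (N + Suc k))) =
    (\<Sum>d\<in>gap_box k m. gap_term k N g n (gap_complete k m d))"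
proof -
  let ?e = "gap_complete k m"
  define c where "c d = fact N * (\<Sum>b\<in>occupation_tuples (Suc k) N. \<Prod>i<Suc k. arc_coeff (b i) (?e d i + 1))
    * g (\<lambda>i. if i < Suc k then real (?e d i) / real n else 0)" for d
  have weight: "(chain_step n p ^^ N) (\<lambda>_. 1) (hole_set (Suc k) (?e d) t) * \<gamma> (hole_set (Suc k) (?e d) t) = c d"
    if d: "d \<in> gap_box k m" and t: "t \<le> ?e d 0" for d t
  proof -
    have e: "(\<Sum>i<Suc k. ?e d i) + Suc k = n" using sum_gap_complete[OF d] n by simp
    let ?X = "hole_set (Suc k) (?e d) t"
    have X: "?X \<in> sites_sets n (Suc k)" by (rule hole_set_sites[OF _ e t]) simp
    then have "?X \<noteq> {}" by auto
    then have "(chain_step n p ^^ N) (\<lambda>_. 1) ?X = fact N * fps_nth (\<Prod>x\<in>?X. arc_fps (cyc_gap n ?X x)) N"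
      using X by (intro chain_step_power_arcs[OF p]) auto
    also have "(\<Prod>x\<in>?X. arc_fps (cyc_gap n ?X x)) = (\<Prod>i<Suc k. arc_fps (?e d i + 1))"
      by (rule prod_cyc_gap_hole_set[OF _ e t]) simp
    also have "fps_nth (\<Prod>i<Suc k. arc_fps (?e d i + 1)) N =
        (\<Sum>b\<in>occupation_tuples (Suc k) N. \<Prod>i<Suc k. arc_coeff (b i) (?e d i + 1))"
      unfolding fps_nth_prod_lessThan[OF zero_less_Suc] occupation_tuples_def by (simp only: arc_fps_def fps_nth_Abs_fps)
    finally have "(chain_step n p ^^ N) (\<lambda>_. 1) ?X =
        fact N * (\<Sum>b\<in>occupation_tuples (Suc k) N. \<Prod>i<Suc k. arc_coeff (b i) (?e d i + 1))" .
    moreover have "\<gamma> ?X = g (\<lambda>i. if i < Suc k then real (?e d i) / real n else 0)"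
    proof -
      have "(\<lambda>i. if i < Suc k then real (gap n ?X i) / real n else 0) = (\<lambda>i. if i < Suc k then real (?e d i) / real n else 0)"
        using gap_hole_set[OF zero_less_Suc e t] by (intro ext if_cong refl) simp
      then show ?thesis unfolding \<gamma>_def by (rule arg_cong)
    qed
    ultimately show ?thesis by (simp only: c_def)
  qed
  have "(\<Sum>X\<in>sites_sets n (Suc k). (chain_step n p ^^ N) (\<lambda>_. 1) X * \<gamma> X) =
    (\<Sum>(d, t)\<in>(SIGMA d:gap_box k m. {..?e d 0}). (chain_step n p ^^ N) (\<lambda>_. 1) (hole_set (Suc k) (?e d) t) * \<gamma> (hole_set (Suc k) (?e d) t))"
    unfolding n by (subst sum.reindex_bij_betw[OF bij_betw_hole_set, symmetric]) (simp only: case_prod_unfold)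
  also have "\<dots> = (\<Sum>(d, t)\<in>(SIGMA d:gap_box k m. {..?e d 0}). c d)"
    by (rule sum.cong[OF refl]) (use weight in auto)
  also have "\<dots> = (\<Sum>d\<in>gap_box k m. \<Sum>t\<le>?e d 0. c d)"
    by (rule sum.Sigma[symmetric]) (auto simp: finite_gap_box)
  also have "\<dots> = (\<Sum>d\<in>gap_box k m. (real (?e d 0) + 1) * c d)"
    by (simp add: add.commute)
  finally have total: "(\<Sum>X\<in>sites_sets n (Suc k). (chain_step n p ^^ N) (\<lambda>_. 1) X * \<gamma> X) =
    (\<Sum>d\<in>gap_box k m. (real (?e d 0) + 1) * c d)" .
  have "gap_term k N g n (?e d) = (real (?e d 0) + 1) * c d / real (n ^ N * (n choose (N + Suc k)))" for d
    by (simp only: gap_term_def c_def mult.assoc of_nat_mult of_nat_power)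
  then show ?thesis unfolding total sum_divide_distrib by (simp only:)
qed

text \<open>Vectors are padded by zeros in \<open>gap_vector\<close> and in
  \<open>simplex_point\<close>, so one topology serves every length. The choice \<open>g = 1\<close>
  shows that the limiting density has total mass one.\<close>

theorem mainTheorem3:
  fixes Nb Nh :: nat and p :: real
  assumes "Nb < Nh" and "0 \<le> p" and "p \<le> 1"
  shows "\<forall>g :: (nat \<Rightarrow> real) \<Rightarrow> real. continuous_on UNIV g \<and> bounded (range g) \<longrightarrow>
    (\<lambda>n. \<integral>\<omega>. g (gap_vector n Nb Nh \<omega>) \<partial>golf_space n Nb Nh p)
    \<longlonglongrightarrow> (\<integral>x. g (simplex_point (Nh - Nb) x) * golf_density Nb Nh x
          \<partial>(\<Pi>\<^sub>M i\<in>{..<Nh - Nb - 1}. lborel))"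
proof (intro allI impI, elim conjE)
  fix g :: "(nat \<Rightarrow> real) \<Rightarrow> real"
  assume cont: "continuous_on UNIV g" and bdd: "bounded (range g)"
  obtain k where k: "Nh = Nb + Suc k" using assms(1) less_iff_Suc_add by auto
  obtain K where K: "\<And>x. \<bar>g x\<bar> \<le> K" using bdd by (auto simp: bounded_iff)
  \<comment> \<open>The offset makes \<open>m = n - L = Suc j\<close> positive, so that cells of
    side \<open>1 / m\<close> make sense.\<close>
  let ?n = "\<lambda>j. j + (k + 2)"
  let ?L = "\<integral>x. g (simplex_point (Nh - Nb) x) * golf_density Nb Nh x \<partial>(\<Pi>\<^sub>M i\<in>{..<Nh - Nb - 1}. lborel)"
  define E where "E n = (\<integral>\<omega>. g (gap_vector n Nb Nh \<omega>) \<partial>golf_space n Nb Nh p)" for n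
  define T where "T j = (\<Sum>d\<in>gap_box k (Suc j). gap_term k Nb g (?n j) (gap_complete k (Suc j) d))" for j
  \<comment> \<open>The proportion of pairs of launch list and hole set that stem from an admissible
    configuration.\<close>
  define r where "r n = fact Nb * real (card (golf_configs n Nb Nh)) / real (n ^ Nb * (n choose Nh))" for n
  have T: "T \<longlonglongrightarrow> ?L"
    unfolding T_def[abs_def] using gap_sum_limit[OF cont K, of k Nb] by (simp add: k)
  have large: "\<forall>\<^sub>F j in sequentially. Nb + Nh \<le> ?n j"
    using eventually_ge_at_top[of "Nb + Nh"] by eventually_elim simp
  have r: "(\<lambda>j. r (?n j)) \<longlonglongrightarrow> 1"
  proof -
    have "\<forall>\<^sub>F j in sequentially. (\<Prod>i<Nb. 1 - real (Nh + i) / real (?n j)) = r (?n j)"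
      using large
    proof eventually_elim
      case (elim j)
      have "fact Nb * real (?n j - Nh choose Nb) = (\<Prod>i<Nb. real (?n j) - real (Nh + i))"
        using elim unfolding real_binomial_prod by (simp add: of_nat_diff algebra_simps)
      then have "fact Nb * real (?n j - Nh choose Nb) / real (?n j) ^ Nb = (\<Prod>i<Nb. (real (?n j) - real (Nh + i)) / real (?n j))"
        by (simp only: prod_dividef) simp
      also have "\<dots> = (\<Prod>i<Nb. 1 - real (Nh + i) / real (?n j))"
        by (intro prod.cong refl) (simp add: diff_divide_distrib)
      moreover have "r (?n j) = fact Nb * real (?n j - Nh choose Nb) / real (?n j) ^ Nb"
        using elim by (simp add: r_def card_golf_configs)
      ultimately show ?case by simp
    qed
    moreover have "(\<lambda>j. \<Prod>i<Nb. 1 - real (Nh + i) / real (?n j)) \<longlonglongrightarrow> (\<Prod>i<Nb. 1 - 0)"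
      by (intro tendsto_intros tendsto_inverse_sites)
    ultimately have "(\<lambda>j. r (?n j)) \<longlonglongrightarrow> (\<Prod>i<Nb. 1 - 0)"
      by (rule Lim_transform_eventually[rotated])
    then show ?thesis by simp
  qed
  have diff: "\<forall>\<^sub>F j in sequentially. \<bar>E (?n j) * r (?n j) - T j\<bar> \<le> K * (1 - r (?n j))"
    using large
  proof eventually_elim
    case (elim j)
    let ?\<gamma> = "\<lambda>X. g (\<lambda>i. if i < Suc k then real (gap (?n j) X i) / real (?n j) else 0)"
    let ?A = "real (?n j ^ Nb * (?n j choose Nh))"
    have "0 < ?n j choose Nh" using elim by (intro zero_less_binomial) simp
    then have "0 < ?n j ^ Nb * (?n j choose Nh)" by (intro mult_pos_pos zero_less_power) simp
    then have A: "?A > 0" by (simp only: of_nat_0_less_iff)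
    have E: "E (?n j) = (\<integral>\<omega>. ?\<gamma> (golf_H1 (?n j) \<omega>) \<partial>golf_space (?n j) Nb Nh p)"
      unfolding E_def gap_vector_def by (simp add: k)
    have "\<bar>E (?n j) * (fact Nb * real (card (golf_configs (?n j) Nb Nh)))
       - (\<Sum>X\<in>sites_sets (?n j) (Nh - Nb). (chain_step (?n j) p ^^ Nb) (\<lambda>_. 1) X * ?\<gamma> X)\<bar>
      \<le> K * (?A - fact Nb * real (card (golf_configs (?n j) Nb Nh)))"
      unfolding E by (rule golf_space_chain_difference[OF assms(2,3,1) elim]) (rule K)
    then have "\<bar>E (?n j) * (fact Nb * real (card (golf_configs (?n j) Nb Nh)))
       - (\<Sum>X\<in>sites_sets (?n j) (Nh - Nb). (chain_step (?n j) p ^^ Nb) (\<lambda>_. 1) X * ?\<gamma> X)\<bar> / ?A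
      \<le> K * (?A - fact Nb * real (card (golf_configs (?n j) Nb Nh))) / ?A"
      using A by (intro divide_right_mono) auto
    moreover have "\<bar>x * (y / a) - z / a\<bar> \<le> K * (1 - y / a)"
      if "\<bar>x * y - z\<bar> / a \<le> K * (a - y) / a" "a > 0" for x y z a :: real
    proof -
      have "x * (y / a) - z / a = (x * y - z) / a" "K * (1 - y / a) = K * (a - y) / a"
        using that(2) by (simp_all add: field_simps)
      then show ?thesis using that by (simp add: abs_divide)
    qed
    ultimately have "\<bar>E (?n j) * (fact Nb * real (card (golf_configs (?n j) Nb Nh)) / ?A)
       - (\<Sum>X\<in>sites_sets (?n j) (Nh - Nb). (chain_step (?n j) p ^^ Nb) (\<lambda>_. 1) X * ?\<gamma> X) / ?A\<bar>
      \<le> K * (1 - fact Nb * real (card (golf_configs (?n j) Nb Nh)) / ?A)"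
      using A by blast
    moreover have "(\<Sum>X\<in>sites_sets (?n j) (Nh - Nb). (chain_step (?n j) p ^^ Nb) (\<lambda>_. 1) X * ?\<gamma> X) / ?A = T j"
      using sum_chain_power_gaps[OF assms(2,3), where n = "?n j" and m = "Suc j" and k = k and N = Nb and g = g]
      unfolding k T_def by simp
    ultimately show ?case unfolding r_def by (simp only:)
  qed
  \<comment> \<open>\<open>E * r\<close> is the share of the unrestricted average that comes from
    admissible pairs, \<open>T\<close> the whole average; the rest vanishes as \<open>r\<close>
    tends to one, and division by \<open>r\<close> then recovers \<open>E\<close>.\<close>
  have "(\<lambda>j. E (?n j) * r (?n j) - T j) \<longlonglongrightarrow> 0"
  proof (rule Lim_null_comparison)
    show "\<forall>\<^sub>F j in sequentially. norm (E (?n j) * r (?n j) - T j) \<le> K * (1 - r (?n j))"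
      using diff by simp
    show "(\<lambda>j. K * (1 - r (?n j))) \<longlonglongrightarrow> 0"
      using tendsto_mult[OF tendsto_const[of K] tendsto_diff[OF tendsto_const[of 1] r]] by simp
  qed
  from tendsto_add[OF this T] have "(\<lambda>j. E (?n j) * r (?n j)) \<longlonglongrightarrow> ?L" by simp
  from tendsto_divide[OF this r] have lim: "(\<lambda>j. E (?n j) * r (?n j) / r (?n j)) \<longlonglongrightarrow> ?L" by simp
  have "\<forall>\<^sub>F j in sequentially. r (?n j) > 0"
    using r by (rule order_tendstoD(1)) simp
  then have "\<forall>\<^sub>F j in sequentially. E (?n j) * r (?n j) / r (?n j) = E (?n j)"
    by eventually_elim simp
  from Lim_transform_eventually[OF lim this] have "(\<lambda>j. E (?n j)) \<longlonglongrightarrow> ?L" .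
  then show "(\<lambda>n. \<integral>\<omega>. g (gap_vector n Nb Nh \<omega>) \<partial>golf_space n Nb Nh p) \<longlonglongrightarrow> ?L"
    unfolding E_def by (rule LIMSEQ_offset)
qed

end
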